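(* For every normalized binary goods instance with at most seven agents, the algorithm Level-and-Scatter (described in the context) computes, in polynomial time, an allocation that is both EF1 and EQ1.
   Context: An instance consists of agents $N=\{1,\dots,n\}$, a finite set $M$ of indivisible items, and for each agent $i$ an additive valuation $v_i:2^M\to\mathbb{R}$, i.e. $v_i(\emptyset)=0$ and $v_i(S)=\sum_{o\in S}v_i(o)$. It is a binary goods instance if $v_i(o)\in\{0,1\}$ for all $i,o$; "agent $i$ values $o$" means $v_i(o)=1$. It is normalized if $v_i(M)=v_j(M)$ for all $i,j\in N$. An allocation $A=(A_1,\dots,A_n)$ is a partition of $M$ into $n$ pairwise disjoint, possibly empty bundles with union $M$. For goods: $A$ is EF1 if for all $i,j\in N$ with $A_j\neq\emptyset$ there is $g\in A_j$ with $v_i(A_i)\ge v_i(A_j\setminus\{g\})$. $A$ is EQ1 if for all $i,j\in N$ with $A_j\neq\emptyset$ there is $g\in A_j$ with $v_i(A_i)\ge v_j(A_j\setminus\{g\})$. Algorithm Level-and-Scatter: 1. Remove from $M$ all goods valued at $0$ by every agent; store them in $J$. Below $M$ denotes the remaining goods. 2. Compute the largest integer $t$ such that there are pairwise disjoint sets of goods, one per agent, each consisting of $t$ goods valued by that agent. Set $B=t+1$. 3. Among all families $P=(P_1,\dots,P_n)$ of pairwise disjoint subsets of $M$ such that every good in $P_i$ is valued by $i$ and $t\le|P_i|\le B$ for every $i$, compute one maximizing the number $\sum_i|P_i|$ of assigned goods. 4. Let $R=M\setminus\bigcup_{i\in N}P_i$. 5. Form the residual alternating graph on agents and goods: a directed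 edge from each agent $i$ to each good in $P_i$; and, from each good $g$ to each agent $i$ with $v_i(g)=1$ and $g\notin P_i$ (so $g$ is unowned or owned by another agent). Let $S$ be the set of agents reachable from $R$ in this graph. For $g\in R\cup\bigcup_{i\in S}P_i$ define $\tau(g)=\{i\in S: v_i(g)=1\}$. ($S$ is fixed from here on.) 6. Swap phase: while there exist $g\in R$, $h\in S$ and $g'\in P_h$ with $\tau(g)=S$ and $\tau(g')\ne S$, replace $P_h$ by $(P_h\setminus\{g'\})\cup\{g\}$ and $R$ by $(R\setminus\{g\})\cup\{g'\}$. 7. Set $A_i=P_i$ for all $i\in N$. Scattering phase: for each $g\in R$ (one at a time, in any order), let $T=\tau(g)$, choose $j\in N\setminus T$ such that $v_i(A_j\cup\{g\})\le B$ for every $i\in T$, and add $g$ to $A_j$. 8. Distribute the goods in $J$ arbitrarily among the agents; return $(A_1,\dots,A_n)$. That the algorithm computes such an allocation includes that the choice in step 7 is always possible. *)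

theory Defs
  imports "HOL-Library.Disjoint_Sets" "HOL-Computational_Algebra.Polynomial" Complex_Main
begin

section \<open>Instances, allocations, fairness\<close>

abbreviation agents :: "nat \<Rightarrow> nat set" where
  "agents n \<equiv> {1..n}"

definition additive_valuation :: "'a set \<Rightarrow> ('a set \<Rightarrow> real) \<Rightarrow> bool" where
  "additive_valuation M u \<longleftrightarrow> u {} = 0 \<and> (\<forall>X\<subseteq>M. u X = (\<Sum>g\<in>X. u {g}))"

definition binary_goods_instance :: "nat \<Rightarrow> 'a set \<Rightarrow> (nat \<Rightarrow> 'a set \<Rightarrow> real) \<Rightarrow> bool" where
  "binary_goods_instance n M v \<longleftrightarrow>
     n \<ge> 1 \<and> finite M \<and>
     (\<forall>i\<in>agents n. additive_valuation M (v i)) \<and>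
     (\<forall>i\<in>agents n. \<forall>g\<in>M. v i {g} \<in> {0, 1})"

definition normalized :: "nat \<Rightarrow> 'a set \<Rightarrow> (nat \<Rightarrow> 'a set \<Rightarrow> real) \<Rightarrow> bool" where
  "normalized n M v \<longleftrightarrow> (\<forall>i\<in>agents n. \<forall>j\<in>agents n. v i M = v j M)"

definition allocation :: "nat \<Rightarrow> 'a set \<Rightarrow> (nat \<Rightarrow> 'a set) \<Rightarrow> bool" where
  "allocation n M A \<longleftrightarrow> disjoint_family_on A (agents n) \<and> (\<Union>i\<in>agents n. A i) = M"

definition EF1 :: "nat \<Rightarrow> (nat \<Rightarrow> 'a set \<Rightarrow> real) \<Rightarrow> (nat \<Rightarrow> 'a set) \<Rightarrow> bool" where
  "EF1 n v A \<longleftrightarrow>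
     (\<forall>i\<in>agents n. \<forall>j\<in>agents n. A j \<noteq> {} \<longrightarrow> (\<exists>g\<in>A j. v i (A i) \<ge> v i (A j - {g})))"

definition EQ1 :: "nat \<Rightarrow> (nat \<Rightarrow> 'a set \<Rightarrow> real) \<Rightarrow> (nat \<Rightarrow> 'a set) \<Rightarrow> bool" where
  "EQ1 n v A \<longleftrightarrow>
     (\<forall>i\<in>agents n. \<forall>j\<in>agents n. A j \<noteq> {} \<longrightarrow> (\<exists>g\<in>A j. v i (A i) \<ge> v j (A j - {g})))"


section \<open>Level-and-Scatter as a nondeterministic transition system\<close>

definition junk :: "nat \<Rightarrow> 'a set \<Rightarrow> (nat \<Rightarrow> 'a set \<Rightarrow> real) \<Rightarrow> 'a set" where
  "junk n M v = {g \<in> M. \<forall>i\<in>agents n. v i {g} = 0}"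

definition valued_families ::
  "nat \<Rightarrow> 'a set \<Rightarrow> (nat \<Rightarrow> 'a set \<Rightarrow> real) \<Rightarrow> (nat \<Rightarrow> 'a set) set" where
  "valued_families n M v =
     {P. disjoint_family_on P (agents n) \<and>
         (\<forall>i\<in>agents n. P i \<subseteq> M - junk n M v \<and> (\<forall>g\<in>P i. v i {g} = 1))}"

definition level :: "nat \<Rightarrow> 'a set \<Rightarrow> (nat \<Rightarrow> 'a set \<Rightarrow> real) \<Rightarrow> nat" where
  "level n M v = (GREATEST t. \<exists>P \<in> valued_families n M v. \<forall>i\<in>agents n. card (P i) = t)"

definition cap :: "nat \<Rightarrow> 'a set \<Rightarrow> (nat \<Rightarrow> 'a set \<Rightarrow> real) \<Rightarrow> nat" where
  "cap n M v = level n M v + 1"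

definition max_level_family ::
  "nat \<Rightarrow> 'a set \<Rightarrow> (nat \<Rightarrow> 'a set \<Rightarrow> real) \<Rightarrow> (nat \<Rightarrow> 'a set) \<Rightarrow> bool" where
  "max_level_family n M v =
     is_arg_max (\<lambda>P. \<Sum>i\<in>agents n. card (P i))
       (\<lambda>P. P \<in> valued_families n M v \<and>
            (\<forall>i\<in>agents n. level n M v \<le> card (P i) \<and> card (P i) \<le> cap n M v))"

definition unassigned ::
  "nat \<Rightarrow> 'a set \<Rightarrow> (nat \<Rightarrow> 'a set \<Rightarrow> real) \<Rightarrow> (nat \<Rightarrow> 'a set) \<Rightarrow> 'a set" where
  "unassigned n M v P = (M - junk n M v) - (\<Union>i\<in>agents n. P i)"

text \<open>Vertices of the residual graph: agents are tagged by \<open>Inl\<close>, goods by \<open>Inr\<close>.\<close>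

definition residual_graph ::
  "nat \<Rightarrow> 'a set \<Rightarrow> (nat \<Rightarrow> 'a set \<Rightarrow> real) \<Rightarrow> (nat \<Rightarrow> 'a set) \<Rightarrow> ((nat + 'a) \<times> (nat + 'a)) set" where
  "residual_graph n M v P =
     {(Inl i, Inr g) | i g. i \<in> agents n \<and> g \<in> P i} \<union>
     {(Inr g, Inl i) | i g. g \<in> M - junk n M v \<and> i \<in> agents n \<and> v i {g} = 1 \<and> g \<notin> P i}"

definition reachable_agents ::
  "nat \<Rightarrow> 'a set \<Rightarrow> (nat \<Rightarrow> 'a set \<Rightarrow> real) \<Rightarrow> (nat \<Rightarrow> 'a set) \<Rightarrow> nat set" where
  "reachable_agents n M v P =
     {i \<in> agents n. \<exists>g\<in>unassigned n M v P. (Inr g, Inl i) \<in> (residual_graph n M v P)\<^sup>*}"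

definition tau :: "(nat \<Rightarrow> 'a set \<Rightarrow> real) \<Rightarrow> nat set \<Rightarrow> 'a \<Rightarrow> nat set" where
  "tau v S g = {i \<in> S. v i {g} = 1}"

definition swappable ::
  "(nat \<Rightarrow> 'a set \<Rightarrow> real) \<Rightarrow> nat set \<Rightarrow> (nat \<Rightarrow> 'a set) \<Rightarrow> 'a set \<Rightarrow> 'a \<Rightarrow> nat \<Rightarrow> 'a \<Rightarrow> bool" where
  "swappable v S P R g h g' \<longleftrightarrow>
     g \<in> R \<and> h \<in> S \<and> g' \<in> P h \<and> tau v S g = S \<and> tau v S g' \<noteq> S"

text \<open>
  \<open>Swapping S P R\<close> and \<open>Scattering S A R\<close> are the loop heads of the two phases.
  In \<open>Placing S A R g\<close> the good \<open>g\<close> has been picked (and removed from \<open>R\<close>) but its receiver has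
  not been chosen yet.  Picking and placing are separate transitions, so that for any order of
  the goods the absence of an admissible receiver shows up as a stuck configuration.
\<close>

datatype 'a config =
    Start
  | Swapping "nat set" "nat \<Rightarrow> 'a set" "'a set"
  | Scattering "nat set" "nat \<Rightarrow> 'a set" "'a set"
  | Placing "nat set" "nat \<Rightarrow> 'a set" "'a set" 'a
  | Done "nat \<Rightarrow> 'a set"

inductive ls_step ::
  "nat \<Rightarrow> 'a set \<Rightarrow> (nat \<Rightarrow> 'a set \<Rightarrow> real) \<Rightarrow> 'a config \<Rightarrow> 'a config \<Rightarrow> bool"
  for n M v where
  level: "max_level_family n M v P \<Longrightarrow>
      ls_step n M v Start (Swapping (reachable_agents n M v P) P (unassigned n M v P))"
| swap: "swappable v S P R g h g' \<Longrightarrow>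
      ls_step n M v (Swapping S P R)
        (Swapping S (P(h := (P h - {g'}) \<union> {g})) ((R - {g}) \<union> {g'}))"
| swap_exit: "\<nexists>g h g'. swappable v S P R g h g' \<Longrightarrow>
      ls_step n M v (Swapping S P R) (Scattering S P R)"
| pick: "g \<in> R \<Longrightarrow>
      ls_step n M v (Scattering S A R) (Placing S A (R - {g}) g)"
| place: "j \<in> agents n - tau v S g \<Longrightarrow>
      \<forall>i\<in>tau v S g. v i (A j \<union> {g}) \<le> real (cap n M v) \<Longrightarrow>
      ls_step n M v (Placing S A R g) (Scattering S (A(j := A j \<union> {g})) R)"
| finish: "disjoint_family_on D (agents n) \<Longrightarrow> (\<Union>i\<in>agents n. D i) = junk n M v \<Longrightarrow>
      ls_step n M v (Scattering S A {}) (Done (\<lambda>i. A i \<union> D i))"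


section \<open>A machine model for running time\<close>

text \<open>
  While programs over named two-dimensional arrays of natural numbers, at unit cost per executed
  command or test.  The only arithmetic is addition and truncated subtraction, so in \<open>T\<close> steps
  numbers grow to \<open>O(T)\<close> bits at most and polynomial time in this model is polynomial time on a
  Turing machine; multiplication is left out because at unit cost it would break this.
\<close>

type_synonym store = "string \<Rightarrow> nat \<Rightarrow> nat \<Rightarrow> nat"

datatype expr = Const nat | Cell string expr expr | Add expr expr | Sub expr expr

datatype test = Lt expr expr | Neg test | Conj test test

datatype prog =
    Skip
  | Assign string expr expr expr
  | Seq prog prog
  | Cond test prog prog
  | Loop test prog

primrec eval_expr :: "expr \<Rightarrow> store \<Rightarrow> nat" where
  "eval_expr (Const k) s = k"
| "eval_expr (Cell x a b) s = s x (eval_expr a s) (eval_expr b s)"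
| "eval_expr (Add a b) s = eval_expr a s + eval_expr b s"
| "eval_expr (Sub a b) s = eval_expr a s - eval_expr b s"

primrec eval_test :: "test \<Rightarrow> store \<Rightarrow> bool" where
  "eval_test (Lt a b) s \<longleftrightarrow> eval_expr a s < eval_expr b s"
| "eval_test (Neg t) s \<longleftrightarrow> \<not> eval_test t s"
| "eval_test (Conj t u) s \<longleftrightarrow> eval_test t s \<and> eval_test u s"

definition store_upd :: "string \<Rightarrow> nat \<Rightarrow> nat \<Rightarrow> nat \<Rightarrow> store \<Rightarrow> store" where
  "store_upd x a b k s = s(x := (s x)(a := (s x a)(b := k)))"

inductive exec :: "prog \<Rightarrow> store \<Rightarrow> nat \<Rightarrow> store \<Rightarrow> bool" where
  Skip: "exec Skip s 1 s"
| Assign: "exec (Assign x a b e) s 1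
             (store_upd x (eval_expr a s) (eval_expr b s) (eval_expr e s) s)"
| Seq: "exec p s T s' \<Longrightarrow> exec q s' U s'' \<Longrightarrow> exec (Seq p q) s (T + U) s''"
| Cond_True: "eval_test t s \<Longrightarrow> exec p s T s' \<Longrightarrow> exec (Cond t p q) s (T + 1) s'"
| Cond_False: "\<not> eval_test t s \<Longrightarrow> exec q s T s' \<Longrightarrow> exec (Cond t p q) s (T + 1) s'"
| Loop_False: "\<not> eval_test t s \<Longrightarrow> exec (Loop t p) s 1 s"
| Loop_True: "eval_test t s \<Longrightarrow> exec p s T s' \<Longrightarrow> exec (Loop t p) s' U s'' \<Longrightarrow>
              exec (Loop t p) s (T + U + 1) s''"


section \<open>Programs executing Level-and-Scatter\<close>

text \<open>
  The list \<open>xs\<close> enumerates the items; programs refer to an item by its position in \<open>xs\<close>.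
  Scalars are held at index (0, 0) and vectors in column 0.
\<close>

definition input_store :: "nat \<Rightarrow> (nat \<Rightarrow> 'a set \<Rightarrow> real) \<Rightarrow> 'a list \<Rightarrow> store" where
  "input_store n v xs = (\<lambda>x a b.
     if x = ''n'' \<and> a = 0 \<and> b = 0 then n
     else if x = ''m'' \<and> a = 0 \<and> b = 0 then length xs
     else if x = ''val'' \<and> a \<in> agents n \<and> b < length xs \<and> v a {xs ! b} = 1 then 1
     else 0)"

text \<open>In array \<open>owner\<close>, 0 marks an item held by no agent.\<close>

definition encodes_bundles :: "nat \<Rightarrow> 'a list \<Rightarrow> (nat \<Rightarrow> 'a set) \<Rightarrow> store \<Rightarrow> bool" where
  "encodes_bundles n xs P s \<longleftrightarrow>
     (\<forall>k<length xs. s ''owner'' k 0 \<le> n \<and>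
        (\<forall>i\<in>agents n. s ''owner'' k 0 = i \<longleftrightarrow> xs ! k \<in> P i))"

definition encodes_sets ::
  "nat \<Rightarrow> 'a list \<Rightarrow> nat set \<Rightarrow> 'a set \<Rightarrow> store \<Rightarrow> bool" where
  "encodes_sets n xs S R s \<longleftrightarrow>
     (\<forall>i\<in>agents n. s ''S'' i 0 = of_bool (i \<in> S)) \<and>
     (\<forall>k<length xs. s ''R'' k 0 = of_bool (xs ! k \<in> R))"

primrec encodes ::
  "nat \<Rightarrow> 'a set \<Rightarrow> (nat \<Rightarrow> 'a set \<Rightarrow> real) \<Rightarrow> 'a list \<Rightarrow> 'a config \<Rightarrow> store \<Rightarrow> bool" where
  "encodes n M v xs Start s \<longleftrightarrow> s = input_store n v xs"
| "encodes n M v xs (Swapping S P R) s \<longleftrightarrow>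
     s ''phase'' 0 0 = 1 \<and> s ''B'' 0 0 = cap n M v \<and>
     encodes_bundles n xs P s \<and> encodes_sets n xs S R s"
| "encodes n M v xs (Scattering S A R) s \<longleftrightarrow>
     s ''phase'' 0 0 = 2 \<and> s ''B'' 0 0 = cap n M v \<and>
     encodes_bundles n xs A s \<and> encodes_sets n xs S R s"
| "encodes n M v xs (Placing S A R g) s \<longleftrightarrow>
     s ''phase'' 0 0 = 3 \<and> s ''B'' 0 0 = cap n M v \<and>
     encodes_bundles n xs A s \<and> encodes_sets n xs S R s \<and>
     s ''item'' 0 0 < length xs \<and> xs ! (s ''item'' 0 0) = g"
| "encodes n M v xs (Done A) s \<longleftrightarrow>
     s ''phase'' 0 0 = 4 \<and> encodes_bundles n xs A s"

text \<open>
  \<open>tracks n M v xs body c s c' s'\<close>: repeated execution of \<open>body\<close> leads from store \<open>s\<close> to store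
  \<open>s'\<close>, and the stores in between encode, one by one, the configurations of a run of
  Level-and-Scatter from \<open>c\<close> to \<open>c'\<close>.
\<close>

inductive tracks ::
  "nat \<Rightarrow> 'a set \<Rightarrow> (nat \<Rightarrow> 'a set \<Rightarrow> real) \<Rightarrow> 'a list \<Rightarrow> prog \<Rightarrow>
   'a config \<Rightarrow> store \<Rightarrow> 'a config \<Rightarrow> store \<Rightarrow> bool"
  for n M v xs body where
  refl: "encodes n M v xs c s \<Longrightarrow> tracks n M v xs body c s c s"
| step: "encodes n M v xs c s \<Longrightarrow> ls_step n M v c c' \<Longrightarrow> exec body s T s' \<Longrightarrow>
         tracks n M v xs body c' s' c'' s'' \<Longrightarrow> tracks n M v xs body c s c'' s''"

text \<open>The program with loop body \<open>body\<close>: repeat until the phase is that of \<open>Done\<close>.\<close>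

definition main_loop :: "prog \<Rightarrow> prog" where
  "main_loop body = Loop (Lt (Cell ''phase'' (Const 0) (Const 0)) (Const 4)) body"

end

theory Submission
  imports Defs
begin

text \<open>
  Only the choice of a receiver in the scattering phase needs \<open>n \<le> 7\<close>.  Write \<open>s = |S|\<close>.  An agent outside
  \<open>S\<close> values only goods held outside \<open>S\<close>, and some bundle there has only \<open>B - 1\<close> goods, so
  normalization bounds every agent's total by \<open>(n - s) B - 1\<close>.  An agent of \<open>S\<close> owns \<open>B\<close> goods it
  values and values the unplaced good \<open>g\<close>, hence it sees at most \<open>n - s - 2\<close> further bundles of
  worth \<open>B\<close>.  If \<open>T = \<tau>(g)\<close> is a proper subset of \<open>S\<close>, then \<open>|T| (n - s - 2) < n - |T|\<close> for
  \<open>n \<le> 7\<close>, so some bundle outside \<open>T\<close> is blocked by nobody.  If \<open>T = S\<close>, the swap phase has made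
  all bundles of \<open>S\<close> worth \<open>B\<close> to every agent of \<open>S\<close>, which leaves at most \<open>n - 2 s - 1\<close> blocked
  bundles per agent, and \<open>s (n - 2 s - 1) < n - s\<close>.

  The program finds the level by augmenting paths with a slowly growing cap \<open>B\<close>: when no augmenting
  path is left and some bundle is below \<open>B\<close>, the reachable agents form a cut that certifies both the
  level \<open>B - 1\<close> and the maximality of the family.
\<close>

section \<open>Augmenting paths and cuts\<close>

text \<open>Fairness rests on two bounds: every agent's own bundle is worth at least
  \<open>B - 1\<close> to it, and no bundle is worth more than \<open>B\<close> to anybody. Dropping
  one valued good then serves EF1 and EQ1 alike. A receiver never values the good scattered to it,
  so scattering can endanger only the second bound. The constant 7 is where the blocking count ends:
  with \<open>s \<ge> |T| + 1\<close> the inequality \<open>|T| (n - s - 2) < n - |T|\<close> reads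
  6 < 6 for n = 8, |T| = 2, s = 3, and \<open>s (n - 2 s - 1) < n - s\<close> reads 6 < 6 for n = 8,
  s = 2. Swaps change the residual graph while \<open>S\<close> stays fixed. The invariants
  therefore treat \<open>S\<close> not as a reachable set but as a closed one: whoever values an
  unassigned good or a good held in \<open>S\<close> belongs to \<open>S\<close>. For the running
  time, programs are written in a language of counting loops whose termination and cost can be read
  off the syntax, so that only the effect of each phase on the store remains to be proved.\<close>

locale binary_instance =
  fixes n :: nat and M :: "'a set" and v :: "nat \<Rightarrow> 'a set \<Rightarrow> real"
  assumes inst: "binary_goods_instance n M v"
begin

abbreviation goods :: "'a set" where "goods \<equiv> M - junk n M v"
abbreviation worth :: "nat \<Rightarrow> 'a set \<Rightarrow> nat" where
  "worth i X \<equiv> card {g \<in> X. v i {g} = 1}"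
abbreviation "valued \<equiv> valued_families n M v"
abbreviation "lvl \<equiv> level n M v"
abbreviation "capa \<equiv> cap n M v"

section \<open>Valuations as counts, valued families and the level\<close>

lemma n_pos: "n \<ge> 1" and finM: "finite M"
  and v_binary: "\<lbrakk>i \<in> agents n; g \<in> M\<rbrakk> \<Longrightarrow> v i {g} = 0 \<or> v i {g} = 1"
  using inst by (auto simp: binary_goods_instance_def)

text \<open>All counting is done with the natural number \<open>worth\<close>; this is the passage
  from real-valued valuations.\<close>

lemma v_eq_worth:
  assumes "i \<in> agents n" "X \<subseteq> M"
  shows "v i X = real (worth i X)"
proof -
  have fin: "finite X" using assms(2) finM finite_subset by blast
  have "v i X = (\<Sum>g\<in>X. v i {g})"
    using assms inst by (auto simp: binary_goods_instance_def additive_valuation_def)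
  also have "\<dots> = (\<Sum>g\<in>X. if v i {g} = 1 then 1 else 0)"
    using v_binary assms by (intro sum.cong) force+
  also have "\<dots> = real (worth i X)"
    using fin by (simp flip: sum.inter_filter)
  finally show ?thesis .
qed

lemma goods_iff: "g \<in> goods \<longleftrightarrow> g \<in> M \<and> (\<exists>i\<in>agents n. v i {g} = 1)"
  using v_binary by (force simp: junk_def)

lemma valuedD:
  assumes "P \<in> valued"
  shows "disjoint_family_on P (agents n)" "i \<in> agents n \<Longrightarrow> P i \<subseteq> goods"
    "\<lbrakk>i \<in> agents n; g \<in> P i\<rbrakk> \<Longrightarrow> v i {g} = 1" "i \<in> agents n \<Longrightarrow> finite (P i)"
  using assms finM finite_subset unfolding valued_families_def by (blast+)

lemma valued_unique:
  assumes "P \<in> valued" "i \<in> agents n" "j \<in> agents n" "g \<in> P i" "g \<in> P j"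
  shows "i = j"
  using valuedD(1)[OF assms(1)] assms(2-) unfolding disjoint_family_on_def by blast

lemma sum_card_valued:
  assumes "P \<in> valued" "I \<subseteq> agents n"
  shows "(\<Sum>i\<in>I. card (P i)) = card (\<Union>i\<in>I. P i)"
proof (rule card_UN_disjoint[symmetric])
  show "finite I" using assms(2) finite_subset by blast
qed (use valuedD[OF assms(1)] assms(2) in \<open>auto simp: disjoint_family_on_def subset_iff\<close>)

lemma sum_card_valued_le: "P \<in> valued \<Longrightarrow> (\<Sum>i\<in>agents n. card (P i)) \<le> card M"
  using valuedD(2) sum_card_valued[of P "agents n"] card_mono[OF finM, of "\<Union>i\<in>agents n. P i"] by force

text \<open>\<open>GREATEST\<close> is meaningful only for a nonempty bounded set: the empty family
  realizes 0, and the bundle of agent 1, which exists because \<open>n \<ge> 1\<close>, bounds every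
  realizable \<open>t\<close> by \<open>card M\<close>.\<close>

lemma level_ex: "\<exists>P\<in>valued. \<forall>i\<in>agents n. card (P i) = lvl"
  and level_max: "\<lbrakk>P \<in> valued; \<forall>i\<in>agents n. card (P i) = t\<rbrakk> \<Longrightarrow> t \<le> lvl"
proof -
  define Q where "Q t \<longleftrightarrow> (\<exists>P\<in>valued. \<forall>i\<in>agents n. card (P i) = t)" for t
  have "(\<lambda>_. {}) \<in> valued" by (auto simp: valued_families_def disjoint_family_on_def)
  then have Q0: "Q 0" by (force simp: Q_def)
  have bd: "t \<le> card M" if "Q t" for t
  proof -
    from that obtain P where P: "P \<in> valued" "\<forall>i\<in>agents n. card (P i) = t" by (auto simp: Q_def)
    have 1: "1 \<in> agents n" using n_pos by auto
    then have "P 1 \<subseteq> M" using valuedD(2)[OF P(1)] by auto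
    then show ?thesis using P(2) 1 card_mono[OF finM] by metis
  qed
  have lvl: "lvl = (GREATEST t. Q t)" by (simp add: level_def Q_def)
  have "Q lvl" unfolding lvl using Q0 bd by (rule GreatestI_nat)
  then show "\<exists>P\<in>valued. \<forall>i\<in>agents n. card (P i) = lvl" by (simp add: Q_def)
  show "t \<le> lvl" if "P \<in> valued" "\<forall>i\<in>agents n. card (P i) = t" for P t
  proof -
    have "Q t" using that by (auto simp: Q_def)
    then show ?thesis unfolding lvl using bd by (rule Greatest_le_nat)
  qed
qed

text \<open>A family with all bundles of size \<open>lvl\<close> is admissible, and
  \<open>card M\<close> bounds the objective.\<close>

lemma max_level_family_ex: "\<exists>P. max_level_family n M v P"
proof -
  let ?C = "\<lambda>P. P \<in> valued \<and> (\<forall>i\<in>agents n. lvl \<le> card (P i) \<and> card (P i) \<le> capa)"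
  obtain P where "?C P" using level_ex by (fastforce simp: cap_def)
  moreover have "\<forall>P. ?C P \<longrightarrow> (\<Sum>i\<in>agents n. card (P i)) < Suc (card M)"
    using sum_card_valued_le by (simp add: less_Suc_eq_le)
  ultimately obtain Q where "?C Q"
    "\<forall>P. ?C P \<longrightarrow> (\<Sum>i\<in>agents n. card (P i)) \<le> (\<Sum>i\<in>agents n. card (Q i))"
    using ex_has_greatest_nat[of ?C P "\<lambda>P. \<Sum>i\<in>agents n. card (P i)" "Suc (card M)"] by auto
  then show ?thesis unfolding max_level_family_def is_arg_max_def not_less[symmetric] by blast
qed

text \<open>Reachability without a graph: for a family in \<open>valued\<close> and its unassigned
  goods, \<open>reachable_agents\<close> is the least closed set of agents. The condition depends on
  \<open>P\<close> and \<open>R\<close> only through the union of \<open>R\<close> with the bundles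
  of \<open>S\<close>, which a swap does not change.\<close>

definition closed_agents :: "(nat \<Rightarrow> 'a set) \<Rightarrow> 'a set \<Rightarrow> nat set \<Rightarrow> bool" where
  "closed_agents P R S \<longleftrightarrow> (\<forall>g \<in> R \<union> (\<Union>i\<in>S. P i). \<forall>i\<in>agents n. v i {g} = 1 \<longrightarrow> i \<in> S)"

lemma reachable_subset: "reachable_agents n M v P \<subseteq> agents n"
  by (auto simp: reachable_agents_def)

lemma reachable_closed:
  assumes "P \<in> valued"
  shows "closed_agents P (unassigned n M v P) (reachable_agents n M v P)"
  unfolding closed_agents_def
proof (intro ballI impI)
  let ?E = "residual_graph n M v P" and ?S = "reachable_agents n M v P" and ?R = "unassigned n M v P"
  fix g i assume g: "g \<in> ?R \<union> (\<Union>i\<in>?S. P i)" and i: "i \<in> agents n" "v i {g} = 1"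
  show "i \<in> ?S"
  proof (cases "g \<in> ?R")
    case True
    then have "(Inr g, Inl i) \<in> ?E" using i by (auto simp: residual_graph_def unassigned_def)
    then show ?thesis using True i by (auto simp: reachable_agents_def)
  next
    case False
    then obtain h where h: "h \<in> ?S" "g \<in> P h" using g by auto
    then obtain g0 where g0: "g0 \<in> ?R" "(Inr g0, Inl h) \<in> ?E\<^sup>*" "h \<in> agents n"
      by (auto simp: reachable_agents_def)
    have "(Inl h, Inr g) \<in> ?E" using h g0 by (auto simp: residual_graph_def)
    \<comment> \<open>The residual graph has no edge from a good to its owner, so
      \<open>i = h\<close> has to be treated apart; there \<open>i\<close> is reachable
      already.\<close>
    moreover have "(Inr g, Inl i) \<in> ?E" if "i \<noteq> h"
    proof -
      have "g \<notin> P i" using valued_unique[OF assms] that h(2) g0(3) i(1) by blast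
      then show ?thesis using i h g0(3) valuedD(2)[OF assms] by (auto simp: residual_graph_def)
    qed
    ultimately show ?thesis using g0 h i
      by (auto simp: reachable_agents_def) (metis rtrancl.rtrancl_into_rtrancl)+
  qed
qed

text \<open>A path that starts in \<open>R\<close> cannot leave the closed set; since it alternates,
  the induction follows agents and goods simultaneously.\<close>

lemma reachable_least:
  assumes "S \<subseteq> agents n" "closed_agents P (unassigned n M v P) S"
  shows "reachable_agents n M v P \<subseteq> S"
proof
  let ?E = "residual_graph n M v P" and ?R = "unassigned n M v P"
  fix i assume "i \<in> reachable_agents n M v P"
  then obtain g where g: "g \<in> ?R" "(Inr g, Inl i) \<in> ?E\<^sup>*" by (auto simp: reachable_agents_def)
  have "(case x of Inl i \<Rightarrow> i \<in> S | Inr g' \<Rightarrow> g' \<in> ?R \<union> (\<Union>i\<in>S. P i))"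
    if "(Inr g, x) \<in> ?E\<^sup>*" for x
    using that
  proof (induction rule: rtrancl_induct)
    case base show ?case using g by simp
  next
    case (step y z)
    from step(2) consider i g' where "y = Inl i" "z = Inr g'" "g' \<in> P i"
      | i g' where "y = Inr g'" "z = Inl i" "i \<in> agents n" "v i {g'} = 1"
      by (auto simp: residual_graph_def)
    then show ?case
    proof cases
      case 1
      then show ?thesis using step.IH by auto
    next
      case 2
      then have "g' \<in> ?R \<union> (\<Union>i\<in>S. P i)" using step.IH by simp
      then have "i \<in> S" using 2 assms(2) unfolding closed_agents_def by blast
      then show ?thesis using 2 by (simp only: sum.case)
    qed
  qed
  from this[OF g(2)] show "i \<in> S" by simp
qed

text \<open>Agent \<open>i\<close> takes a good from some \<open>h\<close> of smaller label, which
  is then one good short and is served recursively; the recursion ends at an unassigned good. Every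
  intermediate family is valid, so no path has to be handled as an object.\<close>

lemma augment_labelled:
  assumes "P \<in> valued" "D \<subseteq> agents n" "i \<in> D"
    and "\<And>j. j \<in> D \<Longrightarrow> \<exists>g\<in>goods. v j {g} = 1 \<and>
           (g \<in> unassigned n M v P \<or> (\<exists>h\<in>D. lev h < (lev j :: nat) \<and> g \<in> P h))"
  shows "\<exists>P'\<in>valued. card (P' i) = Suc (card (P i)) \<and> (\<forall>j\<in>agents n - {i}. card (P' j) = card (P j))"
  using assms
proof (induction "lev i" arbitrary: i P D rule: less_induct)
  case less
  let ?R = "unassigned n M v P"
  have i: "i \<in> agents n" using less.prems(2,3) by auto
  note fam = less.prems(1)
  obtain g where g: "g \<in> goods" "v i {g} = 1"
    "g \<in> ?R \<or> (\<exists>h\<in>D. lev h < lev i \<and> g \<in> P h)" using less.prems(4)[OF less.prems(3)] by blast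
  show ?case
  proof (cases "g \<in> ?R")
    case True
    then have new: "\<And>j. j \<in> agents n \<Longrightarrow> g \<notin> P j" by (auto simp: unassigned_def)
    let ?P = "P(i := insert g (P i))"
    have "?P \<in> valued" using fam g i new
      by (auto simp: valued_families_def disjoint_family_on_def)
    moreover have "card (?P i) = Suc (card (P i))" using new i valuedD(4)[OF fam] by simp
    ultimately show ?thesis by (intro bexI[of _ ?P]) auto
  next
    case False
    then obtain h where h: "h \<in> D" "lev h < lev i" "g \<in> P h" using g by auto
    have hn: "h \<in> agents n" "h \<noteq> i" using h less.prems(2) by auto
    have only: "g \<notin> P j" if "j \<in> agents n" "j \<noteq> h" for j
      using valued_unique[OF fam] that h hn by blast
    let ?P = "P(i := insert g (P i), h := P h - {g})"
    have "disjoint_family_on ?P (agents n)"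
      unfolding disjoint_family_on_def
    proof (intro ballI impI)
      fix j k assume jk: "j \<in> agents n" "k \<in> agents n" "j \<noteq> k"
      then have "P j \<inter> P k = {}" using valuedD(1)[OF fam] unfolding disjoint_family_on_def by blast
      then show "?P j \<inter> ?P k = {}" using only[OF jk(1)] only[OF jk(2)] jk(3) hn(2) by auto
    qed
    moreover have "?P j \<subseteq> goods \<and> (\<forall>g\<in>?P j. v j {g} = 1)" if "j \<in> agents n" for j
    proof (cases "j = i")
      case True
      then have eq: "?P j = insert g (P j)" and "v j {g} = 1" using hn g(2) by simp_all
      then show ?thesis unfolding eq using valuedD(2,3)[OF fam that] g(1) by blast
    next
      case False
      then have "?P j \<subseteq> P j" by auto
      then show ?thesis using valuedD(2,3)[OF fam that] by blast
    qed
    ultimately have fam': "?P \<in> valued" unfolding valued_families_def by blast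
    have un: "unassigned n M v ?P = ?R" using h hn i by (auto simp: unassigned_def)
    \<comment> \<open>Only agents with labels up to that of \<open>h\<close> are kept. The bundles
      that supply them have labels below \<open>lev h\<close>, hence belong neither to
      \<open>h\<close> nor to \<open>i\<close> and are untouched by the exchange.\<close>
    have "\<exists>P'\<in>valued. card (P' h) = Suc (card (?P h)) \<and> (\<forall>j\<in>agents n - {h}. card (P' j) = card (?P j))"
    proof (rule less.hyps[OF h(2) fam', of "{j\<in>D. lev j \<le> lev h}"])
      fix j assume j: "j \<in> {j \<in> D. lev j \<le> lev h}"
      then obtain g' where g': "g' \<in> goods" "v j {g'} = 1"
        "g' \<in> ?R \<or> (\<exists>h'\<in>D. lev h' < lev j \<and> g' \<in> P h')" using less.prems(4)[of j] by blast
      have "\<exists>h'\<in>{j \<in> D. lev j \<le> lev h}. lev h' < lev j \<and> g' \<in> ?P h'"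
        if "h'\<in>D" "lev h' < lev j" "g' \<in> P h'" for h'
        using that j h by (intro bexI[of _ h']) auto
      then show "\<exists>g\<in>goods. v j {g} = 1 \<and> (g \<in> unassigned n M v ?P \<or>
          (\<exists>ha\<in>{j \<in> D. lev j \<le> lev h}. lev ha < lev j \<and> g \<in> ?P ha))"
        unfolding un using g' by blast
    qed (use less.prems(2) h in auto)
    then obtain P' where P': "P' \<in> valued" "card (P' h) = Suc (card (?P h))"
      "\<And>j. j\<in>agents n - {h} \<Longrightarrow> card (P' j) = card (?P j)" by blast
    have "card (P' h) = card (P h)"
      using P'(2) h(3) valuedD(4)[OF fam hn(1)] by (simp add: card_gt_0_iff) (metis Suc_pred card_gt_0_iff empty_iff)
    moreover have "card (P' i) = Suc (card (P i))"
      using P'(3)[of i] i hn only[of i] valuedD(4)[OF fam i] by simp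
    moreover have "card (P' j) = card (P j)" if "j \<in> agents n - {i}" for j
      using P'(3)[of j] that calculation(1) by (cases "j = h") simp_all
    ultimately show ?thesis using P'(1) by blast
  qed
qed

text \<open>Distances from the unassigned goods serve as labels: the last good on a shortest path to
  \<open>j\<close> is either the start of the path or held by an agent that is strictly
  closer.\<close>

lemma augment:
  assumes "P \<in> valued" "i \<in> reachable_agents n M v P"
  shows "\<exists>P'\<in>valued. card (P' i) = Suc (card (P i)) \<and> (\<forall>j\<in>agents n - {i}. card (P' j) = card (P j))"
proof (rule augment_labelled[OF assms(1) reachable_subset assms(2)])
  let ?E = "residual_graph n M v P" and ?R = "unassigned n M v P" and ?S = "reachable_agents n M v P"
  define dist where "dist j = (LEAST l. \<exists>g\<in>?R. (Inr g, Inl j) \<in> ?E ^^ l)" for j :: nat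
  fix j assume j: "j \<in> ?S"
  then obtain g0 l0 where "g0 \<in> ?R" "(Inr g0, Inl j) \<in> ?E ^^ l0"
    by (auto simp: reachable_agents_def rtrancl_power)
  then have "\<exists>l. \<exists>g\<in>?R. (Inr g, Inl j) \<in> ?E ^^ l" by blast
  then have "\<exists>g\<in>?R. (Inr g, Inl j) \<in> ?E ^^ dist j"
    unfolding dist_def by (rule LeastI_ex)
  then obtain g where g: "g \<in> ?R" "(Inr g, Inl j) \<in> ?E ^^ dist j" by auto
  \<comment> \<open>The distance is positive because a path starts at a good and ends at an
    agent.\<close>
  then obtain d where d: "dist j = Suc d" by (cases "dist j") auto
  then obtain x where x: "(Inr g, x) \<in> ?E ^^ d" "(x, Inl j) \<in> ?E" using g(2) by auto
  from x(2) obtain g' where g': "x = Inr g'" "g' \<in> goods" "v j {g'} = 1"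
    by (auto simp: residual_graph_def)
  show "\<exists>g\<in>goods. v j {g} = 1 \<and> (g \<in> ?R \<or> (\<exists>h\<in>?S. dist h < dist j \<and> g \<in> P h))"
  proof (cases d)
    case 0
    then show ?thesis using x g' g by auto
  next
    case (Suc d')
    then obtain y where y: "(Inr g, y) \<in> ?E ^^ d'" "(y, Inr g') \<in> ?E" using x g' by auto
    from y(2) obtain h where h: "y = Inl h" "h \<in> agents n" "g' \<in> P h"
      by (auto simp: residual_graph_def)
    have "(Inr g, Inl h) \<in> ?E\<^sup>*" using y h by (auto simp: rtrancl_power)
    then have "h \<in> ?S" using g h by (auto simp: reachable_agents_def)
    moreover have "dist h \<le> d'" unfolding dist_def using y h g by (intro Least_le) auto
    ultimately show ?thesis using g' h d Suc by force
  qed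
qed

text \<open>Closedness forces every good valued by an agent outside \<open>S\<close> to be held
  outside \<open>S\<close> in \<open>P\<close>, so no other family can place more goods
  there.\<close>

lemma cut_outside:
  assumes P: "P \<in> valued" and S: "closed_agents P (unassigned n M v P) S" and Q: "Q \<in> valued"
  shows "(\<Sum>i\<in>agents n - S. card (Q i)) \<le> (\<Sum>i\<in>agents n - S. card (P i))"
proof -
  let ?O = "agents n - S"
  have "(\<Union>i\<in>?O. Q i) \<subseteq> (\<Union>i\<in>?O. P i)"
  proof clarify
    fix g i assume g: "i \<in> agents n" "i \<notin> S" "g \<in> Q i"
    then have "v i {g} = 1" "g \<in> goods" using valuedD[OF Q] by blast+
    then have "g \<notin> unassigned n M v P" "\<forall>j\<in>S. g \<notin> P j"
      using S g unfolding closed_agents_def by blast+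
    then show "g \<in> (\<Union>i\<in>?O. P i)" using \<open>g \<in> goods\<close> unfolding unassigned_def by blast
  qed
  moreover have "finite (\<Union>i\<in>?O. P i)" using valuedD(4)[OF P] by blast
  ultimately show ?thesis using P Q by (simp add: sum_card_valued card_mono)
qed

text \<open>The level asks for bundles of equal size, so larger bundles are cut down to
  \<open>t\<close> goods.\<close>

lemma level_ge:
  assumes P: "P \<in> valued" and t: "\<And>i. i \<in> agents n \<Longrightarrow> t \<le> card (P i)"
  shows "t \<le> lvl"
proof -
  have "\<forall>i\<in>agents n. \<exists>X\<subseteq>P i. card X = t" using t by (metis obtain_subset_with_card_n)
  then obtain Q where Q: "\<And>i. i \<in> agents n \<Longrightarrow> Q i \<subseteq> P i" "\<And>i. i \<in> agents n \<Longrightarrow> card (Q i) = t"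
    by metis
  have "disjoint_family_on Q (agents n)"
    unfolding disjoint_family_on_def
  proof (intro ballI impI)
    fix i k assume ik: "i \<in> agents n" "k \<in> agents n" "i \<noteq> k"
    then have "P i \<inter> P k = {}" using valuedD(1)[OF P] unfolding disjoint_family_on_def by blast
    then show "Q i \<inter> Q k = {}" using Q(1)[OF ik(1)] Q(1)[OF ik(2)] by blast
  qed
  moreover have "Q i \<subseteq> goods \<and> (\<forall>g\<in>Q i. v i {g} = 1)" if "i \<in> agents n" for i
    using Q(1)[OF that] valuedD(2,3)[OF P that] by blast
  ultimately have "Q \<in> valued" unfolding valued_families_def by blast
  then show ?thesis using level_max[of Q t] Q(2) by blast
qed

text \<open>The hypotheses are what a program can test: all sizes are \<open>b - 1\<close> or
  \<open>b\<close>, reachable agents are full, somebody is not. By \<open>cut_outside\<close> no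
  family holds more goods outside the reachable set. This rules out level \<open>b\<close>, and
  together with the full bundles inside it gives maximality.\<close>

lemma max_level_certificate:
  assumes P: "P \<in> valued"
    and sz: "\<And>i. i \<in> agents n \<Longrightarrow> b \<le> Suc (card (P i))" "\<And>i. i \<in> agents n \<Longrightarrow> card (P i) \<le> b"
    and full: "\<And>i. i \<in> reachable_agents n M v P \<Longrightarrow> b \<le> card (P i)"
    and low: "\<exists>i\<in>agents n. card (P i) < b"
  shows "max_level_family n M v P \<and> capa = b"
proof -
  define S where "S = reachable_agents n M v P"
  have S: "S \<subseteq> agents n" unfolding S_def by (rule reachable_subset)
  note cut = cut_outside[OF P reachable_closed[OF P], folded S_def]
  obtain k where k: "k \<in> agents n" "card (P k) < b" using low by blast
  then have kS: "k \<in> agents n - S" using full unfolding S_def by fastforce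
  have "lvl < b"
  proof (rule ccontr)
    assume ge: "\<not> lvl < b"
    obtain Q where Q: "Q \<in> valued" "\<forall>i\<in>agents n. card (Q i) = lvl" using level_ex by blast
    have "(\<Sum>i\<in>agents n - S. card (P i)) < (\<Sum>i\<in>agents n - S. card (Q i))"
    proof (rule sum_strict_mono_ex1)
      show "\<forall>i\<in>agents n - S. card (P i) \<le> card (Q i)" using sz(2) Q(2) ge by fastforce
      show "\<exists>i\<in>agents n - S. card (P i) < card (Q i)" using k Q(2) ge by (intro bexI[OF _ kS]) simp
    qed simp
    then show False using cut[OF Q(1)] by simp
  qed
  moreover have "b - 1 \<le> lvl" using sz(1) by (intro level_ge[OF P]) fastforce
  ultimately have lvl: "capa = b" "Suc lvl = b" by (auto simp: cap_def)
  have split: "(\<Sum>i\<in>agents n. f i) = (\<Sum>i\<in>S. f i) + (\<Sum>i\<in>agents n - S. f i)" for f :: "nat \<Rightarrow> nat"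
    using sum.subset_diff[OF S, of f] by (simp add: add.commute)
  have "\<not> (\<Sum>i\<in>agents n. card (P i)) < (\<Sum>i\<in>agents n. card (Q i))"
    if Q: "Q \<in> valued" "\<forall>i\<in>agents n. lvl \<le> card (Q i) \<and> card (Q i) \<le> capa" for Q
  proof -
    have "(\<Sum>i\<in>S. card (Q i)) \<le> (\<Sum>i\<in>S. card (P i))"
    proof (rule sum_mono)
      fix i assume i: "i \<in> S"
      then have "card (Q i) \<le> b" using Q(2) S lvl(1) by blast
      also have "b \<le> card (P i)" using full i unfolding S_def by blast
      finally show "card (Q i) \<le> card (P i)" .
    qed
    then show ?thesis using cut[OF Q(1)] unfolding split by linarith
  qed
  moreover have "\<forall>i\<in>agents n. lvl \<le> card (P i) \<and> card (P i) \<le> capa"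
    using sz lvl by (metis Suc_le_mono)
  ultimately show ?thesis
    unfolding max_level_family_def is_arg_max_def using P lvl(1) by blast
qed

end

section \<open>Invariants of the algorithm\<close>

context binary_instance
begin

text \<open>Optimality of the family is replaced by two consequences that swaps preserve: full
  bundles on \<open>S\<close>, and a bundle of size \<open>lvl\<close> outside \<open>S\<close>. The
  latter supplies the strict inequality in the bound on an agent's total.\<close>

definition swap_inv :: "nat set \<Rightarrow> (nat \<Rightarrow> 'a set) \<Rightarrow> 'a set \<Rightarrow> bool" where
  "swap_inv S P R \<longleftrightarrow> P \<in> valued \<and> R = unassigned n M v P \<and> S \<subseteq> agents n \<and>
     closed_agents P R S \<and>
     (\<forall>i\<in>agents n. lvl \<le> card (P i) \<and> card (P i) \<le> capa) \<and>
     (\<forall>i\<in>S. card (P i) = capa) \<and> (\<exists>k\<in>agents n - S. card (P k) = lvl)"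

text \<open>\<open>P\<close> and \<open>R0\<close> are the family and the unassigned goods at the
  end of the swap phase. They stay fixed while \<open>A\<close> grows, because closedness of
  \<open>S\<close> and the absence of swaps refer to them. Own worth remains
  \<open>card (P i)\<close> since no receiver values its new good.\<close>

definition scatter_witness ::
  "nat set \<Rightarrow> (nat \<Rightarrow> 'a set) \<Rightarrow> 'a set \<Rightarrow> (nat \<Rightarrow> 'a set) \<Rightarrow> 'a set \<Rightarrow> bool" where
  "scatter_witness S A R P R0 \<longleftrightarrow>
     swap_inv S P R0 \<and> (\<nexists>g h g'. swappable v S P R0 g h g') \<and>
     R \<subseteq> R0 \<and> disjoint_family_on A (agents n) \<and> (\<Union>i\<in>agents n. A i) = goods - R \<and>
     (\<forall>i\<in>agents n. P i \<subseteq> A i) \<and> (\<forall>i\<in>agents n. worth i (A i) = card (P i)) \<and>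
     (\<forall>i\<in>agents n. \<forall>j\<in>agents n. worth i (A j) \<le> capa)"

definition scatter_inv :: "nat set \<Rightarrow> (nat \<Rightarrow> 'a set) \<Rightarrow> 'a set \<Rightarrow> bool" where
  "scatter_inv S A R \<longleftrightarrow> (\<exists>P R0. scatter_witness S A R P R0)"

text \<open>A good that has been picked but not placed still counts as unplaced, hence
  \<open>insert g R\<close>.\<close>

primrec config_inv :: "'a config \<Rightarrow> bool" where
  "config_inv Start \<longleftrightarrow> True"
| "config_inv (Swapping S P R) \<longleftrightarrow> swap_inv S P R"
| "config_inv (Scattering S A R) \<longleftrightarrow> scatter_inv S A R"
| "config_inv (Placing S A R g) \<longleftrightarrow> g \<notin> R \<and> scatter_inv S A (insert g R)"
| "config_inv (Done A) \<longleftrightarrow> allocation n M A \<and> EF1 n v A \<and> EQ1 n v A"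

lemma max_level_familyD:
  assumes "max_level_family n M v P"
  shows "P \<in> valued" "i \<in> agents n \<Longrightarrow> lvl \<le> card (P i)" "i \<in> agents n \<Longrightarrow> card (P i) \<le> capa"
    "\<lbrakk>Q \<in> valued; \<forall>i\<in>agents n. lvl \<le> card (Q i) \<and> card (Q i) \<le> capa\<rbrakk> \<Longrightarrow>
       (\<Sum>i\<in>agents n. card (Q i)) \<le> (\<Sum>i\<in>agents n. card (P i))"
  using assms unfolding max_level_family_def is_arg_max_def not_less[symmetric] by blast+

text \<open>If a reachable agent had only \<open>lvl\<close> goods, augmenting it would respect the
  cap and raise the total. Not all bundles are full, since otherwise the level would be at least
  \<open>capa\<close>.\<close>

lemma swap_inv_start:
  assumes "max_level_family n M v P"
  shows "swap_inv (reachable_agents n M v P) P (unassigned n M v P)"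
proof -
  let ?S = "reachable_agents n M v P"
  note D = max_level_familyD[OF assms]
  have full: "card (P i) = capa" if "i \<in> ?S" for i
  proof (rule ccontr)
    assume "card (P i) \<noteq> capa"
    have i: "i \<in> agents n" using that reachable_subset by blast
    with \<open>card (P i) \<noteq> capa\<close> D(2,3)[of i] have ci: "card (P i) = lvl" by (auto simp: cap_def)
    obtain P' where P': "P' \<in> valued" "card (P' i) = Suc (card (P i))"
      "\<forall>j\<in>agents n - {i}. card (P' j) = card (P j)" using augment[OF D(1) \<open>i \<in> ?S\<close>] by blast
    have "\<forall>j\<in>agents n. lvl \<le> card (P' j) \<and> card (P' j) \<le> capa"
      using P'(2,3) D(2,3) ci by (metis Diff_iff Suc_eq_plus1 cap_def le_add1 order_refl singletonD)
    from D(4)[OF P'(1) this]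
    have le: "(\<Sum>j\<in>agents n. card (P' j)) \<le> (\<Sum>j\<in>agents n. card (P j))" .
    have "(\<Sum>j\<in>agents n - {i}. card (P' j)) = (\<Sum>j\<in>agents n - {i}. card (P j))"
      using P'(3) by simp
    then show False using le P'(2)
      sum.remove[OF _ i, of "\<lambda>j. card (P' j)"] sum.remove[OF _ i, of "\<lambda>j. card (P j)"] by simp
  qed
  have "\<exists>k\<in>agents n. card (P k) \<noteq> capa"
    using level_max[OF D(1), of capa] by (auto simp: cap_def)
  then obtain k where k: "k \<in> agents n" "card (P k) \<noteq> capa" by blast
  then have "card (P k) = lvl" using D(2,3)[of k] by (auto simp: cap_def)
  then have "\<exists>k\<in>agents n - ?S. card (P k) = lvl" using k full by blast
  then show ?thesis
    unfolding swap_inv_def using D(1,2,3) full reachable_closed[OF D(1)] reachable_subset by blast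
qed

text \<open>Agent \<open>h\<close> values \<open>g\<close> because \<open>tau v S g = S\<close>. One
  good moves from \<open>R\<close> into a bundle of \<open>S\<close> and one moves back, so the
  union of both, and with it closedness, is preserved. The last claim makes swapping terminate:
  \<open>g'\<close> does not enter the set because its \<open>tau\<close> differs from
  \<open>S\<close>.\<close>

lemma swap_inv_swap:
  assumes inv: "swap_inv S P R" and sw: "swappable v S P R g h g'"
  shows "swap_inv S (P(h := (P h - {g'}) \<union> {g})) ((R - {g}) \<union> {g'})"
    "card ((R - {g}) \<union> {g'}) = card R"
    "{x \<in> (R - {g}) \<union> {g'}. tau v S x = S} = {x \<in> R. tau v S x = S} - {g}"
proof -
  have P: "P \<in> valued" and R: "R = unassigned n M v P" and S: "S \<subseteq> agents n"
    and cl: "closed_agents P R S"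
    and sz: "\<And>i. i\<in>agents n \<Longrightarrow> lvl \<le> card (P i) \<and> card (P i) \<le> capa"
    and full: "\<And>i. i\<in>S \<Longrightarrow> card (P i) = capa" and ex: "\<exists>k\<in>agents n - S. card (P k) = lvl"
    using inv unfolding swap_inv_def by blast+
  have g: "g \<in> R" "tau v S g = S" and h: "h \<in> S" and g': "g' \<in> P h" "tau v S g' \<noteq> S"
    using sw unfolding swappable_def by blast+
  have hn: "h \<in> agents n" using h S by blast
  have gR: "g \<in> goods" "\<And>j. j \<in> agents n \<Longrightarrow> g \<notin> P j" using g R unfolding unassigned_def by blast+
  have vh: "v h {g} = 1" using g h unfolding tau_def by blast
  have only: "g' \<notin> P j" if "j \<in> agents n" "j \<noteq> h" for j
    using valued_unique[OF P] that hn g' by blast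
  have g'R: "g' \<notin> R" "g' \<in> goods" "g' \<noteq> g"
    using g' hn R valuedD(2)[OF P hn] gR unfolding unassigned_def by blast+
  let ?P = "P(h := (P h - {g'}) \<union> {g})" and ?R = "(R - {g}) \<union> {g'}"
  have Ph: "?P h = insert g (P h - {g'})" by simp
  have Po: "?P j = P j" if "j \<noteq> h" for j using that by simp
  have "disjoint_family_on ?P (agents n)"
    unfolding disjoint_family_on_def
  proof (intro ballI impI)
    fix j k assume jk: "j \<in> agents n" "k \<in> agents n" "j \<noteq> k"
    then have "P j \<inter> P k = {}" using valuedD(1)[OF P] unfolding disjoint_family_on_def by blast
    then show "?P j \<inter> ?P k = {}" using gR(2)[OF jk(1)] gR(2)[OF jk(2)] jk(3) by auto
  qed
  moreover have "?P j \<subseteq> goods \<and> (\<forall>g\<in>?P j. v j {g} = 1)" if "j \<in> agents n" for j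
  proof (cases "j = h")
    case True
    then show ?thesis unfolding True Ph using valuedD(2,3)[OF P hn] gR(1) vh by blast
  next
    case False
    then show ?thesis unfolding Po[OF False] using valuedD(2,3)[OF P that] by blast
  qed
  ultimately have P': "?P \<in> valued" unfolding valued_families_def by blast
  have un: "(\<Union>j\<in>agents n. ?P j) = insert g ((\<Union>j\<in>agents n. P j) - {g'})"
  proof -
    have "(\<Union>j\<in>agents n. ?P j) = ?P h \<union> (\<Union>j\<in>agents n - {h}. P j)" using hn by auto
    also have "\<dots> = insert g ((\<Union>j\<in>agents n. P j) - {g'})" using only hn unfolding Ph by blast
    finally show ?thesis .
  qed
  have R': "?R = unassigned n M v ?P"
    unfolding R unassigned_def un using g'R by auto
  have "?R \<union> (\<Union>i\<in>S. ?P i) = R \<union> (\<Union>i\<in>S. P i)"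
  proof -
    have "(\<Union>i\<in>S. ?P i) = ?P h \<union> (\<Union>j\<in>S - {h}. P j)" using h by auto
    then show ?thesis using g(1) g'(1) h by auto
  qed
  then have cl': "closed_agents ?P ?R S" using cl unfolding closed_agents_def by (simp only:)
  have "card (?P h) = card (P h)"
    using g'(1) gR(2)[OF hn] valuedD(4)[OF P hn] by (simp add: card_gt_0_iff) (metis Suc_pred card_gt_0_iff empty_iff)
  then have same: "card (?P j) = card (P j)" for j by (cases "j = h") simp_all
  show "swap_inv S ?P ?R" unfolding swap_inv_def same using P' R' S cl' sz full ex by blast
  have "finite R" using R finM unfolding unassigned_def by simp
  then show "card ?R = card R" using g(1) g'R(1) card_Suc_Diff1[of R g] by simp
  show "{x \<in> ?R. tau v S x = S} = {x \<in> R. tau v S x = S} - {g}"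
    using g'(2) by blast
qed

lemma scatter_inv_start:
  assumes "swap_inv S P R" "\<nexists>g h g'. swappable v S P R g h g'"
  shows "scatter_inv S P R"
proof -
  have P: "P \<in> valued" and R: "R = unassigned n M v P" 
    and sz: "\<And>i. i\<in>agents n \<Longrightarrow> card (P i) \<le> capa"
    using assms(1) unfolding swap_inv_def by blast+
  have "worth i (P i) = card (P i)" if "i \<in> agents n" for i
    using valuedD(3)[OF P that] by (intro arg_cong[of _ _ card]) blast
  moreover have "worth i (P j) \<le> capa" if "j \<in> agents n" for i j
    using card_mono[OF valuedD(4)[OF P that], of "{g \<in> P j. v i {g} = 1}"] sz[OF that] by auto
  moreover have "(\<Union>i\<in>agents n. P i) = goods - R"
    using valuedD(2)[OF P] unfolding R unassigned_def by blast
  ultimately have "scatter_witness S P R P R"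
    unfolding scatter_witness_def using assms valuedD(1)[OF P] by (intro conjI ballI) blast+
  then show ?thesis unfolding scatter_inv_def by blast
qed

section \<open>Totals, blocked bundles and the choice of a receiver\<close>

lemma worth_UN:
  assumes "disjoint_family_on A I" "finite I" "\<And>j. j \<in> I \<Longrightarrow> A j \<subseteq> M"
  shows "worth i (\<Union>j\<in>I. A j) = (\<Sum>j\<in>I. worth i (A j))"
proof -
  have "{g \<in> (\<Union>j\<in>I. A j). v i {g} = 1} = (\<Union>j\<in>I. {g \<in> A j. v i {g} = 1})" by blast
  also have "card \<dots> = (\<Sum>j\<in>I. worth i (A j))"
  proof (rule card_UN_disjoint[OF assms(2)])
    show "\<forall>j\<in>I. finite {g \<in> A j. v i {g} = 1}"
      by (intro ballI finite_subset[OF _ finM]) (use assms(3) in blast)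
  qed (use assms(1) in \<open>auto simp: disjoint_family_on_def\<close>)
  finally show ?thesis .
qed

lemma worth_insert:
  assumes "X \<subseteq> M" "g \<notin> X"
  shows "worth i (insert g X) = worth i X + (if v i {g} = 1 then 1 else 0)"
proof -
  have "finite X" using assms(1) finM finite_subset by blast
  moreover have "{x \<in> insert g X. v i {x} = 1} =
    (if v i {g} = 1 then insert g {x \<in> X. v i {x} = 1} else {x \<in> X. v i {x} = 1})" by auto
  ultimately show ?thesis using assms(2) by simp
qed

text \<open>An agent outside \<open>S\<close> values only goods held outside \<open>S\<close>, where some bundle is not full; by
  normalization this bounds everybody's total.\<close>

lemma total_bound:
  assumes "normalized n M v" "swap_inv S P R" "i \<in> agents n"
  shows "worth i M < card (agents n - S) * capa"
proof -
  have P: "P \<in> valued" and R: "R = unassigned n M v P" and S: "S \<subseteq> agents n"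
    and cl: "closed_agents P R S"
    and sz: "\<And>i. i\<in>agents n \<Longrightarrow> card (P i) \<le> capa" 
    and ex: "\<exists>k\<in>agents n - S. card (P k) = lvl"
    using assms(2) unfolding swap_inv_def by blast+
  obtain k where k: "k \<in> agents n" "k \<notin> S" "card (P k) = lvl" using ex by blast
  let ?O = "agents n - S"
  have "{g \<in> M. v k {g} = 1} \<subseteq> (\<Union>j\<in>?O. P j)"
  proof clarify
    fix g assume g: "g \<in> M" "v k {g} = 1"
    then have "g \<in> goods" using k unfolding goods_iff by blast
    moreover have "g \<notin> R" "\<forall>j\<in>S. g \<notin> P j"
      using cl k g unfolding closed_agents_def by blast+
    ultimately show "g \<in> (\<Union>j\<in>?O. P j)" unfolding R unassigned_def by blast
  qed
  moreover have "finite (\<Union>j\<in>?O. P j)" using valuedD(4)[OF P] by blast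
  ultimately have "worth k M \<le> (\<Sum>j\<in>?O. card (P j))"
    using card_mono sum_card_valued[OF P, of ?O] by (metis Diff_subset)
  also have "\<dots> = card (P k) + (\<Sum>j\<in>?O - {k}. card (P j))"
    using k by (intro sum.remove) auto
  \<comment> \<open>Strictness comes from \<open>P k\<close>, which has \<open>lvl\<close>, that is
    \<open>capa - 1\<close>, goods.\<close>
  also have "\<dots> < capa + (\<Sum>j\<in>?O - {k}. capa)"
    using sz k by (intro add_less_le_mono sum_mono) (auto simp: cap_def)
  also have "\<dots> = (\<Sum>j\<in>?O. capa)"
    using k by (intro sum.remove[symmetric]) auto
  finally have "worth k M < card ?O * capa" by simp
  moreover have "v i M = v k M" using assms(1,3) k unfolding normalized_def by blast
  ultimately show ?thesis using v_eq_worth[OF assms(3)] v_eq_worth[OF k(1)] by simp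
qed

text \<open>If nobody could receive \<open>g\<close>, every bundle outside \<open>T\<close> would be
  blocked by some agent of \<open>T\<close>, so the numbers of blocked bundles would add up to at
  least \<open>n - card T\<close>.\<close>

lemma receiver_ex:
  assumes norm: "normalized n M v" and n7: "n \<le> 7" and inv: "scatter_inv S A R" and g: "g \<in> R"
  shows "\<exists>j\<in>agents n - tau v S g. \<forall>i\<in>tau v S g. v i (A j \<union> {g}) \<le> real capa"
proof (rule ccontr)
  assume stuck: "\<not> ?thesis"
  obtain P R0 where "scatter_witness S A R P R0" using inv unfolding scatter_inv_def by blast
  then have sw: "swap_inv S P R0" and noswap: "\<nexists>g h g'. swappable v S P R0 g h g'"
    and RR: "R \<subseteq> R0" and disj: "disjoint_family_on A (agents n)"
    and un: "(\<Union>i\<in>agents n. A i) = goods - R"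
    and PA: "\<And>i. i\<in>agents n \<Longrightarrow> P i \<subseteq> A i"
    and own: "\<And>i. i\<in>agents n \<Longrightarrow> worth i (A i) = card (P i)"
    and bd: "\<And>i k. \<lbrakk>i\<in>agents n; k\<in>agents n\<rbrakk> \<Longrightarrow> worth i (A k) \<le> capa"
    unfolding scatter_witness_def by blast+
  have P: "P \<in> valued" and R0: "R0 = unassigned n M v P" and S: "S \<subseteq> agents n"
    and cl: "closed_agents P R0 S" and full: "\<And>i. i\<in>S \<Longrightarrow> card (P i) = capa"
    using sw unfolding swap_inv_def by blast+
  define T where "T = tau v S g"
  have TS: "T \<subseteq> S" unfolding T_def tau_def by blast
  have finS: "finite S" using S finite_subset by blast
  have AM: "A j \<subseteq> M" "g \<notin> A j" if "j \<in> agents n" for j using un g that by blast+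
  have gR0: "g \<in> R0" "g \<in> goods" using g RR R0 unfolding unassigned_def by blast+
  \<comment> \<open>\<open>T\<close> is nonempty: \<open>g\<close> is not junk, and closedness puts
    everyone who values an unassigned good into \<open>S\<close>.\<close>
  obtain i0 where "i0 \<in> agents n" "v i0 {g} = 1" using gR0(2) unfolding goods_iff by blast
  then have "i0 \<in> T" using cl gR0(1) unfolding closed_agents_def T_def tau_def by blast
  then have T0: "card T \<ge> 1" using finite_subset[OF TS finS] by (metis One_nat_def Suc_leI card_gt_0_iff empty_iff)
  \<comment> \<open>For an agent of \<open>T\<close> the good \<open>g\<close> adds one, so the
    bundles it rejects are those already worth \<open>capa\<close>.\<close>
  define blocked where "blocked i = {j \<in> agents n - T. capa \<le> worth i (A j)}" for i
  have "agents n - T \<subseteq> (\<Union>i\<in>T. blocked i)"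
  proof
    fix j assume j: "j \<in> agents n - T"
    then obtain i where i: "i \<in> T" "\<not> v i (A j \<union> {g}) \<le> real capa"
      using stuck unfolding T_def by blast
    have "i \<in> agents n" "v i {g} = 1" using i(1) TS S unfolding T_def tau_def by blast+
    moreover have "insert g (A j) \<subseteq> M" using AM j gR0(2) by blast
    ultimately have "\<not> worth i (A j) + 1 \<le> capa"
      using i(2) v_eq_worth[of i "insert g (A j)"] worth_insert[of "A j" g i] AM[of j] j by simp
    then have "capa \<le> worth i (A j)" by linarith
    then show "j \<in> (\<Union>i\<in>T. blocked i)" using i(1) j unfolding blocked_def by blast
  qed
  moreover have "(\<Union>i\<in>T. blocked i) \<subseteq> agents n" unfolding blocked_def by blast
  then have "finite (\<Union>i\<in>T. blocked i)" by (rule finite_subset) simp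
  ultimately have "card (agents n - T) \<le> card (\<Union>i\<in>T. blocked i)" by (intro card_mono)
  then have "card (agents n - T) \<le> (\<Sum>i\<in>T. card (blocked i))"
    using card_UN_le[OF finite_subset[OF TS finS], of blocked] by linarith
  then have cover: "n - card T \<le> (\<Sum>i\<in>T. card (blocked i))"
    using S TS by (simp add: card_Diff_subset finite_subset[OF TS finS] order_trans[OF TS S])
  have sn: "card (agents n - S) = n - card S" "card S \<le> n"
    using S card_mono[OF _ S] by (simp_all add: card_Diff_subset finS)
  \<comment> \<open>\<open>H\<close> collects bundles of agents in \<open>T\<close> that are worth
    \<open>capa\<close> to \<open>i\<close>; they are disjoint from the blocked ones, which lie
    outside \<open>T\<close>. It is instantiated with all of \<open>S\<close> when
    \<open>T = S\<close> and with \<open>{i}\<close> otherwise.\<close>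
  have count: "card (blocked i) + card H + 1 \<le> n - card S"
    if i: "i \<in> T" and H: "H \<subseteq> T" "\<And>h. h \<in> H \<Longrightarrow> worth i (A h) = capa" for i H
  proof -
    have Hn: "H \<subseteq> agents n" and iA: "i \<in> agents n" "v i {g} = 1"
      using H(1) i TS S unfolding T_def tau_def by blast+
    have b: "blocked i \<subseteq> agents n" "blocked i \<inter> H = {}" using H(1) unfolding blocked_def by blast+
    have fin: "finite (blocked i)" "finite H" using b(1) Hn finite_subset by blast+
    have "(card (blocked i) + card H) * capa = (\<Sum>j\<in>blocked i \<union> H. capa)"
      using b(2) fin by (simp add: card_Un_disjoint)
    also have "\<dots> \<le> (\<Sum>j\<in>blocked i \<union> H. worth i (A j))"
      using H(2) by (intro sum_mono) (auto simp: blocked_def)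
    also have "\<dots> \<le> (\<Sum>j\<in>agents n. worth i (A j))"
      using b(1) Hn by (intro sum_mono2) auto
    also have "\<dots> = worth i (\<Union>j\<in>agents n. A j)"
      using worth_UN[OF disj] AM(1) by simp
    also have "\<dots> + 1 = worth i (insert g (\<Union>j\<in>agents n. A j))"
    proof -
      have "(\<Union>j\<in>agents n. A j) \<subseteq> M" "g \<notin> (\<Union>j\<in>agents n. A j)" using AM by blast+
      from worth_insert[OF this, of i] show ?thesis using iA(2) by (simp only: if_True simp_thms)
    qed
    also have "\<dots> \<le> worth i M"
    proof (rule card_mono)
      have "(\<Union>j\<in>agents n. A j) \<subseteq> M" using AM(1) by blast
      then show "{x \<in> insert g (\<Union>j\<in>agents n. A j). v i {x} = 1} \<subseteq> {x \<in> M. v i {x} = 1}"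
        using gR0(2) by blast
    qed (use finM in simp)
    also have "\<dots> < (n - card S) * capa"
      using total_bound[OF norm sw iA(1)] sn by simp
    finally have "(card (blocked i) + card H) * capa < (n - card S) * capa" by linarith
    then have "card (blocked i) + card H < n - card S" by (simp only: mult_less_cancel2)
    then show ?thesis by simp
  qed
  show False
  proof (cases "T = S")
    case True
    have "worth i (A h) = capa" if i: "i \<in> T" and h: "h \<in> S" for i h
    proof -
      have hn: "h \<in> agents n" and iS: "i \<in> S" and ia: "i \<in> agents n" using h S i TS by blast+
      \<comment> \<open>Otherwise \<open>g\<close>, whose \<open>tau\<close> is \<open>S\<close> in
        this case, could still be swapped against \<open>g'\<close>.\<close>
      have "tau v S g' = S" if "g' \<in> P h" for g'
        using noswap gR0(1) True h that unfolding swappable_def T_def by blast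
      then have "P h \<subseteq> {g \<in> A h. v i {g} = 1}"
        using PA[OF hn] iS unfolding tau_def by blast
      then have "card (P h) \<le> worth i (A h)"
        using AM(1)[OF hn] finM by (intro card_mono) (auto dest: finite_subset)
      moreover have "worth i (A h) \<le> capa" using bd[OF ia hn] .
      ultimately show ?thesis using full[OF h] by simp
    qed
    then have c: "card (blocked i) \<le> n - card S - (card S + 1)" "card S + 1 \<le> n - card S" if "i \<in> T" for i
      using count[of i S] that True by force+
    have "n - card S \<le> card S * (n - card S - (card S + 1))"
      using cover sum_bounded_above[of T "\<lambda>i. card (blocked i)", OF c(1)] True by simp
    moreover have "card S + 1 \<le> n - card S" using c(2)[OF \<open>i0 \<in> T\<close>] .
    \<comment> \<open>The inequality is quadratic in \<open>card S\<close>; for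
      \<open>n \<le> 7\<close> only three values are left, and each makes it linear in
      \<open>n\<close>.\<close>
    moreover have "card S \<in> {1,2,3}" using calculation T0 True n7 by auto
    ultimately show False using n7 by auto
  next
    case False
    have c: "card (blocked i) \<le> n - card S - 2" "2 \<le> n - card S" if "i \<in> T" for i
      using count[of i "{i}"] that own full TS S by (force simp: subset_iff)+
    have "n - card T \<le> card T * (n - card S - 2)"
      using cover sum_bounded_above[of T "\<lambda>i. card (blocked i)", OF c(1)] by simp
    moreover have "2 \<le> n - card S" using c(2)[OF \<open>i0 \<in> T\<close>] .
    moreover have "card T < card S" using False TS finS by (simp add: psubset_card_mono psubsetI)
    \<comment> \<open>\<open>T\<close> is a proper subset, so \<open>card S\<close> may be replaced
      by \<open>card T + 1\<close>; then \<open>card T\<close>, with at most four values, is the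
      only quadratic unknown.\<close>
    moreover have "card T * (n - card S - 2) \<le> card T * (n - Suc (card T) - 2)"
      using \<open>card T < card S\<close> by (intro mult_le_mono) auto
    moreover have "card T \<in> {1,2,3,4}" using calculation T0 n7 by auto
    ultimately show False using n7 by auto
  qed
qed

text \<open>By closedness every agent who values \<open>g\<close> is in \<open>tau v S g\<close>.
  Hence the test covers all agents for whom bundle \<open>j\<close> gains worth, and the receiver's
  own worth does not change.\<close>

lemma scatter_inv_place:
  assumes inv: "scatter_inv S A (insert g R)" and g: "g \<notin> R"
    and j: "j \<in> agents n - tau v S g" "\<forall>i\<in>tau v S g. v i (A j \<union> {g}) \<le> real capa"
  shows "scatter_inv S (A(j := A j \<union> {g})) R"
proof -
  obtain P R0 where "scatter_witness S A (insert g R) P R0" using inv unfolding scatter_inv_def by blast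
  then have sw: "swap_inv S P R0" and noswap: "\<nexists>g h g'. swappable v S P R0 g h g'"
    and RR: "insert g R \<subseteq> R0" and disj: "disjoint_family_on A (agents n)"
    and un: "(\<Union>i\<in>agents n. A i) = goods - insert g R"
    and PA: "\<And>i. i\<in>agents n \<Longrightarrow> P i \<subseteq> A i"
    and own: "\<And>i. i\<in>agents n \<Longrightarrow> worth i (A i) = card (P i)"
    and bd: "\<And>i k. \<lbrakk>i\<in>agents n; k\<in>agents n\<rbrakk> \<Longrightarrow> worth i (A k) \<le> capa"
    unfolding scatter_witness_def by blast+
  have R0: "R0 = unassigned n M v P" and cl: "closed_agents P R0 S" and S: "S \<subseteq> agents n"
    using sw unfolding swap_inv_def by blast+
  have gg: "g \<in> goods" using RR unfolding R0 unassigned_def by blast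
  have jn: "j \<in> agents n" using j by blast
  have AM: "A k \<subseteq> M" "g \<notin> A k" if "k \<in> agents n" for k using un that by blast+
  have val: "i \<in> tau v S g" if "i \<in> agents n" "v i {g} = 1" for i
    using cl RR that unfolding closed_agents_def tau_def by blast
  let ?A = "A(j := A j \<union> {g})"
  have Aj: "?A j = insert g (A j)" by simp
  have Ao: "?A k = A k" if "k \<noteq> j" for k using that by simp
  have w: "worth i (?A k) \<le> capa" if "i \<in> agents n" "k \<in> agents n" for i k
  proof (cases "k = j \<and> v i {g} = 1")
    case True
    have sub: "A j \<union> {g} \<subseteq> M" using AM(1)[OF jn] gg by blast
    have "v i (A j \<union> {g}) \<le> real capa" using j(2) val[OF that(1)] True by blast
    then have "worth i (A j \<union> {g}) \<le> capa"
      unfolding v_eq_worth[OF that(1) sub] of_nat_le_iff .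
    moreover
    have "?A k = A j \<union> {g}" using True by simp
    ultimately show ?thesis by (simp only:)
  next
    case False
    then have "worth i (?A k) = worth i (A k)"
      using worth_insert[OF AM(1)[OF jn] AM(2)[OF jn], of i] by auto
    then show ?thesis using bd[OF that] by simp
  qed
  have o: "worth i (?A i) = card (P i)" if "i \<in> agents n" for i
  proof (cases "i = j")
    case True
    then have "v i {g} \<noteq> 1" using val[OF that] j(1) by blast
    then show ?thesis using own[OF that] worth_insert[OF AM(1)[OF jn] AM(2)[OF jn], of i] True by simp
  qed (use own[OF that] in simp)
  have d: "disjoint_family_on ?A (agents n)"
    unfolding disjoint_family_on_def
  proof (intro ballI impI)
    fix i k assume ik: "i \<in> agents n" "k \<in> agents n" "i \<noteq> k"
    then have "A i \<inter> A k = {}" using disj unfolding disjoint_family_on_def by blast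
    then show "?A i \<inter> ?A k = {}" using AM(2)[OF ik(1)] AM(2)[OF ik(2)] ik(3) by auto
  qed
  have "(\<Union>i\<in>agents n. ?A i) = insert g (\<Union>i\<in>agents n. A i)"
    using jn by (auto split: if_splits)
  then have "(\<Union>i\<in>agents n. ?A i) = insert g (goods - insert g R)" unfolding un .
  moreover have "insert g (goods - insert g R) = goods - R" using gg g by blast
  ultimately have u: "(\<Union>i\<in>agents n. ?A i) = goods - R" by (rule trans)
  have sub: "P i \<subseteq> ?A i" if "i \<in> agents n" for i using PA[OF that] by auto
  have "scatter_witness S ?A R P R0"
    unfolding scatter_witness_def
    by (intro conjI ballI sw noswap d u sub o w) (use RR in blast)+
  then show ?thesis unfolding scatter_inv_def by blast
qed

lemma done_inv:
  assumes inv: "scatter_inv S A {}"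
    and D: "disjoint_family_on D (agents n)" "(\<Union>i\<in>agents n. D i) = junk n M v"
  shows "config_inv (Done (\<lambda>i. A i \<union> D i))"
proof -
  obtain P R0 where "scatter_witness S A {} P R0" using inv unfolding scatter_inv_def by blast
  then have sw: "swap_inv S P R0" and disj: "disjoint_family_on A (agents n)"
    and un': "(\<Union>i\<in>agents n. A i) = goods - {}"
    and own: "\<And>i. i\<in>agents n \<Longrightarrow> worth i (A i) = card (P i)"
    and bd: "\<And>i k. \<lbrakk>i\<in>agents n; k\<in>agents n\<rbrakk> \<Longrightarrow> worth i (A k) \<le> capa"
    unfolding scatter_witness_def by blast+
  have un: "(\<Union>i\<in>agents n. A i) = goods" using un' by simp
  have sz: "\<And>i. i\<in>agents n \<Longrightarrow> lvl \<le> card (P i)" using sw unfolding swap_inv_def by blast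
  let ?A = "\<lambda>i. A i \<union> D i"
  have junkM: "junk n M v \<subseteq> M" unfolding junk_def by blast
  have U: "(\<Union>i\<in>agents n. ?A i) = M" using un D(2) junkM by blast
  have sub: "?A i \<subseteq> M" if "i \<in> agents n" for i using U that by blast
  have "disjoint_family_on ?A (agents n)"
    unfolding disjoint_family_on_def
  proof (intro ballI impI)
    fix i k assume ik: "i \<in> agents n" "k \<in> agents n" "i \<noteq> k"
    then have "A i \<inter> A k = {}" "D i \<inter> D k = {}"
      using disj D(1) unfolding disjoint_family_on_def by blast+
    moreover have "A i \<inter> D k = {}" "D i \<inter> A k = {}" using un D(2) ik by blast+
    ultimately show "?A i \<inter> ?A k = {}" by blast
  qed
  then have al: "allocation n M ?A" unfolding allocation_def using U by blast
  have wd: "worth i (?A k) = worth i (A k)" if "i \<in> agents n" "k \<in> agents n" for i k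
  proof -
    have "v i {g} = 0" if "g \<in> D k" for g
      using D(2) that \<open>i \<in> agents n\<close> \<open>k \<in> agents n\<close> unfolding junk_def by blast
    then have "{g \<in> ?A k. v i {g} = 1} = {g \<in> A k. v i {g} = 1}" by fastforce
    then show ?thesis by simp
  qed
  \<comment> \<open>One statement for both notions: \<open>l = i\<close> gives EF1 and
    \<open>l = k\<close> gives EQ1. The bundle is worth at most \<open>Suc lvl\<close> to
    \<open>l\<close>, so removing a valued good, if there is one, brings it down to
    \<open>lvl\<close>, which \<open>i\<close> has.\<close>
  have drop: "\<exists>g\<in>?A k. v l (?A k - {g}) \<le> v i (?A i)"
    if i: "i \<in> agents n" and k: "k \<in> agents n" and l: "l \<in> agents n" and ne: "?A k \<noteq> {}" for i k l
  proof -
    have low: "real lvl \<le> v i (?A i)"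
      using v_eq_worth[OF i sub[OF i]] wd[OF i i] own[OF i] sz[OF i] by simp
    have up: "worth l (?A k) \<le> Suc lvl" using bd[OF l k] wd[OF l k] by (simp add: cap_def)
    have eq: "v l (?A k - {g}) = real (worth l (?A k - {g}))" for g
      using v_eq_worth[OF l, of "?A k - {g}"] sub[OF k] by blast
    have fin: "finite (?A k)" using sub[OF k] finM finite_subset by blast
    obtain g where g: "g \<in> ?A k" "worth l (?A k - {g}) \<le> lvl"
    proof (cases "\<exists>g\<in>?A k. v l {g} = 1")
      case True
      then obtain g where g: "g \<in> ?A k" "v l {g} = 1" by blast
      then have "insert g (?A k - {g}) = ?A k" by blast
      moreover have "worth l (insert g (?A k - {g})) = worth l (?A k - {g}) + 1"
        using worth_insert[of "?A k - {g}" g l] sub[OF k] g(2) by force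
      ultimately have "worth l (?A k) = worth l (?A k - {g}) + 1" by (simp only:)
      then show ?thesis using that[OF g(1)] up by simp
    next
      case False
      obtain g where g: "g \<in> ?A k" using ne by blast
      have "{x \<in> ?A k - {g}. v l {x} = 1} = {}" using False by blast
      then have "worth l (?A k - {g}) = 0" by (simp only: card.empty)
      then show ?thesis using that[OF g] by simp
    qed
    then show ?thesis using low eq by (intro bexI[OF _ g(1)]) simp
  qed
  show ?thesis unfolding config_inv.simps EF1_def EQ1_def using al drop by blast
qed

section \<open>Termination and absence of stuck configurations\<close>

lemma junk_distribution_ex:
  "\<exists>D. disjoint_family_on D (agents n) \<and> (\<Union>i\<in>agents n. D i) = junk n M v"
  using n_pos by (intro exI[of _ "\<lambda>i. if i = 1 then junk n M v else {}"])
    (auto simp: disjoint_family_on_def split: if_splits)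

text \<open>Each remaining good pays 2, for being picked and for being placed, and each swap lowers
  the number of goods in \<open>R\<close> valued by all of \<open>S\<close>. The initial value
  allows for \<open>R\<close> as large as \<open>M\<close>.\<close>

primrec rank :: "'a config \<Rightarrow> nat" where
  "rank Start = 3 * card M + 3"
| "rank (Swapping S P R) = 2 * card R + card {g \<in> R. tau v S g = S} + 2"
| "rank (Scattering S A R) = 2 * card R + 1"
| "rank (Placing S A R g) = 2 * card R + 2"
| "rank (Done A) = 0"

lemma swap_inv_R: "swap_inv S P R \<Longrightarrow> R \<subseteq> M"
  and scatter_inv_R: "scatter_inv S A R \<Longrightarrow> R \<subseteq> M"
  unfolding scatter_inv_def scatter_witness_def swap_inv_def unassigned_def by blast+

text \<open>Both claims are proved together because the decrease of the cardinalities needs the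
  finiteness of \<open>R\<close>, which comes from the invariant.\<close>

lemma step_inv:
  assumes "ls_step n M v c c'" "config_inv c"
  shows "config_inv c' \<and> rank c' < rank c"
  using assms
proof cases
  case (level P)
  let ?R = "unassigned n M v P"
  have "?R \<subseteq> M" by (auto simp: unassigned_def)
  then have "card ?R \<le> card M" "card {g \<in> ?R. tau v (reachable_agents n M v P) g = reachable_agents n M v P} \<le> card M"
    using finM by (auto intro!: card_mono)
  then show ?thesis using level swap_inv_start by simp
next
  case (swap S P R g h g')
  have inv: "swap_inv S P R" using assms(2) swap by simp
  note sw = swap_inv_swap[OF inv swap(3)]
  have "finite {x \<in> R. tau v S x = S}" using swap_inv_R[OF inv] finM by (auto dest: finite_subset)
  moreover have "g \<in> {x \<in> R. tau v S x = S}" using swap(3) unfolding swappable_def by blast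
  ultimately have "card ({x \<in> R. tau v S x = S} - {g}) < card {x \<in> R. tau v S x = S}"
    by (rule card_Diff1_less)
  then show ?thesis unfolding swap(1,2) config_inv.simps rank.simps sw(2,3) using sw(1) by simp
next
  case (swap_exit S P R)
  then show ?thesis using assms(2) scatter_inv_start by simp
next
  case (pick g R S A)
  have inv: "scatter_inv S A R" using assms(2) pick by simp
  have "insert g (R - {g}) = R" using pick by blast
  moreover have "finite R" using scatter_inv_R[OF inv] finM finite_subset by blast
  ultimately show ?thesis using inv pick card_Suc_Diff1[of R g] by simp
next
  case (place j S g A R)
  then show ?thesis using assms(2) scatter_inv_place by simp
next
  case (finish D S A)
  then show ?thesis using assms(2) done_inv[of S A D] by simp
qed

text \<open>The rank is a budget from which every step takes at least one, whatever choices the run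
  makes.\<close>

lemma steps_inv:
  "(ls_step n M v ^^ l) Start c \<Longrightarrow> config_inv c \<and> l + rank c \<le> 3 * card M + 3"
proof (induction l arbitrary: c)
  case 0
  then show ?case by auto
next
  case (Suc l)
  then obtain b where "(ls_step n M v ^^ l) Start b" "ls_step n M v b c" by auto
  then show ?case using Suc.IH step_inv by fastforce
qed

text \<open>The placing of a good is the only configuration that could be stuck; there
  \<open>receiver_ex\<close> provides the transition.\<close>

lemma progress:
  assumes "normalized n M v" "n \<le> 7" "config_inv c" "\<nexists>A. c = Done A"
  shows "\<exists>c'. ls_step n M v c c'"
proof (cases c)
  case Start
  then show ?thesis using max_level_family_ex ls_step.level by blast
next
  case (Swapping S P R)
  show ?thesis
  proof (cases "\<exists>g h g'. swappable v S P R g h g'")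
    case True
    then obtain g h g' where "swappable v S P R g h g'" by blast
    from ls_step.swap[OF this] show ?thesis unfolding Swapping by (rule exI)
  next
    case False
    from ls_step.swap_exit[OF this] show ?thesis unfolding Swapping by (rule exI)
  qed
next
  case (Scattering S A R)
  show ?thesis
  proof (cases "R = {}")
    case True
    obtain D where "disjoint_family_on D (agents n)" "(\<Union>i\<in>agents n. D i) = junk n M v"
      using junk_distribution_ex by blast
    from ls_step.finish[OF this] show ?thesis unfolding Scattering True by (rule exI)
  next
    case False
    then obtain g where "g \<in> R" by blast
    from ls_step.pick[OF this] show ?thesis unfolding Scattering by (rule exI)
  qed
next
  case (Placing S A R g)
  then have "scatter_inv S A (insert g R)" using assms(3) by simp
  from receiver_ex[OF assms(1,2) this] obtain j
    where j: "j \<in> agents n - tau v S g" "\<forall>i\<in>tau v S g. v i (A j \<union> {g}) \<le> real capa" by blast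
  then have "ls_step n M v (Placing S A R g) (Scattering S (A(j := A j \<union> {g})) R)"
    by (rule ls_step.place)
  then show ?thesis unfolding Placing by (rule exI)
next
  case (Done A)
  then show ?thesis using assms(4) by blast
qed

end

section \<open>Bounded loop programs\<close>

abbreviation Var :: "string \<Rightarrow> expr" where "Var x \<equiv> Cell x (Const 0) (Const 0)"
abbreviation Entry :: "string \<Rightarrow> expr \<Rightarrow> expr" where "Entry x e \<equiv> Cell x e (Const 0)"
abbreviation Eq :: "expr \<Rightarrow> expr \<Rightarrow> test" where "Eq a b \<equiv> Conj (Neg (Lt a b)) (Neg (Lt b a))"
abbreviation Pos :: "expr \<Rightarrow> test" where "Pos a \<equiv> Lt (Const 0) a"

text \<open>Counting loops always terminate, so \<open>run\<close> is a total function on stores and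
  correctness needs no reasoning about derivations of \<open>exec\<close>. Assignments reach column
  0 only; the programs below just read the one true matrix, \<open>val\<close>.\<close>

datatype cmd =
    CSkip
  | CSet string expr expr
  | CSeq cmd cmd (infixr ";;" 60)
  | CIf test cmd cmd
  | CFor string expr cmd

primrec compile :: "cmd \<Rightarrow> prog" where
  "compile CSkip = Skip"
| "compile (CSet x a e) = Assign x a (Const 0) e"
| "compile (c ;; d) = Seq (compile c) (compile d)"
| "compile (CIf t c d) = Cond t (compile c) (compile d)"
| "compile (CFor x e c) = Seq (Assign x (Const 0) (Const 0) (Const 0))
     (Loop (Lt (Var x) e) (Seq (compile c) (Assign x (Const 0) (Const 0) (Add (Var x) (Const 1)))))"

text \<open>The counter is set at the start of every round and to the bound at the end. The compiled
  loop agrees with this as long as the body leaves the counter alone and the bound is constant,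
  which \<open>wf_cmd\<close> demands.\<close>

primrec run :: "cmd \<Rightarrow> store \<Rightarrow> store" where
  "run CSkip s = s"
| "run (CSet x a e) s = store_upd x (eval_expr a s) 0 (eval_expr e s) s"
| "run (c ;; d) s = run d (run c s)"
| "run (CIf t c d) s = (if eval_test t s then run c s else run d s)"
| "run (CFor x e c) s = store_upd x 0 0 (eval_expr e s)
     (fold (\<lambda>k s. run c (store_upd x 0 0 k s)) [0..<eval_expr e s] s)"

primrec writes :: "cmd \<Rightarrow> string set" where
  "writes CSkip = {}"
| "writes (CSet x a e) = {x}"
| "writes (c ;; d) = writes c \<union> writes d"
| "writes (CIf t c d) = writes c \<union> writes d"
| "writes (CFor x e c) = insert x (writes c)"

text \<open>Loop bounds only mention the input sizes, so that they are constant during execution.\<close>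

primrec size_expr :: "expr \<Rightarrow> bool" where
  "size_expr (Const k) = True"
| "size_expr (Cell x a b) = (x \<in> {''n'', ''m''} \<and> a = Const 0 \<and> b = Const 0)"
| "size_expr (Add a b) = (size_expr a \<and> size_expr b)"
| "size_expr (Sub a b) = False"

primrec wf_cmd :: "cmd \<Rightarrow> bool" where
  "wf_cmd CSkip = True"
| "wf_cmd (CSet x a e) = (x \<notin> {''n'', ''m''})"
| "wf_cmd (c ;; d) = (wf_cmd c \<and> wf_cmd d)"
| "wf_cmd (CIf t c d) = (wf_cmd c \<and> wf_cmd d)"
| "wf_cmd (CFor x e c) = (x \<notin> {''n'', ''m''} \<and> x \<notin> writes c \<and> size_expr e \<and> wf_cmd c)"

text \<open>The variable of the polynomial stands for the sum of the two input sizes, which bounds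
  either of them.\<close>

primrec bound :: "expr \<Rightarrow> nat poly" where
  "bound (Const k) = [:k:]"
| "bound (Cell x a b) = [:0, 1:]"
| "bound (Add a b) = bound a + bound b"
| "bound (Sub a b) = bound a"

text \<open>Branches are added instead of maximized so that the result is a polynomial. In a loop, 2
  per round pays for the test and the increment, the final 2 for the initialization and the failing
  test.\<close>

primrec cost :: "cmd \<Rightarrow> nat poly" where
  "cost CSkip = 1"
| "cost (CSet x a e) = 1"
| "cost (c ;; d) = cost c + cost d"
| "cost (CIf t c d) = cost c + cost d + 1"
| "cost (CFor x e c) = bound e * (cost c + 2) + 2"

section \<open>Compiled programs, their running time and loop rules\<close>

lemma upd_same [simp]: "store_upd x a b k s x = (s x)(a := (s x a)(b := k))"
  and upd_other [simp]: "y \<noteq> x \<Longrightarrow> store_upd x a b k s y = s y"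
  by (simp_all add: store_upd_def)

lemma upd_upd [simp]: "store_upd x a b j (store_upd x a b k s) = store_upd x a b j s"
  by (simp add: store_upd_def)

lemma run_frame: "x \<notin> writes c \<Longrightarrow> run c s x = s x"
proof (induction c arbitrary: s)
  case (CFor y e c)
  have "fold (\<lambda>k s. run c (store_upd y 0 0 k s)) ks s x = s x" for ks s
    using CFor by (induction ks arbitrary: s) auto
  then show ?case using CFor.prems by simp
qed auto

lemma run_sizes:
  "wf_cmd c \<Longrightarrow> x \<in> {''n'', ''m''} \<Longrightarrow> run c s x = s x"
proof (rule run_frame)
  show "wf_cmd c \<Longrightarrow> x \<in> {''n'', ''m''} \<Longrightarrow> x \<notin> writes c" by (induction c) auto
qed

lemma size_expr_eval:
  assumes "size_expr e" "t ''n'' 0 0 = s ''n'' 0 0" "t ''m'' 0 0 = s ''m'' 0 0"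
  shows "eval_expr e t = eval_expr e s"
  using assms by (induction e) auto

lemma size_expr_bound:
  "size_expr e \<Longrightarrow> eval_expr e s \<le> poly (bound e) (s ''n'' 0 0 + s ''m'' 0 0)"
  by (induction e) auto

lemma exec_compile:
  "wf_cmd c \<Longrightarrow> \<exists>T \<le> poly (cost c) (s ''n'' 0 0 + s ''m'' 0 0). exec (compile c) s T (run c s)"
proof (induction c arbitrary: s)
  case CSkip
  then show ?case by (auto intro!: exI[of _ 1] exec.Skip)
next
  case (CSet x a e)
  have "exec (compile (CSet x a e)) s 1 (run (CSet x a e) s)"
    using exec.Assign[of x a "Const 0" e s] by simp
  then show ?case by (intro exI[of _ 1]) simp
next
  case (CSeq c d)
  obtain T where T: "T \<le> poly (cost c) (s ''n'' 0 0 + s ''m'' 0 0)" "exec (compile c) s T (run c s)"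
    using CSeq.IH(1)[of s] CSeq.prems by auto
  obtain U where U: "U \<le> poly (cost d) (s ''n'' 0 0 + s ''m'' 0 0)"
    "exec (compile d) (run c s) U (run d (run c s))"
    using CSeq.IH(2)[of "run c s"] CSeq.prems run_sizes[of c] by auto
  show ?case using T U by (intro exI[of _ "T + U"]) (auto intro: exec.Seq)
next
  case (CIf t c d)
  show ?case
  proof (cases "eval_test t s")
    case True
    obtain T where "T \<le> poly (cost c) (s ''n'' 0 0 + s ''m'' 0 0)" "exec (compile c) s T (run c s)"
      using CIf.IH(1)[of s] CIf.prems by auto
    then show ?thesis using True exec.Cond_True[of t s "compile c" T] by (intro exI[of _ "T + 1"]) auto
  next
    case False
    obtain T where "T \<le> poly (cost d) (s ''n'' 0 0 + s ''m'' 0 0)" "exec (compile d) s T (run d s)"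
      using CIf.IH(2)[of s] CIf.prems by auto
    then show ?thesis using False exec.Cond_False[of t s "compile d" T] by (intro exI[of _ "T + 1"]) auto
  qed
next
  case (CFor x e c)
  define N where "N = eval_expr e s"
  define C where "C = poly (cost c) (s ''n'' 0 0 + s ''m'' 0 0)"
  let ?f = "\<lambda>k s. run c (store_upd x 0 0 k s)"
  let ?L = "Loop (Lt (Var x) e) (Seq (compile c) (Assign x (Const 0) (Const 0) (Add (Var x) (Const 1))))"
  have x: "x \<noteq> ''n''" "x \<noteq> ''m''" "x \<notin> writes c" and e: "size_expr e" and wf: "wf_cmd c"
    using CFor.prems by auto
  \<comment> \<open>Generalized over the counter and over the store, which has to agree with
    \<open>s\<close> on the input sizes only: these determine the number of rounds \<open>N\<close>
    and the cost bound \<open>C\<close> of a round.\<close>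
  have loop: "\<exists>T \<le> (N - k) * (C + 2) + 1.
      exec ?L (store_upd x 0 0 k t) T (store_upd x 0 0 N (fold ?f [k..<N] t))"
    if "k \<le> N" "t ''n'' = s ''n''" "t ''m'' = s ''m''" for k t
    using that
  proof (induction "N - k" arbitrary: k t)
    case 0
    have "eval_expr e (store_upd x 0 0 k t) = N"
      unfolding N_def using 0 x by (intro size_expr_eval[OF e]) auto
    then have "exec ?L (store_upd x 0 0 k t) 1 (store_upd x 0 0 k t)"
      using 0 by (intro exec.Loop_False) auto
    then show ?case using 0 by (intro exI[of _ 1]) auto
  next
    case (Suc d)
    let ?t = "store_upd x 0 0 k t" and ?u = "run c (store_upd x 0 0 k t)"
    have k: "k < N" using Suc by linarith
    have eN: "eval_expr e ?t = N"
      unfolding N_def using Suc.prems x by (intro size_expr_eval[OF e]) auto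
    have u: "?u ''n'' = s ''n''" "?u ''m'' = s ''m''"
      using run_sizes[OF wf] Suc.prems x by simp_all
    have ux: "?u x = ?t x" by (rule run_frame[OF x(3)])
    obtain T where T: "T \<le> C" "exec (compile c) ?t T ?u"
      using CFor.IH[OF wf, of ?t] Suc.prems x by (auto simp: C_def)
    have "exec (Assign x (Const 0) (Const 0) (Add (Var x) (Const 1))) ?u 1 (store_upd x 0 0 (Suc k) ?u)"
      using exec.Assign[of x "Const 0" "Const 0" "Add (Var x) (Const 1)" ?u] ux by simp
    with T(2) have b: "exec (Seq (compile c) (Assign x (Const 0) (Const 0) (Add (Var x) (Const 1)))) ?t
        (T + 1) (store_upd x 0 0 (Suc k) ?u)" by (rule exec.Seq)
    obtain U where U: "U \<le> (N - Suc k) * (C + 2) + 1"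
      "exec ?L (store_upd x 0 0 (Suc k) ?u) U (store_upd x 0 0 N (fold ?f [Suc k..<N] ?u))"
    proof -
      have "d = N - Suc k" using Suc.hyps(2) by simp
      from Suc.hyps(1)[OF this _ u] k that show thesis by auto
    qed
    have "exec ?L ?t (T + 1 + U + 1) (store_upd x 0 0 N (fold ?f [k..<N] t))"
      using exec.Loop_True[OF _ b U(2)] k eN by (simp add: upt_conv_Cons)
    moreover have "N - k = Suc (N - Suc k)" using k by simp
    ultimately show ?case using T(1) U(1) by (intro exI[of _ "T + 1 + U + 1"]) auto
  qed
  obtain T where T: "T \<le> N * (C + 2) + 1"
    "exec ?L (store_upd x 0 0 0 s) T (store_upd x 0 0 N (fold ?f [0..<N] s))"
    using loop[of 0 s] by auto
  have "exec (Assign x (Const 0) (Const 0) (Const 0)) s 1 (store_upd x 0 0 0 s)"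
    using exec.Assign[of x "Const 0" "Const 0" "Const 0" s] by simp
  from exec.Seq[OF this T(2)] have "exec (compile (CFor x e c)) s (1 + T) (run (CFor x e c) s)"
    by (simp add: N_def)
  moreover have "N * (C + 2) \<le> poly (bound e) (s ''n'' 0 0 + s ''m'' 0 0) * (C + 2)"
    unfolding N_def by (intro mult_right_mono size_expr_bound e) simp
  ultimately show ?case using T(1) by (intro exI[of _ "1 + T"]) (auto simp: C_def)
qed

text \<open>The invariant rule for counting loops. The counter cell is overwritten between rounds,
  so the invariant must not depend on it; the body may use the counter value and, by framing, the
  initial contents of all arrays it does not write.\<close>

lemma run_For:
  assumes N: "eval_expr e s = N" and I0: "I 0 s"
    and step: "\<And>k t. \<lbrakk>k < N; I k t; t x 0 0 = k; \<And>y. y \<noteq> x \<Longrightarrow> y \<notin> writes c \<Longrightarrow> t y = s y\<rbrakk>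
                \<Longrightarrow> I (Suc k) (run c t)"
    and I_upd: "\<And>k j t. I k t \<Longrightarrow> I k (store_upd x 0 0 j t)"
  shows "I N (run (CFor x e c) s)"
proof -
  let ?f = "\<lambda>k s. run c (store_upd x 0 0 k s)"
  have "I k (fold ?f [0..<k] s) \<and> (\<forall>y. y \<noteq> x \<and> y \<notin> writes c \<longrightarrow> fold ?f [0..<k] s y = s y)"
    if "k \<le> N" for k
    using that
  proof (induction k)
    case 0
    then show ?case using I0 by simp
  next
    case (Suc k)
    define u where "u = fold ?f [0..<k] s"
    have u: "I k u" "\<And>y. y \<noteq> x \<Longrightarrow> y \<notin> writes c \<Longrightarrow> u y = s y" "k < N"
      using Suc unfolding u_def by auto
    have "I (Suc k) (run c (store_upd x 0 0 k u))"
      using u by (intro step I_upd) auto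
    moreover have "run c (store_upd x 0 0 k u) y = s y" if "y \<noteq> x" "y \<notin> writes c" for y
      using u(2) that by (simp add: run_frame)
    ultimately show ?case by (simp add: u_def)
  qed
  then show ?thesis using N I_upd by simp
qed

text \<open>Linear search in which the last hit wins. Earlier hits may have overwritten
  \<open>g\<close>, so test and value must not depend on its content.\<close>

lemma run_find:
  assumes N: "eval_expr e s = N" and xg: "x \<noteq> g"
    and t: "\<And>k j. k < N \<Longrightarrow> eval_test t (store_upd x 0 0 k (store_upd g 0 0 j s)) \<longleftrightarrow> Q k"
    and f: "\<And>k j. k < N \<Longrightarrow> eval_expr f (store_upd x 0 0 k (store_upd g 0 0 j s)) = F k"
  obtains j where "run (CFor x e (CIf t (CSet g (Const 0) f) CSkip)) s =
      store_upd x 0 0 N (store_upd g 0 0 j s)"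
    "(\<exists>k<N. Q k \<and> j = F k) \<or> (\<forall>k<N. \<not> Q k) \<and> j = s g 0 0"
proof -
  \<comment> \<open>Stores are compared after overwriting the counter, which makes the invariant
    insensitive to it.\<close>
  define I where "I n u \<longleftrightarrow> (\<exists>j. (\<forall>i. store_upd x 0 0 i u = store_upd x 0 0 i (store_upd g 0 0 j s)) \<and>
    ((\<exists>k<n. Q k \<and> j = F k) \<or> (\<forall>k<n. \<not> Q k) \<and> j = s g 0 0))" for n u
  let ?c = "CIf t (CSet g (Const 0) f) CSkip"
  have "I N (run (CFor x e ?c) s)"
  proof (rule run_For[OF N])
    show "I 0 s" unfolding I_def
      by (intro exI[of _ "s g 0 0"]) (simp add: store_upd_def)
  next
    fix k u assume k: "k < N" "I k u" "u x 0 0 = k"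
    obtain j where j: "\<And>i. store_upd x 0 0 i u = store_upd x 0 0 i (store_upd g 0 0 j s)"
      "(\<exists>k'<k. Q k' \<and> j = F k') \<or> (\<forall>k'<k. \<not> Q k') \<and> j = s g 0 0"
      using k(2) unfolding I_def by blast
    have "store_upd x 0 0 k u = u" using k(3) by (auto simp: store_upd_def)
    then have u: "u = store_upd x 0 0 k (store_upd g 0 0 j s)" using j(1)[of k] by simp
    show "I (Suc k) (run ?c u)"
    proof (cases "Q k")
      case True
      have "run ?c u = store_upd g 0 0 (F k) u" using t[OF k(1)] f[OF k(1)] True by (simp add: u)
      moreover have "store_upd x 0 0 i (store_upd g 0 0 (F k) u) = store_upd x 0 0 i (store_upd g 0 0 (F k) s)" for i
        unfolding u using xg by (auto simp: store_upd_def fun_eq_iff)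
      ultimately show ?thesis unfolding I_def using True by (intro exI[of _ "F k"]) auto
    next
      case False
      have "run ?c u = u" using t[OF k(1)] False by (simp add: u)
      then show ?thesis unfolding I_def using j False
        by (intro exI[of _ j]) (auto simp: less_Suc_eq)
    qed
  next
    show "I k (store_upd x 0 0 j u)" if "I k u" for k j u
      using that unfolding I_def by simp
  qed
  then obtain j where j: "\<And>i. store_upd x 0 0 i (run (CFor x e ?c) s) = store_upd x 0 0 i (store_upd g 0 0 j s)"
    "(\<exists>k<N. Q k \<and> j = F k) \<or> (\<forall>k<N. \<not> Q k) \<and> j = s g 0 0"
    unfolding I_def by blast
  have "store_upd x 0 0 N (run (CFor x e ?c) s) = run (CFor x e ?c) s" using N by simp
  then show thesis using that[of j] j by simp
qed

section \<open>Labelling reachable agents\<close>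

text \<open>Label 0 means not reached. Unassigned items have owner 0 and position 0 carries label 1,
  so these items act as sources without a case of their own.\<close>

definition relax_label :: cmd where
  "relax_label =
     CIf (Conj (Eq (Entry ''lev'' (Var ''i'')) (Const 0))
           (Conj (Eq (Cell ''val'' (Var ''i'') (Var ''k'')) (Const 1))
                 (Pos (Entry ''lev'' (Entry ''owner'' (Var ''k''))))))
       (CSet ''lev'' (Var ''i'') (Add (Entry ''lev'' (Entry ''owner'' (Var ''k''))) (Const 1)))
       CSkip"

definition relax_items :: cmd where
  "relax_items = CFor ''k'' (Var ''m'') relax_label"

definition relax_agents :: cmd where
  "relax_agents = CFor ''i'' (Add (Var ''n'') (Const 1)) relax_items"

definition init_labels :: cmd where
  "init_labels =
     CFor ''i'' (Add (Var ''n'') (Const 1)) (CSet ''lev'' (Var ''i'') (Const 0)) ;;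
     CSet ''lev'' (Const 0) (Const 1)"

text \<open>Relaxation in the style of Bellman and Ford: a round that starts incomplete labels a
  further position among 0 to n, so \<open>n + 2\<close> rounds suffice.\<close>

definition label_agents :: cmd where
  "label_agents = init_labels ;; CFor ''r'' (Add (Var ''n'') (Const 2)) relax_agents"

lemma writes_label [simp]:
  "writes relax_label = {''lev''}" "writes relax_items = {''k'', ''lev''}"
  "writes relax_agents = {''i'', ''k'', ''lev''}" "writes init_labels = {''i'', ''lev''}"
  "writes label_agents = {''i'', ''k'', ''lev'', ''r''}"
  by (auto simp: relax_label_def relax_items_def relax_agents_def init_labels_def label_agents_def)

locale enumerated_instance = binary_instance n M v for n and M :: "'a set" and v +
  fixes xs :: "'a list"
  assumes distinct_xs: "distinct xs" and set_xs: "set xs = M"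
begin

abbreviation likes :: "nat \<Rightarrow> nat \<Rightarrow> bool" where
  "likes i k \<equiv> i \<in> agents n \<and> k < length xs \<and> v i {xs ! k} = 1"

definition env :: "store \<Rightarrow> bool" where
  "env s \<longleftrightarrow> s ''n'' 0 0 = n \<and> s ''m'' 0 0 = length xs \<and>
     (\<forall>i k. s ''val'' i k = of_bool (likes i k))"

definition owners :: "(nat \<Rightarrow> nat) \<Rightarrow> bool" where
  "owners o' \<longleftrightarrow> (\<forall>k<length xs. o' k \<le> n \<and> (0 < o' k \<longrightarrow> likes (o' k) k))"

text \<open>Position 0 of a labelling stands for the unassigned items, whose owner is 0.\<close>

definition labelling :: "(nat \<Rightarrow> nat) \<Rightarrow> (nat \<Rightarrow> nat) \<Rightarrow> bool" where
  "labelling o' L \<longleftrightarrow> L 0 = 1 \<and>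
     (\<forall>i\<in>agents n. 0 < L i \<longrightarrow> (\<exists>k. likes i k \<and> 0 < L (o' k) \<and> L i = Suc (L (o' k)))) \<and>
     (\<forall>i\<le>n. L i \<le> card {j. j \<le> n \<and> 0 < L j})"

definition complete :: "(nat \<Rightarrow> nat) \<Rightarrow> (nat \<Rightarrow> nat) \<Rightarrow> bool" where
  "complete o' L \<longleftrightarrow> (\<forall>i k. likes i k \<and> 0 < L (o' k) \<longrightarrow> 0 < L i)"

lemma completeD: "complete o' L \<Longrightarrow> likes i k \<Longrightarrow> 0 < L (o' k) \<Longrightarrow> 0 < L i"
  unfolding complete_def by blast

lemma env_cong:
  "env s \<Longrightarrow> t ''n'' = s ''n'' \<Longrightarrow> t ''m'' = s ''m'' \<Longrightarrow> t ''val'' = s ''val'' \<Longrightarrow> env t"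
  by (simp add: env_def)

lemma envD: "env s \<Longrightarrow> s ''n'' 0 0 = n" "env s \<Longrightarrow> s ''m'' 0 0 = length xs"
  "env s \<Longrightarrow> s ''val'' i k = of_bool (likes i k)"
  unfolding env_def by blast+

lemma card_insert_label:
  assumes "i \<le> n" "L i = (0::nat)" "0 < c"
  shows "card {j. j \<le> n \<and> 0 < (L(i := c)) j} = Suc (card {j. j \<le> n \<and> 0 < L j})"
proof -
  have "{j. j \<le> n \<and> 0 < (L(i := c)) j} = insert i {j. j \<le> n \<and> 0 < L j}" using assms by auto
  then show ?thesis using assms by simp
qed

text \<open>The new label exceeds an old one by one, and so does the number of labelled positions;
  this keeps the clause that later bounds the length of an augmenting walk. The owner of
  \<open>k\<close> differs from \<open>i\<close> because it is already labelled.\<close>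

lemma labelling_extend:
  assumes L: "labelling o' L" and o': "owners o'" and i: "likes i k" "L i = 0" "0 < L (o' k)"
  shows "labelling o' (L(i := Suc (L (o' k))))"
proof -
  let ?L = "L(i := Suc (L (o' k)))"
  have ok: "o' k \<le> n" "o' k \<noteq> i" "i \<noteq> 0" "i \<le> n" using o' i unfolding owners_def by auto
  have L0: "L 0 = 1" and Lp: "\<And>j. j \<in> agents n \<Longrightarrow> 0 < L j \<Longrightarrow> \<exists>k. likes j k \<and> 0 < L (o' k) \<and> L j = Suc (L (o' k))"
    and Lc: "\<And>j. j \<le> n \<Longrightarrow> L j \<le> card {j. j \<le> n \<and> 0 < L j}"
    using L unfolding labelling_def by blast+
  have "\<exists>k. likes j k \<and> 0 < ?L (o' k) \<and> ?L j = Suc (?L (o' k))" if "j \<in> agents n" "0 < ?L j" for j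
  proof (cases "j = i")
    case True
    then show ?thesis using i ok by (intro exI[of _ k]) auto
  next
    case False
    then have "0 < L j" using that(2) by simp
    from Lp[OF that(1) this] obtain k'
      where k': "likes j k'" "0 < L (o' k')" "L j = Suc (L (o' k'))" by blast
    then have "o' k' \<noteq> i" using i(2) by auto
    then show ?thesis using k' False by (intro exI[of _ k']) auto
  qed
  moreover have "?L j \<le> card {j. j \<le> n \<and> 0 < ?L j}" if "j \<le> n" for j
    unfolding card_insert_label[of i L "Suc (L (o' k))", OF ok(4) i(2) zero_less_Suc]
    using Lc[OF that] Lc[OF ok(1)] by (cases "j = i") auto
  moreover have "?L 0 = 1" using L0 ok by simp
  ultimately show ?thesis unfolding labelling_def by blast
qed

definition lev :: "store \<Rightarrow> nat \<Rightarrow> nat" where "lev s i = s ''lev'' i 0"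
definition owner :: "store \<Rightarrow> nat \<Rightarrow> nat" where "owner s k = s ''owner'' k 0"

text \<open>\<open>L\<close> is the labelling at the start of a round, the fixed reference for
  measuring the progress of that round, although labels set during the round are used at
  once.\<close>

definition extends :: "(nat \<Rightarrow> nat) \<Rightarrow> (nat \<Rightarrow> nat) \<Rightarrow> (nat \<Rightarrow> nat) \<Rightarrow> bool" where
  "extends o' L L' \<longleftrightarrow> labelling o' L' \<and> (\<forall>i. 0 < L i \<longrightarrow> L' i = L i) \<and> (complete o' L \<longrightarrow> L' = L)"

lemma relax:
  assumes ext: "extends o' L (lev t)" and o': "owners o'" and ot: "owner t = o'"
    and e: "env t" and k: "t ''k'' 0 0 = k" "k < length xs" and i: "t ''i'' 0 0 = i"
  defines "t' \<equiv> run relax_label t"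
  shows "extends o' L (lev t')" "\<And>j. 0 < lev t j \<Longrightarrow> lev t' j = lev t j"
    "likes i k \<Longrightarrow> 0 < L (o' k) \<Longrightarrow> 0 < lev t' i"
proof -
  define C where "C \<longleftrightarrow> lev t i = 0 \<and> likes i k \<and> 0 < lev t (o' k)"
  have "lev t' = (if C then (lev t)(i := Suc (lev t (o' k))) else lev t)"
  proof -
    have o'k: "t ''owner'' k 0 = o' k" using ot by (auto simp: owner_def)
    have test: "eval_test (Conj (Eq (Entry ''lev'' (Var ''i'')) (Const 0))
              (Conj (Eq (Cell ''val'' (Var ''i'') (Var ''k'')) (Const 1))
                    (Pos (Entry ''lev'' (Entry ''owner'' (Var ''k'')))))) t \<longleftrightarrow> C"
      unfolding C_def lev_def eval_test.simps eval_expr.simps k(1) i o'k envD(3)[OF e]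
      by (cases "likes i k") (simp_all only: of_bool_eq simp_thms, linarith+)
    show ?thesis unfolding t'_def relax_label_def run.simps test
      by (simp add: k(1) i o'k lev_def fun_eq_iff)
  qed
  note t' = this
  show ext': "extends o' L (lev t')"
  proof (cases C)
    case True
    then have "\<not> complete o' (lev t)" using completeD[of o' "lev t" i k] unfolding C_def by linarith
    then have "\<not> complete o' L" using ext unfolding extends_def by auto
    moreover have "labelling o' (lev t')"
      using labelling_extend[of o' "lev t" i k] ext o' True unfolding t' C_def extends_def by simp
    ultimately show ?thesis using ext True unfolding extends_def t' C_def by auto
  qed (use ext t' in simp)
  show "0 < lev t j \<Longrightarrow> lev t' j = lev t j" for j unfolding t' C_def by auto
  show "0 < lev t' i" if "likes i k" "0 < L (o' k)"
    using ext that unfolding t' extends_def C_def by auto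
qed

lemma label_agents:
  assumes e: "env s" and o': "owners (owner s)"
  shows "labelling (owner s) (lev (run label_agents s))" "complete (owner s) (lev (run label_agents s))"
proof -
  let ?o = "owner s"
  define same where "same t \<longleftrightarrow> env t \<and> owner t = ?o" for t
  have same_upd: "same (store_upd x 0 0 j t) \<longleftrightarrow> same t" "lev (store_upd x 0 0 j t) = lev t"
    if "x \<in> {''i'', ''k'', ''r''}" for x j t
  proof -
    have "x \<noteq> ''n''" "x \<noteq> ''m''" "x \<noteq> ''val''" "x \<noteq> ''owner''" "x \<noteq> ''lev''" using that by auto
    then show "same (store_upd x 0 0 j t) \<longleftrightarrow> same t" "lev (store_upd x 0 0 j t) = lev t"
      by (simp_all add: same_def env_def owner_def[abs_def] lev_def[abs_def])
  qed
  have same_frame: "same u" if "same t" "\<And>y. y \<notin> {''lev'', ''i'', ''k'', ''r''} \<Longrightarrow> u y = t y" for t u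
  proof -
    have "u ''n'' = t ''n''" "u ''m'' = t ''m''" "u ''val'' = t ''val''" "u ''owner'' = t ''owner''"
      by (simp_all add: that(2))
    then show ?thesis using that(1) env_cong[of t u] by (simp add: same_def owner_def[abs_def])
  qed
  \<comment> \<open>\<open>L\<close> stays the labelling from the start of the round, while
    \<open>t\<close> is the store after the agents treated before \<open>i\<close>.\<close>
  have inner: "extends ?o L (lev (run relax_items t)) \<and> (\<forall>j. 0 < lev t j \<longrightarrow> lev (run relax_items t) j = lev t j) \<and>
      (\<forall>k. likes i k \<and> 0 < L (?o k) \<longrightarrow> 0 < lev (run relax_items t) i)"
    if "same t" "extends ?o L (lev t)" "t ''i'' 0 0 = i" for L t i
  proof -
    let ?I = "\<lambda>k u. extends ?o L (lev u) \<and> (\<forall>j. 0 < lev t j \<longrightarrow> lev u j = lev t j) \<and>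
      (\<forall>k'<k. likes i k' \<and> 0 < L (?o k') \<longrightarrow> 0 < lev u i)"
    have "?I (length xs) (run relax_items t)"
    unfolding relax_items_def
    proof (rule run_For[where I = ?I])
      fix k u assume k: "k < length xs" and I: "?I k u" and uk: "u ''k'' 0 0 = k"
        and fr: "\<And>y. y \<noteq> ''k'' \<Longrightarrow> y \<notin> writes relax_label \<Longrightarrow> u y = t y"
      have "same u" using that(1) fr by (rule same_frame) auto
      moreover have "u ''i'' 0 0 = i" using fr that(3) by simp
      ultimately have "extends ?o L (lev (run relax_label u))" 
        "\<And>j. 0 < lev u j \<Longrightarrow> lev (run relax_label u) j = lev u j"
        "likes i k \<Longrightarrow> 0 < L (?o k) \<Longrightarrow> 0 < lev (run relax_label u) i"
        using relax[of ?o L u k i] I o' uk k unfolding same_def by blast+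
      then show "?I (Suc k) (run relax_label u)"
        using I by (simp only: less_Suc_eq) (metis neq0_conv)
    next
      show "?I k (store_upd ''k'' 0 0 j u)" if "?I k u" for k j u
        using that same_upd(2) by simp
    qed (use that in \<open>simp_all add: same_def envD\<close>)
    then show ?thesis by blast
  qed
  have round: "extends ?o (lev t) (lev (run relax_agents t))"
    "\<And>i k. likes i k \<Longrightarrow> 0 < lev t (?o k) \<Longrightarrow> 0 < lev (run relax_agents t) i"
    if "same t" "labelling ?o (lev t)" for t
  proof -
    let ?I = "\<lambda>i u. extends ?o (lev t) (lev u) \<and>
      (\<forall>i'<i. \<forall>k. likes i' k \<and> 0 < lev t (?o k) \<longrightarrow> 0 < lev u i')"
    have "?I (n + 1) (run relax_agents t)"
    unfolding relax_agents_def
    proof (rule run_For[where I = ?I])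
      fix i u assume i: "i < n + 1" and I: "?I i u" and ui: "u ''i'' 0 0 = i"
        and fr: "\<And>y. y \<noteq> ''i'' \<Longrightarrow> y \<notin> writes relax_items \<Longrightarrow> u y = t y"
      have "same u" using that(1) fr by (rule same_frame) auto
      from inner[OF this _ ui, of "lev t"] I
      show "?I (Suc i) (run relax_items u)" by (simp only: less_Suc_eq) (metis neq0_conv)
    next
      show "?I i (store_upd ''i'' 0 0 j u)" if "?I i u" for i j u
        using that same_upd(2) by simp
    next
      show "?I 0 t" using that by (simp add: extends_def)
    qed (use that in \<open>simp add: same_def envD\<close>)
    note I = this
    show "extends ?o (lev t) (lev (run relax_agents t))" using I by (rule conjunct1)
    show "0 < lev (run relax_agents t) i" if "likes i k" "0 < lev t (?o k)" for i k
    proof -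
      have "i < n + 1" using that(1) by simp
      then show ?thesis using conjunct2[OF I] that by blast
    qed
  qed
  define s1 where "s1 = run init_labels s"
  have zero: "\<forall>i<n+1. lev (run (CFor ''i'' (Add (Var ''n'') (Const 1)) (CSet ''lev'' (Var ''i'') (Const 0))) s) i = 0"
    by (rule run_For[where I = "\<lambda>k u. \<forall>i<k. lev u i = 0"]) (auto simp: envD[OF e] lev_def less_Suc_eq)
  have same1: "same s1" unfolding s1_def same_def
    by (intro conjI env_cong[OF e]) (simp_all add: run_frame owner_def[abs_def])
  have lev1: "lev s1 0 = 1" "\<And>i. i \<in> agents n \<Longrightarrow> lev s1 i = 0" using zero by (auto simp: s1_def init_labels_def lev_def simp del: run.simps(5))
  have "0 < lev s1 j \<longleftrightarrow> j = 0" if "j \<le> n" for j using lev1 that by (cases "j = 0") auto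
  then have "{j. j \<le> n \<and> 0 < lev s1 j} = {0}" by auto
  then have card1: "card {j. j \<le> n \<and> 0 < lev s1 j} = 1" by simp
  have "lev s1 j \<le> 1" if "j \<le> n" for j using lev1 that by (cases "j = 0") auto
  then have lab1: "labelling ?o (lev s1)" unfolding labelling_def card1 using lev1 by auto
  \<comment> \<open>Only \<open>n + 1\<close> positions exist, so for \<open>r = n + 2\<close> the
    second alternative is impossible and completeness remains.\<close>
  let ?J = "\<lambda>r u. labelling ?o (lev u) \<and> (complete ?o (lev u) \<or> r < card {j. j \<le> n \<and> 0 < lev u j})"
  have J: "?J (n + 2) (run (CFor ''r'' (Add (Var ''n'') (Const 2)) relax_agents) s1)"
  proof (rule run_For[where I = ?J])
    show "?J 0 s1" using lab1 card1 by simp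
  next
    fix r u assume r: "r < n + 2" and J: "?J r u" and ur: "u ''r'' 0 0 = r"
        and fr: "\<And>y. y \<noteq> ''r'' \<Longrightarrow> y \<notin> writes relax_agents \<Longrightarrow> u y = s1 y"
    have "same u" using same1 fr by (rule same_frame) auto
    note rd = round[OF this conjunct1[OF J]]
    have ext: "labelling ?o (lev (run relax_agents u))" "\<And>i. 0 < lev u i \<Longrightarrow> lev (run relax_agents u) i = lev u i"
      "complete ?o (lev u) \<Longrightarrow> lev (run relax_agents u) = lev u"
      using rd(1) unfolding extends_def by blast+
    show "?J (Suc r) (run relax_agents u)"
    proof (cases "complete ?o (lev u)")
      case True
      then show ?thesis using ext(1) ext(3)[OF True] by simp
    next
      case False
      then obtain i k where ik: "likes i k" "0 < lev u (?o k)" "lev u i = 0" unfolding complete_def by blast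
      then have "0 < lev (run relax_agents u) i" using rd(2) by blast
      moreover have "\<forall>j. 0 < lev u j \<longrightarrow> 0 < lev (run relax_agents u) j" using ext(2) by simp
      then have "{j. j \<le> n \<and> 0 < lev u j} \<subseteq> {j. j \<le> n \<and> 0 < lev (run relax_agents u) j}"
        by auto
      moreover have "i \<in> {j. j \<le> n \<and> 0 < lev (run relax_agents u) j}"
        "i \<notin> {j. j \<le> n \<and> 0 < lev u j}" using ik(1,3) calculation(1) by auto
      ultimately have "{j. j \<le> n \<and> 0 < lev u j} \<subset> {j. j \<le> n \<and> 0 < lev (run relax_agents u) j}"
        by blast
      then have "card {j. j \<le> n \<and> 0 < lev u j} < card {j. j \<le> n \<and> 0 < lev (run relax_agents u) j}"
        by (rule psubset_card_mono[rotated]) simp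
      then show ?thesis using ext(1) False J by auto
    qed
  next
    show "?J r (store_upd ''r'' 0 0 j u)" if "?J r u" for r j u
      using that same_upd(2) by simp
  next
    show "eval_expr (Add (Var ''n'') (Const 2)) s1 = n + 2" using same1 by (simp add: same_def envD)
  qed
  have fin: "run label_agents s = run (CFor ''r'' (Add (Var ''n'') (Const 2)) relax_agents) s1"
    by (simp add: label_agents_def s1_def del: run.simps(5))
  have "card {j. j \<le> n \<and> 0 < lev (run label_agents s) j} \<le> card {..n}"
    by (intro card_mono) auto
  then show "labelling ?o (lev (run label_agents s))" "complete ?o (lev (run label_agents s))"
    using J unfolding fin by auto
qed

end

section \<open>Augmentation\<close>

definition count_items :: cmd where
  "count_items =
     CFor ''i'' (Add (Var ''n'') (Const 1)) (CSet ''sz'' (Var ''i'') (Const 0)) ;;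
     CFor ''k'' (Var ''m'') (CSet ''sz'' (Entry ''owner'' (Var ''k''))
       (Add (Entry ''sz'' (Entry ''owner'' (Var ''k''))) (Const 1)))"

definition find_deficient :: cmd where
  "find_deficient =
     CSet ''cur'' (Const 0) (Const 0) ;;
     CFor ''i'' (Add (Var ''n'') (Const 1))
       (CIf (Conj (Pos (Var ''i'')) (Conj (Pos (Entry ''lev'' (Var ''i'')))
              (Lt (Entry ''sz'' (Var ''i'')) (Var ''B''))))
         (CSet ''cur'' (Const 0) (Var ''i'')) CSkip)"

definition find_low :: cmd where
  "find_low =
     CSet ''low'' (Const 0) (Const 0) ;;
     CFor ''i'' (Add (Var ''n'') (Const 1))
       (CIf (Conj (Pos (Var ''i'')) (Lt (Entry ''sz'' (Var ''i'')) (Var ''B'')))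
         (CSet ''low'' (Const 0) (Const 1)) CSkip)"

text \<open>One exchange along an augmenting path, followed back from the deficient agent. Only
  position 0 has label 1, so the path ends at an unassigned item.\<close>

definition walk_step :: cmd where
  "walk_step =
     CFor ''k'' (Var ''m'')
       (CIf (Conj (Eq (Cell ''val'' (Var ''cur'') (Var ''k'')) (Const 1))
              (Conj (Pos (Entry ''lev'' (Entry ''owner'' (Var ''k''))))
                 (Eq (Entry ''lev'' (Var ''cur'')) (Add (Entry ''lev'' (Entry ''owner'' (Var ''k''))) (Const 1)))))
         (CSet ''g'' (Const 0) (Var ''k'')) CSkip) ;;
     CSet ''h'' (Const 0) (Entry ''owner'' (Var ''g'')) ;;
     CSet ''owner'' (Var ''g'') (Var ''cur'') ;;
     CSet ''cur'' (Const 0) (Var ''h'')"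

definition walk :: cmd where
  "walk = CFor ''r'' (Add (Var ''n'') (Const 2)) (CIf (Pos (Var ''cur'')) walk_step CSkip)"

text \<open>One of three things happens: an augmentation, nothing because the certificate of
  maximality is reached, or an increase of \<open>B\<close> because all bundles are full.\<close>

definition level_step :: cmd where
  "level_step =
     label_agents ;; count_items ;; find_deficient ;; find_low ;;
     CIf (Pos (Var ''cur'')) walk
       (CIf (Pos (Var ''low'')) CSkip (CSet ''B'' (Const 0) (Add (Var ''B'') (Const 1))))"

lemma writes_level [simp]:
  "writes count_items = {''i'', ''k'', ''sz''}" "writes find_deficient = {''cur'', ''i''}"
  "writes find_low = {''low'', ''i''}" "writes walk_step = {''k'', ''g'', ''h'', ''owner'', ''cur''}"
  "writes walk = {''r'', ''k'', ''g'', ''h'', ''owner'', ''cur''}"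
  by (auto simp: count_items_def find_deficient_def find_low_def walk_step_def walk_def)

context enumerated_instance
begin

definition tally :: "(nat \<Rightarrow> nat) \<Rightarrow> nat \<Rightarrow> nat" where
  "tally o' i = card {k. k < length xs \<and> o' k = i}"

definition family :: "(nat \<Rightarrow> nat) \<Rightarrow> nat \<Rightarrow> 'a set" where
  "family o' i = {xs ! k | k. k < length xs \<and> o' k = i}"

lemma nth_in_family: "k < length xs \<Longrightarrow> xs ! k \<in> family o' i \<longleftrightarrow> o' k = i"
  using distinct_xs by (auto simp: family_def nth_eq_iff_index_eq)

lemma card_family: "card (family o' i) = tally o' i"
proof -
  have "family o' i = (!) xs ` {k. k < length xs \<and> o' k = i}" by (auto simp: family_def)
  moreover have "inj_on ((!) xs) {k. k < length xs \<and> o' k = i}"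
    using distinct_xs by (auto simp: inj_on_def nth_eq_iff_index_eq)
  ultimately show ?thesis by (simp add: card_image tally_def)
qed

lemma item_index: "g \<in> M \<Longrightarrow> \<exists>k<length xs. g = xs ! k"
  using set_xs by (auto simp: in_set_conv_nth)

lemma nth_goods: "likes i k \<Longrightarrow> xs ! k \<in> goods"
  using set_xs nth_mem unfolding goods_iff by blast

lemma family_valued:
  assumes "owners o'"
  shows "family o' \<in> valued"
proof -
  have "disjoint_family_on (family o') (agents n)"
    by (auto simp: disjoint_family_on_def family_def nth_eq_iff_index_eq[OF distinct_xs])
  moreover have "family o' i \<subseteq> goods \<and> (\<forall>g\<in>family o' i. v i {g} = 1)" if i: "i \<in> agents n" for i
  proof -
    have "xs ! k \<in> goods \<and> v i {xs ! k} = 1" if "k < length xs" "o' k = i" for k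
      using assms that i nth_goods[of i k] unfolding owners_def by fastforce
    then show ?thesis unfolding family_def by blast
  qed
  ultimately show ?thesis unfolding valued_families_def by blast
qed

text \<open>Owner 0 also marks junk, which the algorithm does not count as unassigned; hence the
  condition that somebody values the item.\<close>

lemma nth_unassigned:
  assumes "owners o'" "k < length xs"
  shows "xs ! k \<in> unassigned n M v (family o') \<longleftrightarrow> o' k = 0 \<and> (\<exists>i. likes i k)"
proof -
  have "xs ! k \<in> goods \<longleftrightarrow> (\<exists>i. likes i k)"
    using assms(2) set_xs nth_mem[of k xs] unfolding goods_iff by blast
  moreover have "xs ! k \<in> (\<Union>i\<in>agents n. family o' i) \<longleftrightarrow> 0 < o' k"
    using assms unfolding UN_iff nth_in_family[OF assms(2)] owners_def by fastforce
  ultimately show ?thesis unfolding unassigned_def by (simp only: Diff_iff not_gr_zero) blast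
qed

text \<open>Labelled agents are reachable by following the witnessing items down to position 0.
  Conversely, a complete labelling marks a closed set, which contains the least one.\<close>

lemma labelled_iff_reachable:
  assumes L: "labelling o' L" "complete o' L" and o': "owners o'" and i: "i \<in> agents n"
  shows "0 < L i \<longleftrightarrow> i \<in> reachable_agents n M v (family o')"
proof
  let ?S = "reachable_agents n M v (family o')"
  have cl: "closed_agents (family o') (unassigned n M v (family o')) ?S"
    by (rule reachable_closed[OF family_valued[OF o']])
  assume "0 < L i"
  then show "i \<in> ?S" using i
  proof (induction "L i" arbitrary: i rule: less_induct)
    case less
    obtain k where k: "likes i k" "0 < L (o' k)" "L i = Suc (L (o' k))"
      using L(1) less.prems unfolding labelling_def by blast
    have "xs ! k \<in> unassigned n M v (family o') \<union> (\<Union>j\<in>?S. family o' j)"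
    proof (cases "o' k = 0")
      case True
      then have "xs ! k \<in> unassigned n M v (family o')" using nth_unassigned[OF o', of k] k(1) by blast
      then show ?thesis by blast
    next
      case False
      then have "o' k \<in> agents n" using o' k(1) unfolding owners_def by fastforce
      then have "o' k \<in> ?S" using less.hyps[of "o' k"] k by simp
      moreover have "xs ! k \<in> family o' (o' k)" using k(1) by (simp add: nth_in_family)
      ultimately show ?thesis by blast
    qed
    then show ?case using cl k(1) unfolding closed_agents_def by blast
  qed
next
  let ?S = "{i \<in> agents n. 0 < L i}"
  have "closed_agents (family o') (unassigned n M v (family o')) ?S"
    unfolding closed_agents_def
  proof (intro ballI impI)
    fix g j assume g: "g \<in> unassigned n M v (family o') \<union> (\<Union>i\<in>?S. family o' i)"
      and j: "j \<in> agents n" "v j {g} = 1"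
    have "unassigned n M v (family o') \<subseteq> M" unfolding unassigned_def by blast
    moreover have "family o' i \<subseteq> M" for i using set_xs by (auto simp: family_def)
    ultimately obtain k where k: "k < length xs" "g = xs ! k" using g item_index[of g] by blast
    have "0 < L (o' k)"
    proof (cases "g \<in> unassigned n M v (family o')")
      case True
      then have "o' k = 0" using nth_unassigned[OF o' k(1)] k(2) by simp
      then show ?thesis using L(1) by (simp add: labelling_def)
    next
      case False
      then show ?thesis using g k nth_in_family[OF k(1)] by auto
    qed
    then show "j \<in> ?S" using completeD[OF L(2), of j k] j k by blast
  qed
  then have "reachable_agents n M v (family o') \<subseteq> ?S" by (intro reachable_least) auto
  then show "i \<in> reachable_agents n M v (family o') \<Longrightarrow> 0 < L i" by blast
qed

text \<open>The additive form avoids truncated subtraction and covers the case that old and new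
  owner coincide.\<close>

lemma tally_upd:
  assumes "k < length xs"
  shows "tally (o'(k := c)) i + of_bool (o' k = i) = tally o' i + of_bool (c = i)"
proof -
  define X where "X = {j. j < length xs \<and> o' j = i} - {k}"
  have fin: "finite X" "k \<notin> X" unfolding X_def by auto
  have "{j. j < length xs \<and> o' j = i} = (if o' k = i then insert k X else X)"
    "{j. j < length xs \<and> (o'(k := c)) j = i} = (if c = i then insert k X else X)"
    using assms unfolding X_def by auto
  then show ?thesis unfolding tally_def using fin by simp
qed

lemma sum_tally_le: "(\<Sum>i\<in>agents n. tally o' i) \<le> length xs"
proof -
  have "(\<Sum>i\<in>agents n. tally o' i) = card (\<Union>i\<in>agents n. {k. k < length xs \<and> o' k = i})"
    unfolding tally_def by (intro card_UN_disjoint[symmetric]) auto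
  also have "\<dots> \<le> card {..<length xs}" by (intro card_mono) auto
  finally show ?thesis by simp
qed

text \<open>State of the walk back along decreasing labels: \<open>c\<close> has given an item to the agent visited
  before (or is the starting point \<open>i0\<close>) and is one item short; items with smaller labels are
  untouched.\<close>

definition walking ::
  "(nat \<Rightarrow> nat) \<Rightarrow> (nat \<Rightarrow> nat) \<Rightarrow> nat \<Rightarrow> (nat \<Rightarrow> nat) \<Rightarrow> nat \<Rightarrow> bool" where
  "walking o' L i0 ow c \<longleftrightarrow> owners ow \<and> c \<le> n \<and> 0 < L c \<and>
     (\<forall>k<length xs. L (o' k) < L c \<longrightarrow> ow k = o' k) \<and>
     (\<forall>i\<in>agents n. tally ow i + of_bool (i = c) = tally o' i + of_bool (i = i0))"

text \<open>The labels belong to the original owners \<open>o'\<close>. The item they promise to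
  \<open>c\<close> has an original owner of smaller label, so it has not moved yet.\<close>

lemma walking_ex:
  assumes "labelling o' L" "walking o' L i0 ow c" "0 < c"
  shows "\<exists>k. likes c k \<and> 0 < L (ow k) \<and> L c = Suc (L (ow k))"
proof -
  have "c \<le> n" "0 < L c" and un: "\<And>k. k < length xs \<Longrightarrow> L (o' k) < L c \<Longrightarrow> ow k = o' k"
    using assms(2) unfolding walking_def by blast+
  then have "c \<in> agents n" "0 < L c" using assms(3) by simp_all
  then obtain k where k: "likes c k" "0 < L (o' k)" "L c = Suc (L (o' k))"
    using assms(1) unfolding labelling_def by blast
  then have "ow k = o' k" using un by simp
  then show ?thesis using k by (intro exI[of _ k]) simp
qed

text \<open>The deficit of one item passes from \<open>c\<close> to the previous owner of
  \<open>k\<close>, whose label is smaller by one.\<close>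

lemma walking_step:
  assumes w: "walking o' L i0 ow c" and k: "likes c k" "0 < L (ow k)" "L c = Suc (L (ow k))"
  shows "walking o' L i0 (ow(k := c)) (ow k)"
proof -
  have ow: "owners ow" and c: "c \<le> n" and un: "\<And>k. k < length xs \<Longrightarrow> L (o' k) < L c \<Longrightarrow> ow k = o' k"
    and t: "\<And>i. i\<in>agents n \<Longrightarrow> tally ow i + of_bool (i = c) = tally o' i + of_bool (i = i0)"
    using w unfolding walking_def by blast+
  have "owners (ow(k := c))" using ow k(1) unfolding owners_def by simp
  moreover have "ow k \<le> n" using ow k(1) unfolding owners_def by blast
  moreover have "(ow(k := c)) j = o' j" if "j < length xs" "L (o' j) < L (ow k)" for j
    using un[of j] that k(3) by (cases "j = k") auto
  moreover have "tally (ow(k := c)) i + of_bool (i = ow k) = tally o' i + of_bool (i = i0)"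
    if "i \<in> agents n" for i
  proof -
    have "tally (ow(k := c)) i + of_bool (ow k = i) = tally ow i + of_bool (c = i)"
      using k(1) by (intro tally_upd) blast
    then show ?thesis using t[OF that] unfolding eq_commute[of i] by linarith
  qed
  ultimately show ?thesis unfolding walking_def using k(2) by blast
qed

lemma walk_step:
  assumes e: "env s" and L: "labelling o' (lev s)" and w: "walking o' (lev s) i0 (owner s) (s ''cur'' 0 0)"
    and c: "0 < s ''cur'' 0 0"
  defines "s' \<equiv> run walk_step s"
  shows "walking o' (lev s) i0 (owner s') (s' ''cur'' 0 0)"
    "Suc (lev s (s' ''cur'' 0 0)) = lev s (s ''cur'' 0 0)"
proof -
  define c where "c = s ''cur'' 0 0"
  define Q where "Q k \<longleftrightarrow> likes c k \<and> 0 < lev s (owner s k) \<and> lev s c = Suc (lev s (owner s k))" for k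
  let ?t = "Conj (Eq (Cell ''val'' (Var ''cur'') (Var ''k'')) (Const 1))
              (Conj (Pos (Entry ''lev'' (Entry ''owner'' (Var ''k''))))
                 (Eq (Entry ''lev'' (Var ''cur'')) (Add (Entry ''lev'' (Entry ''owner'' (Var ''k''))) (Const 1))))"
  obtain j where j: "run (CFor ''k'' (Var ''m'') (CIf ?t (CSet ''g'' (Const 0) (Var ''k'')) CSkip)) s =
      store_upd ''k'' 0 0 (length xs) (store_upd ''g'' 0 0 j s)"
    "(\<exists>k<length xs. Q k \<and> j = k) \<or> (\<forall>k<length xs. \<not> Q k) \<and> j = s ''g'' 0 0"
  proof (rule run_find[where e = "Var ''m''" and x = "''k''" and g = "''g''" and t = ?t
        and f = "Var ''k''" and Q = Q and F = "\<lambda>k. k" and s = s and N = "length xs"])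
    show "eval_test ?t (store_upd ''k'' 0 0 k (store_upd ''g'' 0 0 j s)) \<longleftrightarrow> Q k" for k j
      using envD(3)[OF e, of c k] by (auto simp: Q_def c_def lev_def owner_def)
  qed (auto simp: envD[OF e])
  obtain k where k: "likes c k" "0 < lev s (owner s k)" "lev s c = Suc (lev s (owner s k))"
    using walking_ex[OF L w] c unfolding c_def by blast
  then have "Q j" using j(2) unfolding Q_def by blast
  then have Qj: "likes c j" "0 < lev s (owner s j)" "lev s c = Suc (lev s (owner s j))"
    unfolding Q_def by blast+
  have "owner s' = (owner s)(j := c)" "s' ''cur'' 0 0 = owner s j"
    unfolding s'_def walk_step_def run.simps(3) j(1) by (auto simp: owner_def c_def fun_eq_iff)
  then show "walking o' (lev s) i0 (owner s') (s' ''cur'' 0 0)"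
    "Suc (lev s (s' ''cur'' 0 0)) = lev s (s ''cur'' 0 0)"
    using walking_step[OF w[folded c_def] Qj] Qj(3) by (simp_all add: c_def)
qed

text \<open>Labels start at no more than \<open>n + 1\<close> and drop by one per exchange, so
  \<open>n + 2\<close> rounds bring \<open>cur\<close> to 0. Then the deficit sits at position 0,
  and among the agents only the starting one has a changed tally.\<close>

lemma walk:
  assumes e: "env s" and L: "labelling (owner s) (lev s)" and o': "owners (owner s)"
    and c: "s ''cur'' 0 0 \<in> agents n" "0 < lev s (s ''cur'' 0 0)"
  defines "s' \<equiv> run walk s"
  shows "owners (owner s')"
    "i \<in> agents n \<Longrightarrow> tally (owner s') i = tally (owner s) i + of_bool (i = s ''cur'' 0 0)"
proof -
  let ?c = "\<lambda>u. u ''cur'' 0 0 :: nat"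
  let ?b = "CIf (Pos (Var ''cur'')) walk_step CSkip"
  let ?I = "\<lambda>r u. walking (owner s) (lev s) (?c s) (owner u) (?c u) \<and> (?c u = 0 \<or> lev s (?c u) + r \<le> n + 1)"
  have bnd: "lev s (?c s) \<le> n + 1"
  proof -
    have "lev s (?c s) \<le> card {j. j \<le> n \<and> 0 < lev s j}" using L c unfolding labelling_def by auto
    also have "\<dots> \<le> card {..n}" by (intro card_mono) auto
    finally show ?thesis by simp
  qed
  have I: "?I (n + 2) (run walk s)"
    unfolding walk_def
  proof (rule run_For[where I = ?I])
    show "?I 0 s" using o' c bnd unfolding walking_def by simp
  next
    fix r u assume I: "?I r u" and fr: "\<And>y. y \<noteq> ''r'' \<Longrightarrow> y \<notin> writes ?b \<Longrightarrow> u y = s y"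
    have eu: "env u" by (rule env_cong[OF e]) (simp_all add: fr)
    have lu: "lev u = lev s" by (simp add: lev_def[abs_def] fr)
    show "?I (Suc r) (run ?b u)"
    proof (cases "?c u = 0")
      case True
      then show ?thesis using I by simp
    next
      case False
      then have r: "run ?b u = run walk_step u" by simp
      have ws: "walking (owner s) (lev s) (?c s) (owner (run walk_step u)) (?c (run walk_step u))"
        "Suc (lev s (?c (run walk_step u))) = lev s (?c u)"
        using walk_step[OF eu, of "owner s" "?c s"] L I False unfolding lu by blast+
      then show ?thesis using I False unfolding r by auto
    qed
  next
    show "?I r (store_upd ''r'' 0 0 j u)" if "?I r u" for r j u
      using that by (simp add: owner_def[abs_def])
  qed (simp add: envD[OF e])
  then have c0: "?c s' = 0" unfolding s'_def by auto
  have w: "walking (owner s) (lev s) (?c s) (owner s') 0" using I c0 unfolding s'_def by simp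
  show "owners (owner s')" using w unfolding walking_def by blast
  show "tally (owner s') i = tally (owner s) i + of_bool (i = ?c s)" if "i \<in> agents n" for i
    using w that unfolding walking_def by force
qed

end

section \<open>Computing the level\<close>

text \<open>With \<open>B = 1\<close> the empty bundles at the start are exactly one short of
  full.\<close>

definition level_loop :: cmd where
  "level_loop = CSet ''B'' (Const 0) (Const 1) ;;
     CFor ''t'' (Add (Add (Var ''m'') (Var ''m'')) (Const 2)) level_step"

text \<open>An existential quantifier over the indices 0 to n for every item. Index 0 is no agent,
  so the test itself has to fail there.\<close>

definition flag_table :: "string \<Rightarrow> test \<Rightarrow> cmd" where
  "flag_table x t = CFor ''k'' (Var ''m'')
     (CSet ''f'' (Const 0) (Const 0) ;;
      CFor ''i'' (Add (Var ''n'') (Const 1)) (CIf t (CSet ''f'' (Const 0) (Const 1)) CSkip) ;;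
      CSet x (Var ''k'') (Var ''f''))"

text \<open>With truncated subtraction \<open>1 - (1 - x)\<close> is the sign of \<open>x\<close>,
  which turns labels into the indicator of \<open>S\<close>.\<close>

definition record_sets :: cmd where
  "record_sets =
     CFor ''i'' (Add (Var ''n'') (Const 1))
       (CSet ''S'' (Var ''i'') (Sub (Const 1) (Sub (Const 1) (Entry ''lev'' (Var ''i''))))) ;;
     flag_table ''R''
       (Conj (Eq (Entry ''owner'' (Var ''k'')) (Const 0)) (Eq (Cell ''val'' (Var ''i'') (Var ''k'')) (Const 1)))"

text \<open>The labels are computed once more for the final owner array, since \<open>S\<close> is
  read off from them.\<close>

definition level_phase :: cmd where
  "level_phase = level_loop ;; label_agents ;; record_sets ;; CSet ''phase'' (Const 0) (Const 1)"

lemma writes_level_phase [simp]: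
  "writes (flag_table x t) = {''k'', ''f'', ''i'', x}"
  "writes level_step = {''lev'', ''r'', ''i'', ''k'', ''sz'', ''cur'', ''low'', ''g'', ''h'', ''owner'', ''B''}"
  "writes level_loop = {''lev'', ''r'', ''i'', ''k'', ''sz'', ''cur'', ''low'', ''g'', ''h'', ''owner'', ''B'', ''t''}"
  "writes record_sets = {''S'', ''R'', ''i'', ''k'', ''f''}"
  by (auto simp: level_step_def level_loop_def record_sets_def flag_table_def)

context enumerated_instance
begin

definition cap_cell :: "store \<Rightarrow> nat" where "cap_cell s = s ''B'' 0 0"

lemma count_items:
  assumes e: "env s" and o': "owners (owner s)" and i: "i \<le> n"
  shows "run count_items s ''sz'' i 0 = tally (owner s) i"
proof -
  let ?c = "CSet ''sz'' (Entry ''owner'' (Var ''k'')) (Add (Entry ''sz'' (Entry ''owner'' (Var ''k''))) (Const 1))"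
  define s1 where "s1 = run (CFor ''i'' (Add (Var ''n'') (Const 1)) (CSet ''sz'' (Var ''i'') (Const 0))) s"
  have z: "\<forall>i<n+1. s1 ''sz'' i 0 = 0" unfolding s1_def
    by (rule run_For[where I = "\<lambda>k u. \<forall>i<k. u ''sz'' i 0 = 0"]) (auto simp: envD[OF e] less_Suc_eq)
  have fr1: "s1 y = s y" if "y \<notin> {''i'', ''sz''}" for y
    unfolding s1_def using that by (intro run_frame) auto
  let ?I = "\<lambda>k u. \<forall>i\<le>n. u ''sz'' i 0 = card {j. j < k \<and> owner s j = i}"
  have "?I (length xs) (run (CFor ''k'' (Var ''m'') ?c) s1)"
  proof (rule run_For[where I = ?I])
    show "eval_expr (Var ''m'') s1 = length xs" by (simp add: fr1 envD[OF e])
    show "?I 0 s1" using z by simp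
  next
    fix k u assume k: "k < length xs" and I: "?I k u" and uk: "u ''k'' 0 0 = k"
      and fr: "\<And>y. y \<noteq> ''k'' \<Longrightarrow> y \<notin> writes ?c \<Longrightarrow> u y = s1 y"
    have ok: "u ''owner'' k 0 = owner s k" by (simp add: fr fr1 owner_def)
    have split: "{j. j < Suc k \<and> owner s j = i} =
      (if owner s k = i then insert k {j. j < k \<and> owner s j = i} else {j. j < k \<and> owner s j = i})" for i
      by (auto simp: less_Suc_eq)
    show "?I (Suc k) (run ?c u)"
    proof (intro allI impI)
      fix i assume i: "i \<le> n"
      have "run ?c u ''sz'' i 0 = (if owner s k = i then u ''sz'' i 0 + 1 else u ''sz'' i 0)"
        by (simp add: uk ok)
      then show "run ?c u ''sz'' i 0 = card {j. j < Suc k \<and> owner s j = i}"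
        unfolding split using I i by simp
    qed
  next
    show "?I k (store_upd ''k'' 0 0 j u)" if "?I k u" for k j u
      using that by simp
  qed
  moreover have "run count_items s = run (CFor ''k'' (Var ''m'') ?c) s1"
    unfolding count_items_def s1_def run.simps(3) ..
  ultimately show ?thesis using i unfolding tally_def by simp
qed

lemma find_deficient:
  assumes e: "env s"
  defines "c \<equiv> run find_deficient s ''cur'' 0 0"
  shows "(c \<in> agents n \<and> 0 < lev s c \<and> s ''sz'' c 0 < s ''B'' 0 0) \<or>
    c = 0 \<and> (\<forall>i\<in>agents n. 0 < lev s i \<longrightarrow> s ''B'' 0 0 \<le> s ''sz'' i 0)"
proof -
  let ?t = "Conj (Pos (Var ''i'')) (Conj (Pos (Entry ''lev'' (Var ''i''))) (Lt (Entry ''sz'' (Var ''i'')) (Var ''B'')))"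
  let ?s = "store_upd ''cur'' 0 0 0 s"
  let ?Q = "\<lambda>i. 0 < i \<and> 0 < lev s i \<and> s ''sz'' i 0 < s ''B'' 0 0"
  obtain j where j: "run (CFor ''i'' (Add (Var ''n'') (Const 1)) (CIf ?t (CSet ''cur'' (Const 0) (Var ''i'')) CSkip)) ?s =
      store_upd ''i'' 0 0 (n + 1) (store_upd ''cur'' 0 0 j ?s)"
    "(\<exists>k<n + 1. ?Q k \<and> j = k) \<or> (\<forall>k<n + 1. \<not> ?Q k) \<and> j = ?s ''cur'' 0 0"
  proof (rule run_find[where e = "Add (Var ''n'') (Const 1)" and x = "''i''" and g = "''cur''" and t = ?t
        and f = "Var ''i''" and Q = ?Q and F = "\<lambda>k. k" and s = ?s and N = "n + 1"])
    show "eval_test ?t (store_upd ''i'' 0 0 k (store_upd ''cur'' 0 0 j ?s)) \<longleftrightarrow> ?Q k" for k j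
      by (simp add: lev_def)
  qed (simp_all add: envD[OF e])
  have "run find_deficient s = run (CFor ''i'' (Add (Var ''n'') (Const 1)) (CIf ?t (CSet ''cur'' (Const 0) (Var ''i'')) CSkip)) ?s"
    by (simp add: find_deficient_def del: run.simps(5))
  then have cj: "c = j" unfolding c_def j(1) by simp
  show ?thesis using j(2)
  proof (elim disjE exE conjE)
    fix k assume "k < n + 1" "0 < k" "0 < lev s k" "s ''sz'' k 0 < s ''B'' 0 0" "j = k"
    then have "j \<in> agents n \<and> 0 < lev s j \<and> s ''sz'' j 0 < s ''B'' 0 0" by simp
    then show ?thesis unfolding cj by blast
  next
    assume none: "\<forall>k<n + 1. \<not> ?Q k" and "j = ?s ''cur'' 0 0"
    then have "j = 0" by simp
    moreover have "s ''B'' 0 0 \<le> s ''sz'' i 0" if "i \<in> agents n" "0 < lev s i" for i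
      using none[rule_format, of i] that by simp
    ultimately show ?thesis unfolding cj by blast
  qed
qed

lemma find_low:
  assumes e: "env s"
  shows "0 < run find_low s ''low'' 0 0 \<longleftrightarrow> (\<exists>i\<in>agents n. s ''sz'' i 0 < s ''B'' 0 0)"
proof -
  let ?t = "Conj (Pos (Var ''i'')) (Lt (Entry ''sz'' (Var ''i'')) (Var ''B''))"
  let ?s = "store_upd ''low'' 0 0 0 s"
  let ?Q = "\<lambda>i. 0 < i \<and> s ''sz'' i 0 < s ''B'' 0 0"
  obtain j where j: "run (CFor ''i'' (Add (Var ''n'') (Const 1)) (CIf ?t (CSet ''low'' (Const 0) (Const 1)) CSkip)) ?s =
      store_upd ''i'' 0 0 (n + 1) (store_upd ''low'' 0 0 j ?s)"
    "(\<exists>k<n + 1. ?Q k \<and> j = 1) \<or> (\<forall>k<n + 1. \<not> ?Q k) \<and> j = ?s ''low'' 0 0"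
  proof (rule run_find[where e = "Add (Var ''n'') (Const 1)" and x = "''i''" and g = "''low''" and t = ?t
        and f = "Const 1" and Q = ?Q and F = "\<lambda>k. 1" and s = ?s and N = "n + 1"])
    show "eval_test ?t (store_upd ''i'' 0 0 k (store_upd ''low'' 0 0 j ?s)) \<longleftrightarrow> ?Q k" for k j
      by simp
  qed (simp_all add: envD[OF e])
  have "run find_low s = run (CFor ''i'' (Add (Var ''n'') (Const 1)) (CIf ?t (CSet ''low'' (Const 0) (Const 1)) CSkip)) ?s"
    by (simp add: find_low_def del: run.simps(5))
  then have lj: "run find_low s ''low'' 0 0 = j" unfolding j(1) by simp
  show "0 < run find_low s ''low'' 0 0 \<longleftrightarrow> (\<exists>i\<in>agents n. s ''sz'' i 0 < s ''B'' 0 0)" using j(2) unfolding lj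
  proof (elim disjE exE conjE)
    fix k assume "k < n + 1" "0 < k" "s ''sz'' k 0 < s ''B'' 0 0" "j = 1"
    moreover from this have "k \<in> agents n" by simp
    ultimately show "0 < j \<longleftrightarrow> (\<exists>i\<in>agents n. s ''sz'' i 0 < s ''B'' 0 0)" by auto
  next
    assume none: "\<forall>k<n + 1. \<not> ?Q k" and "j = ?s ''low'' 0 0"
    then have "j = 0" by simp
    moreover have "\<not> s ''sz'' i 0 < s ''B'' 0 0" if "i \<in> agents n" for i
      using none[rule_format, of i] that by simp
    ultimately show "0 < j \<longleftrightarrow> (\<exists>i\<in>agents n. s ''sz'' i 0 < s ''B'' 0 0)" by blast
  qed
qed

definition level_state :: "store \<Rightarrow> bool" where
  "level_state s \<longleftrightarrow> env s \<and> owners (owner s) \<and>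
     (\<forall>i\<in>agents n. cap_cell s \<le> Suc (tally (owner s) i) \<and> tally (owner s) i \<le> cap_cell s)"

text \<open>The hypotheses of \<open>max_level_certificate\<close> that are reached only at the end;
  \<open>level_state\<close> holds the others throughout.\<close>

definition final_level :: "store \<Rightarrow> bool" where
  "final_level s \<longleftrightarrow>
     (\<forall>i\<in>reachable_agents n M v (family (owner s)). cap_cell s \<le> tally (owner s) i) \<and>
     (\<exists>i\<in>agents n. tally (owner s) i < cap_cell s)"

definition progress_level :: "store \<Rightarrow> nat" where
  "progress_level s = (\<Sum>i\<in>agents n. tally (owner s) i) + cap_cell s"

text \<open>Augmenting and increasing \<open>B\<close> each raise the potential by one. Both happen
  only in states that are not final, so a final state is never left.\<close>

lemma level_step:
  assumes st: "level_state s"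
  defines "u \<equiv> run level_step s"
  shows "level_state u \<and> (final_level s \<longrightarrow> final_level u) \<and>
    (final_level u \<or> progress_level s < progress_level u)"
proof -
  have e: "env s" and o': "owners (owner s)"
    and sz: "\<And>i. i \<in> agents n \<Longrightarrow> cap_cell s \<le> Suc (tally (owner s) i) \<and> tally (owner s) i \<le> cap_cell s"
    using st unfolding level_state_def by blast+
  define s1 where "s1 = run label_agents s"
  define s2 where "s2 = run count_items s1"
  define s3 where "s3 = run find_deficient s2"
  define s4 where "s4 = run find_low s3"
  have fr: "s1 y = s y" if "y \<notin> writes label_agents" for y
    using that unfolding s1_def by (rule run_frame)
  have fr2: "s2 y = s1 y" if "y \<notin> writes count_items" for y
    using that unfolding s2_def by (rule run_frame)
  have fr3: "s3 y = s2 y" if "y \<notin> writes find_deficient" for y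
    using that unfolding s3_def by (rule run_frame)
  have fr4: "s4 y = s3 y" if "y \<notin> writes find_low" for y
    using that unfolding s4_def by (rule run_frame)
  have e1: "env s1" by (rule env_cong[OF e]) (simp_all add: fr)
  have e2: "env s2" by (rule env_cong[OF e1]) (simp_all add: fr2)
  have e3: "env s3" by (rule env_cong[OF e2]) (simp_all add: fr3)
  have e4: "env s4" by (rule env_cong[OF e3]) (simp_all add: fr4)
  have ow: "owner s1 = owner s" "owner s2 = owner s" "owner s3 = owner s" "owner s4 = owner s"
    by (simp_all add: owner_def[abs_def] fr fr2 fr3 fr4)
  have B: "s2 ''B'' = s ''B''" "s3 ''B'' = s ''B''" "s4 ''B'' = s ''B''"
    by (simp_all add: fr fr2 fr3 fr4)
  have lv: "lev s2 = lev s1" "lev s4 = lev s1"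
    by (simp_all add: lev_def[abs_def] fr2 fr3 fr4)
  have L: "labelling (owner s) (lev s1)" "complete (owner s) (lev s1)"
    using label_agents[OF e o'] unfolding s1_def by blast+
  have tl: "s2 ''sz'' i 0 = tally (owner s) i" "s3 ''sz'' i 0 = tally (owner s) i" if "i \<le> n" for i
    using count_items[OF e1 _ that] o' by (simp_all add: s2_def[symmetric] ow fr3)
  have reach: "0 < lev s1 i \<longleftrightarrow> i \<in> reachable_agents n M v (family (owner s))" if "i \<in> agents n" for i
    by (rule labelled_iff_reachable[OF L o' that])
  have cur: "s4 ''cur'' = s3 ''cur''" by (simp add: fr4)
  define c where "c = s3 ''cur'' 0 0"
  have cc: "(c \<in> agents n \<and> 0 < lev s1 c \<and> tally (owner s) c < cap_cell s) \<or>
    c = 0 \<and> (\<forall>i\<in>agents n. 0 < lev s1 i \<longrightarrow> cap_cell s \<le> tally (owner s) i)"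
    using find_deficient[OF e2] tl(1) unfolding s3_def[symmetric] c_def[symmetric] lv B cap_cell_def
    by (auto; fail)
  have low: "0 < s4 ''low'' 0 0 \<longleftrightarrow> (\<exists>i\<in>agents n. tally (owner s) i < cap_cell s)"
    using find_low[OF e3] tl(2) unfolding s4_def[symmetric] B cap_cell_def by (auto; fail)
  have u: "u = run (CIf (Pos (Var ''cur'')) walk
       (CIf (Pos (Var ''low'')) CSkip (CSet ''B'' (Const 0) (Add (Var ''B'') (Const 1))))) s4"
    unfolding u_def level_step_def s4_def s3_def s2_def s1_def run.simps(3) ..
  show ?thesis
  proof (cases "c = 0")
    case False
    then have c: "c \<in> agents n" "0 < lev s1 c" "tally (owner s) c < cap_cell s" using cc by auto
    have u: "u = run walk s4" unfolding u using False by (simp add: cur c_def)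
    have W: "owners (owner u)"
      "\<And>i. i \<in> agents n \<Longrightarrow> tally (owner u) i = tally (owner s) i + of_bool (i = c)"
      using walk[OF e4] L o' c unfolding u ow lv cur c_def by blast+
    have fw: "u y = s4 y" if "y \<notin> writes walk" for y
      using that unfolding u by (rule run_frame)
    have eu: "env u" by (rule env_cong[OF e4]) (simp_all add: fw)
    have Bu: "cap_cell u = cap_cell s" by (simp add: cap_cell_def fw B)
    have "tally (owner s) i + of_bool (i = c) \<le> cap_cell s" if "i \<in> agents n" for i
      using sz[OF that] c(3) by (cases "i = c") auto
    then have "level_state u" unfolding level_state_def Bu using eu W sz by fastforce
    moreover have "\<not> final_level s"
      using c reach unfolding final_level_def by (meson not_less)
    moreover have "(\<Sum>i\<in>agents n. tally (owner u) i) = Suc (\<Sum>i\<in>agents n. tally (owner s) i)"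
    proof -
      have "(\<Sum>i\<in>agents n. tally (owner u) i) = (\<Sum>i\<in>agents n. tally (owner s) i + of_bool (i = c))"
        using W(2) by (rule sum.cong[OF HOL.refl])
      also have "\<dots> = Suc (\<Sum>i\<in>agents n. tally (owner s) i)"
        using c(1) by (simp add: sum.distrib of_bool_def)
      finally show ?thesis .
    qed
    ultimately show ?thesis unfolding progress_level_def Bu by simp
  next
    case True
    then have full: "cap_cell s \<le> tally (owner s) i"
      if "i \<in> reachable_agents n M v (family (owner s))" for i
      using cc that reach reachable_subset by fastforce
    show ?thesis
    proof (cases "s4 ''low'' 0 0 = 0")
      case False
      have "u = s4" unfolding u using True False by (simp add: cur c_def)
      then have "owner u = owner s" "cap_cell u = cap_cell s" "env u"
        using ow e4 B by (simp_all add: cap_cell_def)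
      moreover have "final_level s" unfolding final_level_def using full low False by blast
      ultimately show ?thesis using st unfolding level_state_def final_level_def by simp
    next
      case False': True
      have uB: "u = store_upd ''B'' 0 0 (s4 ''B'' 0 0 + 1) s4"
        unfolding u using True False' by (simp add: cur c_def)
      then have ou: "owner u = owner s" "cap_cell u = Suc (cap_cell s)"
        using ow B by (simp_all add: cap_cell_def owner_def[abs_def])
      have eu: "env u" unfolding uB by (rule env_cong[OF e4]) simp_all
      \<comment> \<open>All bundles have exactly \<open>cap_cell s\<close> items and are thus one
        short of the increased cap.\<close>
      have nolow: "\<not> (\<exists>i\<in>agents n. tally (owner s) i < cap_cell s)" using low False' by simp
      then have "level_state u" unfolding level_state_def ou using eu o' sz by (meson Suc_le_mono le_SucI not_less)
      moreover have "\<not> final_level s" using nolow unfolding final_level_def by blast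
      ultimately show ?thesis unfolding progress_level_def ou by simp
    qed
  qed
qed

text \<open>Unless the state is final, the potential exceeds the number of rounds. Agent 1 holds at
  least \<open>B - 1\<close> items, hence \<open>B\<close> is at most \<open>m + 1\<close> and the
  potential at most \<open>2 m + 1\<close>, which \<open>2 m + 2\<close> rounds would
  surpass.\<close>

lemma level_loop:
  assumes e: "env s" and o0: "\<And>k. owner s k = 0"
  defines "u \<equiv> run level_loop s"
  shows "level_state u \<and> final_level u"
proof -
  define s1 where "s1 = store_upd ''B'' 0 0 1 s"
  have e1: "env s1" unfolding s1_def by (rule env_cong[OF e]) simp_all
  have o1: "owner s1 k = 0" for k using o0[of k] by (simp add: s1_def owner_def)
  have B1: "cap_cell s1 = 1" by (simp add: s1_def cap_cell_def)
  have t0: "tally (owner s1) i = 0" if "i \<in> agents n" for i using that o1 by (auto simp: tally_def)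
  have st1: "level_state s1" unfolding level_state_def owners_def using e1 o1 t0 B1 by simp
  let ?I = "\<lambda>k u. level_state u \<and> (final_level u \<or> k < progress_level u)"
  have I: "?I (length xs + length xs + 2) (run (CFor ''t'' (Add (Add (Var ''m'') (Var ''m'')) (Const 2)) level_step) s1)"
  proof (rule run_For[where I = ?I])
    show "?I 0 s1" using st1 B1 by (simp add: progress_level_def)
  next
    fix k w assume I: "?I k w"
    then show "?I (Suc k) (run level_step w)" using level_step[of w] by auto
  next
    show "?I k (store_upd ''t'' 0 0 j w)" if "?I k w" for k j w
    proof -
      let ?w = "store_upd ''t'' 0 0 j w"
      have "owner ?w = owner w" "cap_cell ?w = cap_cell w" by (simp_all add: owner_def[abs_def] cap_cell_def)
      moreover have "env ?w" if "env w" using that by (rule env_cong) simp_all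
      ultimately show ?thesis using that unfolding level_state_def final_level_def progress_level_def by simp
    qed
  next
    show "eval_expr (Add (Add (Var ''m'') (Var ''m'')) (Const 2)) s1 = length xs + length xs + 2"
      by (simp add: envD[OF e1])
  qed
  have u: "u = run (CFor ''t'' (Add (Add (Var ''m'') (Var ''m'')) (Const 2)) level_step) s1"
    by (simp add: u_def s1_def level_loop_def del: run.simps(5))
  have st: "level_state u" using I unfolding u by blast
  have one: "1 \<in> agents n" using n_pos by simp
  have "tally (owner u) 1 \<le> (\<Sum>i\<in>agents n. tally (owner u) i)"
    using one by (intro member_le_sum) auto
  then have "cap_cell u \<le> Suc (length xs)"
    using st one sum_tally_le[of "owner u"] unfolding level_state_def by fastforce
  then have "progress_level u \<le> Suc (length xs + length xs)"
    unfolding progress_level_def using sum_tally_le[of "owner u"] by linarith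
  then show ?thesis using I unfolding u by auto
qed

lemma flag_table:
  assumes e: "env s" and x: "x \<notin> {''k'', ''i'', ''f'', ''n'', ''m''}"
    and t: "\<And>k i w. \<lbrakk>w ''k'' 0 0 = k; w ''i'' 0 0 = i; k < length xs; i \<le> n;
      \<And>y. y \<notin> {''k'', ''i'', ''f'', x} \<Longrightarrow> w y = s y\<rbrakk> \<Longrightarrow> eval_test t w \<longleftrightarrow> Q k i"
    and k: "k < length xs"
  shows "run (flag_table x t) s x k 0 = of_bool (\<exists>i\<le>n. Q k i)"
proof -
  let ?N = "Add (Var ''n'') (Const 1)"
  let ?f = "CFor ''i'' ?N (CIf t (CSet ''f'' (Const 0) (Const 1)) CSkip)"
  let ?b = "CSet ''f'' (Const 0) (Const 0) ;; ?f ;; CSet x (Var ''k'') (Var ''f'')"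
  have ne: "x \<noteq> ''k''" "x \<noteq> ''i''" "x \<noteq> ''f''" "x \<noteq> ''n''" "x \<noteq> ''m''" using x by simp_all
  let ?I = "\<lambda>k w. \<forall>j<k. w x j 0 = of_bool (\<exists>i\<le>n. Q j i)"
  have "?I (length xs) (run (flag_table x t) s)"
    unfolding flag_table_def
  proof (rule run_For[where I = ?I])
    show "eval_expr (Var ''m'') s = length xs" by (simp add: envD[OF e])
  next
    fix k w assume k: "k < length xs" and I: "?I k w" and wk: "w ''k'' 0 0 = k"
      and fr: "\<And>y. y \<noteq> ''k'' \<Longrightarrow> y \<notin> writes ?b \<Longrightarrow> w y = s y"
    let ?w = "store_upd ''f'' 0 0 0 w"
    obtain j where j: "run ?f ?w = store_upd ''i'' 0 0 (n + 1) (store_upd ''f'' 0 0 j ?w)"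
      "(\<exists>i<n + 1. Q k i \<and> j = 1) \<or> (\<forall>i<n + 1. \<not> Q k i) \<and> j = ?w ''f'' 0 0"
    proof (rule run_find[where e = ?N and x = "''i''" and g = "''f''" and t = t
        and f = "Const 1" and Q = "Q k" and F = "\<lambda>k. 1" and s = ?w and N = "n + 1"])
      show "eval_expr ?N ?w = n + 1" using ne by (simp add: fr envD[OF e])
      show "eval_test t (store_upd ''i'' 0 0 i (store_upd ''f'' 0 0 j ?w)) \<longleftrightarrow> Q k i"
        if "i < n + 1" for i j
        by (rule t) (use that k ne in \<open>simp_all add: wk fr\<close>)
    qed simp_all
    have j': "j = of_bool (\<exists>i\<le>n. Q k i)"
      using j(2) by (elim disjE exE conjE) (auto simp: less_Suc_eq_le)
    have "run ?b w = store_upd x (run ?f ?w ''k'' 0 0) 0 (run ?f ?w ''f'' 0 0) (run ?f ?w)"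
      by (simp del: run.simps(5))
    also have "\<dots> = store_upd x k 0 j (run ?f ?w)" unfolding j(1) by (simp add: wk)
    finally have rb: "run ?b w = store_upd x k 0 j (run ?f ?w)" .
    have "run ?f ?w x = w x" unfolding j(1) using ne by simp
    then show "?I (Suc k) (run ?b w)" unfolding rb using I j' by (simp add: less_Suc_eq)
  next
    show "?I k (store_upd ''k'' 0 0 j w)" if "?I k w" for k j w using that ne by simp
  qed simp
  then show ?thesis using k by blast
qed

lemma record_sets:
  assumes e: "env s"
  defines "u \<equiv> run record_sets s"
  shows "i \<in> agents n \<Longrightarrow> u ''S'' i 0 = of_bool (0 < lev s i)"
    "k < length xs \<Longrightarrow> u ''R'' k 0 = of_bool (owner s k = 0 \<and> (\<exists>i. likes i k))"
proof -
  let ?N = "Add (Var ''n'') (Const 1)"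
  let ?a = "CSet ''S'' (Var ''i'') (Sub (Const 1) (Sub (Const 1) (Entry ''lev'' (Var ''i''))))"
  define s1 where "s1 = run (CFor ''i'' ?N ?a) s"
  have fr1: "s1 y = s y" if "y \<notin> {''i'', ''S''}" for y
    unfolding s1_def using that by (intro run_frame) auto
  have S1: "\<forall>i<n + 1. s1 ''S'' i 0 = of_bool (0 < lev s i)"
    unfolding s1_def
  proof (rule run_For[where I = "\<lambda>k u. \<forall>i<k. u ''S'' i 0 = of_bool (0 < lev s i)"])
    fix k w assume "\<forall>i<k. w ''S'' i 0 = of_bool (0 < lev s i)" "w ''i'' 0 0 = k"
      and fr: "\<And>y. y \<noteq> ''i'' \<Longrightarrow> y \<notin> writes ?a \<Longrightarrow> w y = s y"
    moreover have "w ''lev'' k 0 = lev s k" by (simp add: fr lev_def)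
    ultimately show "\<forall>i<Suc k. run ?a w ''S'' i 0 = of_bool (0 < lev s i)"
      by (auto simp: less_Suc_eq)
  qed (simp_all add: envD[OF e])
  let ?t = "Conj (Eq (Entry ''owner'' (Var ''k'')) (Const 0)) (Eq (Cell ''val'' (Var ''i'') (Var ''k'')) (Const 1))"
  have u: "u = run (flag_table ''R'' ?t) s1"
    unfolding u_def record_sets_def s1_def run.simps(3) ..
  have "u ''S'' = s1 ''S''" unfolding u by (intro run_frame) simp
  then show "i \<in> agents n \<Longrightarrow> u ''S'' i 0 = of_bool (0 < lev s i)" using S1 by simp
  have e1: "env s1" by (rule env_cong[OF e]) (simp_all add: fr1)
  show "u ''R'' k 0 = of_bool (owner s k = 0 \<and> (\<exists>i. likes i k))" if k: "k < length xs"
  proof -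
    have "u ''R'' k 0 = of_bool (\<exists>i\<le>n. owner s k = 0 \<and> likes i k)"
      unfolding u
    proof (rule flag_table[OF e1 _ _ k])
      fix k i w assume w: "w ''k'' 0 0 = k" "w ''i'' 0 0 = i"
        and fr: "\<And>y. y \<notin> {''k'', ''i'', ''f'', ''R''} \<Longrightarrow> w y = s1 y"
      have "w ''owner'' k 0 = owner s k" by (simp add: fr fr1 owner_def)
      moreover have "w ''val'' i k = of_bool (likes i k)"
        using envD(3)[OF e, of i k] by (simp add: fr fr1)
      ultimately show "eval_test ?t w \<longleftrightarrow> owner s k = 0 \<and> likes i k" using w by auto
    qed simp
    also have "(\<exists>i\<le>n. owner s k = 0 \<and> likes i k) \<longleftrightarrow> owner s k = 0 \<and> (\<exists>i. likes i k)" by auto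
    finally show ?thesis .
  qed
qed

lemma encodes_family:
  assumes "\<And>k. k < length xs \<Longrightarrow> owner s k \<le> n"
  shows "encodes_bundles n xs (family (owner s)) s"
  using assms unfolding encodes_bundles_def by (auto simp: nth_in_family owner_def)

lemma level_phase:
  assumes e: "env s" and o0: "\<And>k. owner s k = 0"
  defines "u \<equiv> run level_phase s" and "P \<equiv> family (owner (run level_phase s))"
  shows "env u" "max_level_family n M v P"
    "encodes n M v xs (Swapping (reachable_agents n M v P) P (unassigned n M v P)) u"
proof -
  define s1 where "s1 = run level_loop s"
  define s2 where "s2 = run label_agents s1"
  define s3 where "s3 = run record_sets s2"
  have u: "u = store_upd ''phase'' 0 0 1 s3"
    by (simp add: u_def level_phase_def s1_def s2_def s3_def)
  have fr2: "s2 y = s1 y" if "y \<notin> writes label_agents" for y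
    using that unfolding s2_def by (rule run_frame)
  have fr3: "s3 y = s2 y" if "y \<notin> writes record_sets" for y
    using that unfolding s3_def by (rule run_frame)
  have l1: "level_state s1" "final_level s1" using level_loop[OF e o0] unfolding s1_def by blast+
  then have e1: "env s1" and o1: "owners (owner s1)" unfolding level_state_def by blast+
  have e2: "env s2" by (rule env_cong[OF e1]) (simp_all add: fr2)
  have e3: "env s3" by (rule env_cong[OF e2]) (simp_all add: fr3)
  show "env u" unfolding u by (rule env_cong[OF e3]) simp_all
  have ow: "owner s2 = owner s1" "owner u = owner s1"
    unfolding u by (simp_all add: owner_def[abs_def] fr2 fr3)
  have P: "P = family (owner s1)" unfolding P_def u_def[symmetric] ow ..
  have B: "u ''B'' 0 0 = cap_cell s1" unfolding u by (simp add: cap_cell_def fr2 fr3)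
  \<comment> \<open>The certificate also identifies the cell \<open>B\<close> with
    \<open>capa\<close>, which is never computed from its definition.\<close>
  have cert: "max_level_family n M v P \<and> capa = cap_cell s1"
  proof (rule max_level_certificate)
    show "P \<in> valued" unfolding P by (rule family_valued[OF o1])
  qed (use l1 in \<open>auto simp: P card_family level_state_def final_level_def\<close>)
  then show "max_level_family n M v P" by blast
  have lab: "labelling (owner s1) (lev s2)" "complete (owner s1) (lev s2)"
    using label_agents[OF e1 o1] unfolding s2_def by blast+
  have S: "u ''S'' i 0 = of_bool (i \<in> reachable_agents n M v P)" if "i \<in> agents n" for i
    using record_sets(1)[OF e2 that] labelled_iff_reachable[OF lab o1 that]
    unfolding u P by (simp add: s3_def)
  have R: "u ''R'' k 0 = of_bool (xs ! k \<in> unassigned n M v P)" if "k < length xs" for k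
    using record_sets(2)[OF e2 that] nth_unassigned[OF o1 that]
    unfolding u P by (simp add: s3_def ow)
  have "encodes_bundles n xs P u"
    using encodes_family[of u] o1 unfolding P ow owners_def by blast
  then show "encodes n M v xs (Swapping (reachable_agents n M v P) P (unassigned n M v P)) u"
    using cert S R B unfolding encodes.simps encodes_sets_def by (simp add: u)
qed

end

section \<open>The swap and scattering phases\<close>

text \<open>The result is the position of the item plus 1; 0 means that there is none.\<close>

definition find_item :: "string \<Rightarrow> test \<Rightarrow> cmd" where
  "find_item x t = CSet x (Const 0) (Const 0) ;;
     CFor ''k'' (Var ''m'') (CIf t (CSet x (Const 0) (Add (Var ''k'') (Const 1))) CSkip)"

text \<open>\<open>D\<close> marks the items whose \<open>tau\<close> is not all of
  \<open>S\<close>. The cell \<open>h\<close> holds the position of the item called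
  \<open>g'\<close> in the algorithm, not an agent; its owner is copied to the incoming item before
  it is cleared.\<close>

definition swap_phase :: cmd where
  "swap_phase =
     flag_table ''D'' (Conj (Pos (Var ''i'')) (Conj (Eq (Entry ''S'' (Var ''i'')) (Const 1))
       (Eq (Cell ''val'' (Var ''i'') (Var ''k'')) (Const 0)))) ;;
     find_item ''g'' (Conj (Eq (Entry ''R'' (Var ''k'')) (Const 1)) (Eq (Entry ''D'' (Var ''k'')) (Const 0))) ;;
     find_item ''h'' (Conj (Pos (Entry ''owner'' (Var ''k'')))
       (Conj (Eq (Entry ''S'' (Entry ''owner'' (Var ''k''))) (Const 1)) (Eq (Entry ''D'' (Var ''k'')) (Const 1)))) ;;
     CIf (Conj (Pos (Var ''g'')) (Pos (Var ''h'')))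
       (CSet ''owner'' (Sub (Var ''g'') (Const 1)) (Entry ''owner'' (Sub (Var ''h'') (Const 1))) ;;
        CSet ''owner'' (Sub (Var ''h'') (Const 1)) (Const 0) ;;
        CSet ''R'' (Sub (Var ''g'') (Const 1)) (Const 0) ;;
        CSet ''R'' (Sub (Var ''h'') (Const 1)) (Const 1))
       (CSet ''phase'' (Const 0) (Const 2))"

text \<open>Executed only when \<open>R\<close> is empty, so the items without owner are precisely
  the junk.\<close>

definition give_junk :: cmd where
  "give_junk = CFor ''k'' (Var ''m'')
     (CIf (Eq (Entry ''owner'' (Var ''k'')) (Const 0)) (CSet ''owner'' (Var ''k'') (Const 1)) CSkip)"

definition pick_phase :: cmd where
  "pick_phase =
     find_item ''g'' (Eq (Entry ''R'' (Var ''k'')) (Const 1)) ;;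
     CIf (Pos (Var ''g''))
       (CSet ''item'' (Const 0) (Sub (Var ''g'') (Const 1)) ;;
        CSet ''R'' (Sub (Var ''g'') (Const 1)) (Const 0) ;;
        CSet ''phase'' (Const 0) (Const 3))
       (give_junk ;; CSet ''phase'' (Const 0) (Const 4))"

definition count_worth :: cmd where
  "count_worth = CSet ''cnt'' (Const 0) (Const 0) ;;
     CFor ''k'' (Var ''m'')
       (CIf (Conj (Eq (Entry ''owner'' (Var ''k'')) (Var ''j'')) (Eq (Cell ''val'' (Var ''i'') (Var ''k'')) (Const 1)))
         (CSet ''cnt'' (Const 0) (Add (Var ''cnt'') (Const 1))) CSkip)"

text \<open>The agents tested value the item, so their worth after insertion is at most
  \<open>B\<close> exactly if the count before it is below \<open>B\<close>.\<close>

definition check_agent :: cmd where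
  "check_agent = count_worth ;;
     CIf (Conj (Eq (Entry ''S'' (Var ''i'')) (Const 1)) (Conj (Eq (Cell ''val'' (Var ''i'') (Var ''item'')) (Const 1))
            (Neg (Lt (Var ''cnt'') (Var ''B'')))))
       (CSet ''bad'' (Const 0) (Const 1)) CSkip"

definition check_receiver :: cmd where
  "check_receiver = CSet ''bad'' (Const 0) (Const 0) ;;
     CIf (Conj (Eq (Entry ''S'' (Var ''j'')) (Const 1)) (Eq (Cell ''val'' (Var ''j'') (Var ''item'')) (Const 1)))
       (CSet ''bad'' (Const 0) (Const 1)) CSkip ;;
     CFor ''i'' (Add (Var ''n'') (Const 1)) check_agent"

definition find_receiver :: cmd where
  "find_receiver = CSet ''dest'' (Const 0) (Const 0) ;;
     CFor ''j'' (Add (Var ''n'') (Const 1))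
       (check_receiver ;;
        CIf (Conj (Pos (Var ''j'')) (Eq (Var ''bad'') (Const 0))) (CSet ''dest'' (Const 0) (Var ''j'')) CSkip)"

definition place_phase :: cmd where
  "place_phase = find_receiver ;;
     CSet ''owner'' (Var ''item'') (Var ''dest'') ;; CSet ''phase'' (Const 0) (Const 2)"

definition body :: cmd where
  "body = CIf (Lt (Var ''phase'') (Const 1)) level_phase
     (CIf (Lt (Var ''phase'') (Const 2)) swap_phase
       (CIf (Lt (Var ''phase'') (Const 3)) pick_phase place_phase))"

lemma writes_phases [simp]:
  "writes (find_item x t) = {''k'', x}" "writes give_junk = {''k'', ''owner''}"
  "writes count_worth = {''cnt'', ''k''}" "writes check_agent = {''cnt'', ''k'', ''bad''}"
  "writes check_receiver = {''cnt'', ''k'', ''bad'', ''i''}"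
  "writes find_receiver = {''cnt'', ''k'', ''bad'', ''i'', ''j'', ''dest''}"
  by (auto simp: find_item_def give_junk_def count_worth_def check_agent_def check_receiver_def find_receiver_def)

text \<open>Through \<open>exec_compile\<close> this bounds one round of the main loop by a
  polynomial.\<close>

lemma wf_body: "wf_cmd body"
  by (simp add: body_def level_phase_def level_loop_def level_step_def label_agents_def init_labels_def
      relax_agents_def relax_items_def relax_label_def count_items_def find_deficient_def find_low_def
      walk_def walk_step_def record_sets_def flag_table_def swap_phase_def find_item_def pick_phase_def
      give_junk_def place_phase_def find_receiver_def check_receiver_def check_agent_def count_worth_def)

context enumerated_instance
begin

lemma find_item:
  assumes e: "env s" and x: "x \<notin> {''k'', ''n'', ''m''}"
    and t: "\<And>k w. \<lbrakk>k < length xs; w ''k'' 0 0 = k; \<And>y. y \<notin> {''k'', x} \<Longrightarrow> w y = s y\<rbrakk> \<Longrightarrow> eval_test t w \<longleftrightarrow> Q k"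
  shows "(\<exists>k<length xs. Q k \<and> run (find_item x t) s x 0 0 = Suc k) \<or>
    (\<forall>k<length xs. \<not> Q k) \<and> run (find_item x t) s x 0 0 = 0"
proof -
  let ?s = "store_upd x 0 0 0 s"
  let ?c = "CFor ''k'' (Var ''m'') (CIf t (CSet x (Const 0) (Add (Var ''k'') (Const 1))) CSkip)"
  have ne: "x \<noteq> ''k''" "x \<noteq> ''n''" "x \<noteq> ''m''" using x by simp_all
  obtain j where j: "run ?c ?s = store_upd ''k'' 0 0 (length xs) (store_upd x 0 0 j ?s)"
    "(\<exists>k<length xs. Q k \<and> j = Suc k) \<or> (\<forall>k<length xs. \<not> Q k) \<and> j = ?s x 0 0"
  proof (rule run_find[where e = "Var ''m''" and x = "''k''" and g = x and t = t
      and f = "Add (Var ''k'') (Const 1)" and Q = Q and F = Suc and s = ?s and N = "length xs"])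
    show "eval_expr (Var ''m'') ?s = length xs" using ne by (simp add: envD[OF e])
    show "eval_test t (store_upd ''k'' 0 0 k (store_upd x 0 0 j ?s)) \<longleftrightarrow> Q k" if "k < length xs" for k j
      by (rule t[OF that]) (use ne in simp_all)
    show "''k'' \<noteq> x" using ne by simp
  qed (use ne in simp_all)
  have "run (find_item x t) s = run ?c ?s" by (simp add: find_item_def del: run.simps(5))
  then have "run (find_item x t) s x 0 0 = j" unfolding j(1) using ne by simp
  then show ?thesis using j(2) by simp
qed

text \<open>\<open>encodes\<close> drops the input after the first configuration, yet every later
  phase reads the sizes and the valuation table; \<open>env\<close> keeps them.\<close>

definition encodes_env :: "'a config \<Rightarrow> store \<Rightarrow> bool" where
  "encodes_env c s \<longleftrightarrow> encodes n M v xs c s \<and> env s"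

lemma swap_inv_facts:
  assumes "swap_inv S P R"
  shows "P \<in> valued" "S \<subseteq> agents n" "R \<subseteq> M" "i \<in> agents n \<Longrightarrow> g \<in> R \<Longrightarrow> g \<notin> P i"
    "i \<in> agents n \<Longrightarrow> P i \<subseteq> M"
  using assms valuedD(2)[of P] unfolding swap_inv_def unassigned_def by blast+

lemma encodes_bundlesD:
  assumes "encodes_bundles n xs P s" "k < length xs"
  shows "owner s k \<le> n" "i \<in> agents n \<Longrightarrow> owner s k = i \<longleftrightarrow> xs ! k \<in> P i"
  using assms unfolding encodes_bundles_def owner_def by blast+

lemma encodes_setsD:
  assumes "encodes_sets n xs S R s"
  shows "i \<in> agents n \<Longrightarrow> s ''S'' i 0 = of_bool (i \<in> S)"
    "k < length xs \<Longrightarrow> s ''R'' k 0 = of_bool (xs ! k \<in> R)"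
  using assms unfolding encodes_sets_def by blast+

lemma swap_phase:
  assumes enc: "encodes_env (Swapping S P R) s" and inv: "swap_inv S P R"
  shows "\<exists>c'. ls_step n M v (Swapping S P R) c' \<and> encodes_env c' (run swap_phase s)"
proof -
  have e: "env s" and ph: "s ''phase'' 0 0 = 1" "s ''B'' 0 0 = capa"
    and eb: "encodes_bundles n xs P s" and es: "encodes_sets n xs S R s"
    using enc unfolding encodes_env_def by auto
  note I = swap_inv_facts[OF inv]
  let ?tD = "Conj (Pos (Var ''i'')) (Conj (Eq (Entry ''S'' (Var ''i'')) (Const 1))
       (Eq (Cell ''val'' (Var ''i'') (Var ''k'')) (Const 0)))"
  let ?tg = "Conj (Eq (Entry ''R'' (Var ''k'')) (Const 1)) (Eq (Entry ''D'' (Var ''k'')) (Const 0))"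
  let ?th = "Conj (Pos (Entry ''owner'' (Var ''k'')))
       (Conj (Eq (Entry ''S'' (Entry ''owner'' (Var ''k''))) (Const 1)) (Eq (Entry ''D'' (Var ''k'')) (Const 1)))"
  define s1 where "s1 = run (flag_table ''D'' ?tD) s"
  define s2 where "s2 = run (find_item ''g'' ?tg) s1"
  define s3 where "s3 = run (find_item ''h'' ?th) s2"
  define u where "u = run swap_phase s"
  have fr1: "s1 y = s y" if "y \<notin> {''k'', ''f'', ''i'', ''D''}" for y
    using that unfolding s1_def by (intro run_frame) simp
  have fr2: "s2 y = s1 y" if "y \<notin> {''k'', ''g''}" for y
    using that unfolding s2_def by (intro run_frame) simp
  have fr3: "s3 y = s2 y" if "y \<notin> {''k'', ''h''}" for y
    using that unfolding s3_def by (intro run_frame) simp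
  have e1: "env s1" by (rule env_cong[OF e]) (simp_all add: fr1)
  have e2: "env s2" by (rule env_cong[OF e1]) (simp_all add: fr2)
  have e3: "env s3" by (rule env_cong[OF e2]) (simp_all add: fr3)
  have D: "s1 ''D'' k 0 = of_bool (tau v S (xs ! k) \<noteq> S)" if k: "k < length xs" for k
  proof -
    have "s1 ''D'' k 0 = of_bool (\<exists>i\<le>n. i \<in> S \<and> v i {xs ! k} \<noteq> 1)"
      unfolding s1_def
    proof (rule flag_table[OF e _ _ k])
      fix k i w assume w: "w ''k'' 0 0 = k" "w ''i'' 0 0 = i" "k < length xs" "i \<le> n"
        and fr: "\<And>y. y \<notin> {''k'', ''i'', ''f'', ''D''} \<Longrightarrow> w y = s y"
      show "eval_test ?tD w \<longleftrightarrow> i \<in> S \<and> v i {xs ! k} \<noteq> 1"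
      \<comment> \<open>The loop visits index 0, which the test rejects and \<open>S\<close> does
        not contain.\<close>
      proof (cases "i = 0")
        case True
        then show ?thesis using I(2) w by auto
      next
        case False
        then have "i \<in> agents n" using w by simp
        then have "w ''S'' i 0 = of_bool (i \<in> S)" "w ''val'' i k = of_bool (v i {xs ! k} = 1)"
          using encodes_setsD(1)[OF es] envD(3)[OF e, of i k] w by (simp_all add: fr)
        then show ?thesis using False w by auto
      qed
    qed simp
    also have "(\<exists>i\<le>n. i \<in> S \<and> v i {xs ! k} \<noteq> 1) \<longleftrightarrow> tau v S (xs ! k) \<noteq> S"
      using I(2) unfolding tau_def by fastforce
    finally show ?thesis .
  qed
  let ?Qg = "\<lambda>k. xs ! k \<in> R \<and> tau v S (xs ! k) = S"
  have g: "(\<exists>k<length xs. ?Qg k \<and> s2 ''g'' 0 0 = Suc k) \<or> (\<forall>k<length xs. \<not> ?Qg k) \<and> s2 ''g'' 0 0 = 0"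
    unfolding s2_def
  proof (rule find_item[OF e1])
    fix k w assume k: "k < length xs" "w ''k'' 0 0 = k" and fr: "\<And>y. y \<notin> {''k'', ''g''} \<Longrightarrow> w y = s1 y"
    show "eval_test ?tg w \<longleftrightarrow> ?Qg k"
      using D[OF k(1)] encodes_setsD(2)[OF es k(1)] by (auto simp: k(2) fr fr1)
  qed simp
  let ?Qh = "\<lambda>k. owner s k \<in> S \<and> tau v S (xs ! k) \<noteq> S"
  have h: "(\<exists>k<length xs. ?Qh k \<and> s3 ''h'' 0 0 = Suc k) \<or> (\<forall>k<length xs. \<not> ?Qh k) \<and> s3 ''h'' 0 0 = 0"
    unfolding s3_def
  proof (rule find_item[OF e2])
    fix k w assume k: "k < length xs" "w ''k'' 0 0 = k" and fr: "\<And>y. y \<notin> {''k'', ''h''} \<Longrightarrow> w y = s2 y"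
    have wo: "w ''owner'' k 0 = owner s k" by (simp add: fr fr2 fr1 owner_def)
    have wD: "w ''D'' k 0 = of_bool (tau v S (xs ! k) \<noteq> S)" using D[OF k(1)] by (simp add: fr fr2)
    show "eval_test ?th w \<longleftrightarrow> ?Qh k"
    proof (cases "owner s k = 0")
      case True
      then show ?thesis using I(2) by (auto simp: k(2) wo)
    next
      case False
      then have "owner s k \<in> agents n" using encodes_bundlesD(1)[OF eb k(1)] by simp
      then have "w ''S'' (owner s k) 0 = of_bool (owner s k \<in> S)"
        using encodes_setsD(1)[OF es] by (simp add: fr fr2 fr1)
      then show ?thesis using False by (auto simp: k(2) wo wD)
    qed
  qed simp
  have g3: "s3 ''g'' = s2 ''g''" by (simp add: fr3)
  let ?w = "CSet ''owner'' (Sub (Var ''g'') (Const 1)) (Entry ''owner'' (Sub (Var ''h'') (Const 1))) ;;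
        CSet ''owner'' (Sub (Var ''h'') (Const 1)) (Const 0) ;;
        CSet ''R'' (Sub (Var ''g'') (Const 1)) (Const 0) ;;
        CSet ''R'' (Sub (Var ''h'') (Const 1)) (Const 1)"
  have u: "u = (if 0 < s3 ''g'' 0 0 \<and> 0 < s3 ''h'' 0 0 then run ?w s3 else store_upd ''phase'' 0 0 2 s3)"
    by (simp add: u_def swap_phase_def s1_def s2_def s3_def)
  show ?thesis
  proof (cases "0 < s3 ''g'' 0 0 \<and> 0 < s3 ''h'' 0 0")
    case True
    obtain a where a: "a < length xs" "xs ! a \<in> R" "tau v S (xs ! a) = S" "s3 ''g'' 0 0 = Suc a"
      using g True g3 by auto
    obtain b where b: "b < length xs" "owner s b \<in> S" "tau v S (xs ! b) \<noteq> S" "s3 ''h'' 0 0 = Suc b"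
      using h True by auto
    define i where "i = owner s b"
    have i: "i \<in> agents n" "i \<in> S" using b(2) I(2) unfolding i_def by blast+
    have bP: "xs ! b \<in> P i" using encodes_bundlesD(2)[OF eb b(1) i(1)] by (simp add: i_def)
    have sw: "swappable v S P R (xs ! a) i (xs ! b)"
      unfolding swappable_def using a b i bP by blast
    let ?P = "P(i := (P i - {xs ! b}) \<union> {xs ! a})" and ?R = "(R - {xs ! a}) \<union> {xs ! b}"
    have step: "ls_step n M v (Swapping S P R) (Swapping S ?P ?R)" by (rule ls_step.swap[OF sw])
    have ab: "a \<noteq> b" using a(3) b(3) by auto
    have u': "u = run ?w s3" unfolding u using True by simp
    have s3: "s3 ''owner'' = s ''owner''" "s3 ''R'' = s ''R''" by (simp_all add: fr3 fr2 fr1)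
    have ou: "owner u k = (if k = b then 0 else if k = a then i else owner s k)" for k
      unfolding u' using ab by (simp add: a(4) b(4) owner_def i_def s3)
    have Ru: "u ''R'' k 0 = (if k = b then 1 else if k = a then 0 else s ''R'' k 0)" for k
      unfolding u' using ab by (simp add: a(4) b(4) s3)
    have fu: "u y = s3 y" if "y \<notin> {''owner'', ''R''}" for y
      unfolding u' using that by (intro run_frame) simp
    have eq: "xs ! k = xs ! l \<longleftrightarrow> k = l" if "k < length xs" "l < length xs" for k l
      using distinct_xs that by (simp add: nth_eq_iff_index_eq)
    have "encodes_bundles n xs ?P u"
      unfolding encodes_bundles_def owner_def[symmetric] ou
    proof (intro allI impI conjI ballI)
      fix k assume k: "k < length xs"
      show "(if k = b then 0 else if k = a then i else owner s k) \<le> n"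
        using encodes_bundlesD(1)[OF eb k] i(1) by simp
      fix j assume j: "j \<in> agents n"
      note E = encodes_bundlesD(2)[OF eb k j]
      consider "k = b" | "k = a" "k \<noteq> b" | "k \<noteq> a" "k \<noteq> b" by blast
      then show "((if k = b then 0 else if k = a then i else owner s k) = j) = (xs ! k \<in> ?P j)"
      proof cases
        case 1
        have "xs ! b \<noteq> xs ! a" using eq[OF b(1) a(1)] ab by simp
        moreover have "xs ! b \<notin> P j" if "j \<noteq> i" using E 1 that i_def by simp
        ultimately show ?thesis using 1 j by auto
      next
        case 2
        have "xs ! a \<notin> P j" using I(4)[OF j a(2)] .
        then show ?thesis using 2 by auto
      next
        case 3
        then have "xs ! k \<noteq> xs ! a" "xs ! k \<noteq> xs ! b" using eq[OF k a(1)] eq[OF k b(1)] by simp_all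
        then show ?thesis using 3 E by auto
      qed
    qed
    moreover have "encodes_sets n xs S ?R u"
      unfolding encodes_sets_def Ru
    proof (intro conjI ballI allI impI)
      show "u ''S'' j 0 = of_bool (j \<in> S)" if "j \<in> agents n" for j
        using encodes_setsD(1)[OF es that] by (simp add: fu fr3 fr2 fr1)
      fix k assume k: "k < length xs"
      show "(if k = b then 1 else if k = a then 0 else s ''R'' k 0) = of_bool (xs ! k \<in> ?R)"
        using encodes_setsD(2)[OF es k] eq[OF k a(1)] eq[OF k b(1)] by auto
    qed
    moreover have "env u" by (rule env_cong[OF e3]) (simp_all add: fu)
    moreover have "u ''phase'' 0 0 = 1" "u ''B'' 0 0 = capa" using ph by (simp_all add: fu fr3 fr2 fr1)
    ultimately have "encodes_env (Swapping S ?P ?R) u" unfolding encodes_env_def by simp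
    then show ?thesis using step unfolding u_def by blast
  next
    case False
    \<comment> \<open>The two searches are independent because the swap condition splits into one on
      the unassigned good and one on the held good; a swappable triple would give both of them a
      hit.\<close>
    have "\<not> swappable v S P R x i y" for x i y
    proof
      assume "swappable v S P R x i y"
      then have x: "x \<in> R" "tau v S x = S" and i: "i \<in> S" and y: "y \<in> P i" "tau v S y \<noteq> S"
        unfolding swappable_def by blast+
      have "i \<in> agents n" using i I(2) by blast
      obtain a where a: "a < length xs" "x = xs ! a" using item_index[of x] x(1) I(3) by blast
      obtain b where b: "b < length xs" "y = xs ! b" using item_index[of y] y(1) I(5)[OF \<open>i \<in> agents n\<close>] by blast
      have "owner s b = i" using encodes_bundlesD(2)[OF eb b(1) \<open>i \<in> agents n\<close>] y(1) b(2) by simp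
      then have "?Qg a" "?Qh b" using x i y a b by simp_all
      then obtain k l where "s2 ''g'' 0 0 = Suc k" "s3 ''h'' 0 0 = Suc l"
        using g h a(1) b(1) by blast
      then show False using False g3 by simp
    qed
    then have step: "ls_step n M v (Swapping S P R) (Scattering S P R)" by (intro ls_step.swap_exit) blast
    have u': "u = store_upd ''phase'' 0 0 2 s3" unfolding u if_not_P[OF False] ..
    have fu: "u y = s y" if "y \<in> {''B'', ''owner'', ''S'', ''R''}" for y
      using that unfolding u' by (auto simp: fr3 fr2 fr1)
    have "env u" unfolding u' by (rule env_cong[OF e3]) simp_all
    moreover have "encodes_bundles n xs P u" using eb unfolding encodes_bundles_def by (simp add: fu)
    moreover have "encodes_sets n xs S R u" using es unfolding encodes_sets_def by (simp add: fu)
    moreover have "u ''phase'' 0 0 = 2" "u ''B'' 0 0 = capa" using ph(2) by (simp add: u', simp add: fu)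
    ultimately have "encodes_env (Scattering S P R) u" unfolding encodes_env_def by simp
    then show ?thesis using step unfolding u_def by blast
  qed
qed

section \<open>Simulating the scattering phase\<close>

lemma scatter_inv_facts:
  assumes "scatter_inv S A R"
  shows "S \<subseteq> agents n" "R \<subseteq> M" "(\<Union>i\<in>agents n. A i) = goods - R"
proof -
  obtain P R0 where w: "scatter_witness S A R P R0" using assms unfolding scatter_inv_def by blast
  then have "swap_inv S P R0" "R \<subseteq> R0" "(\<Union>i\<in>agents n. A i) = goods - R"
    unfolding scatter_witness_def by blast+
  note f = this
  show "S \<subseteq> agents n" by (rule swap_inv_facts(2)[OF f(1)])
  show "R \<subseteq> M" using f(2) swap_inv_facts(3)[OF f(1)] by (rule subset_trans)
  show "(\<Union>i\<in>agents n. A i) = goods - R" by (rule f(3))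
qed

lemma give_junk:
  assumes e: "env s" and k: "k < length xs"
  shows "owner (run give_junk s) k = (if owner s k = 0 then 1 else owner s k)"
proof -
  let ?c = "CIf (Eq (Entry ''owner'' (Var ''k'')) (Const 0)) (CSet ''owner'' (Var ''k'') (Const 1)) CSkip"
  let ?I = "\<lambda>k w. \<forall>j. owner w j = (if j < k \<and> owner s j = 0 then 1 else owner s j)"
  have "?I (length xs) (run give_junk s)"
    unfolding give_junk_def
  proof (rule run_For[where I = ?I])
    fix k w assume I: "?I k w" and wk: "w ''k'' 0 0 = k"
    have "owner (run ?c w) j = (if j = k \<and> owner w k = 0 then 1 else owner w j)" for j
      by (simp add: wk owner_def)
    then show "?I (Suc k) (run ?c w)" using I by (auto simp: less_Suc_eq)
  next
    show "?I k (store_upd ''k'' 0 0 j w)" if "?I k w" for k j w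
      using that by (simp add: owner_def)
  qed (simp_all add: envD[OF e])
  then show ?thesis using k by simp
qed

lemma pick_phase:
  assumes enc: "encodes_env (Scattering S A R) s" and inv: "scatter_inv S A R"
  shows "\<exists>c'. ls_step n M v (Scattering S A R) c' \<and> encodes_env c' (run pick_phase s)"
proof -
  have e: "env s" and ph: "s ''phase'' 0 0 = 2" "s ''B'' 0 0 = capa"
    and eb: "encodes_bundles n xs A s" and es: "encodes_sets n xs S R s"
    using enc unfolding encodes_env_def by auto
  note I = scatter_inv_facts[OF inv]
  let ?t = "Eq (Entry ''R'' (Var ''k'')) (Const 1)"
  define s1 where "s1 = run (find_item ''g'' ?t) s"
  define u where "u = run pick_phase s"
  have fr1: "s1 y = s y" if "y \<notin> {''k'', ''g''}" for y
    using that unfolding s1_def by (intro run_frame) simp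
  have e1: "env s1" by (rule env_cong[OF e]) (simp_all add: fr1)
  have g: "(\<exists>k<length xs. xs ! k \<in> R \<and> s1 ''g'' 0 0 = Suc k) \<or> (\<forall>k<length xs. xs ! k \<notin> R) \<and> s1 ''g'' 0 0 = 0"
    unfolding s1_def
  proof (rule find_item[OF e])
    fix k w assume k: "k < length xs" "w ''k'' 0 0 = k" and fr: "\<And>y. y \<notin> {''k'', ''g''} \<Longrightarrow> w y = s y"
    show "eval_test ?t w \<longleftrightarrow> xs ! k \<in> R"
      using encodes_setsD(2)[OF es k(1)] by (auto simp: k(2) fr)
  qed simp
  let ?w = "CSet ''item'' (Const 0) (Sub (Var ''g'') (Const 1)) ;;
        CSet ''R'' (Sub (Var ''g'') (Const 1)) (Const 0) ;;
        CSet ''phase'' (Const 0) (Const 3)"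
  have u: "u = (if 0 < s1 ''g'' 0 0 then run ?w s1 else store_upd ''phase'' 0 0 4 (run give_junk s1))"
    by (simp add: u_def pick_phase_def s1_def)
  show ?thesis
  proof (cases "0 < s1 ''g'' 0 0")
    case True
    then obtain a where a: "a < length xs" "xs ! a \<in> R" "s1 ''g'' 0 0 = Suc a" using g by auto
    have step: "ls_step n M v (Scattering S A R) (Placing S A (R - {xs ! a}) (xs ! a))"
      by (rule ls_step.pick[OF a(2)])
    have u': "u = run ?w s1" unfolding u using True by simp
    have fu: "u y = s y" if "y \<notin> {''k'', ''g'', ''item'', ''R'', ''phase''}" for y
      unfolding u' using that fr1 by simp
    have Ru: "u ''R'' k 0 = (if k = a then 0 else s ''R'' k 0)" for k
      unfolding u' by (simp add: a(3) fr1)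
    have "encodes_sets n xs S (R - {xs ! a}) u"
      unfolding encodes_sets_def Ru
    proof (intro conjI ballI allI impI)
      show "u ''S'' j 0 = of_bool (j \<in> S)" if "j \<in> agents n" for j
        using encodes_setsD(1)[OF es that] by (simp add: fu)
      fix k assume k: "k < length xs"
      show "(if k = a then 0 else s ''R'' k 0) = of_bool (xs ! k \<in> R - {xs ! a})"
        using encodes_setsD(2)[OF es k] distinct_xs k a(1) by (auto simp: nth_eq_iff_index_eq)
    qed
    moreover have "encodes_bundles n xs A u" using eb unfolding encodes_bundles_def by (simp add: fu)
    moreover have "env u" by (rule env_cong[OF e]) (simp_all add: fu)
    moreover have "u ''phase'' 0 0 = 3" "u ''item'' 0 0 = a" unfolding u' by (simp_all add: a(3))
    moreover have "u ''B'' 0 0 = capa" using ph by (simp add: fu)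
    ultimately have "encodes_env (Placing S A (R - {xs ! a}) (xs ! a)) u"
      unfolding encodes_env_def using a(1) by simp
    then show ?thesis using step unfolding u_def by blast
  next
    case False
    \<comment> \<open>\<open>xs\<close> enumerates all of \<open>M\<close>, so an unsuccessful
      search shows that \<open>R\<close> is empty.\<close>
    then have "R \<inter> M = {}" using g item_index by fastforce
    then have R: "R = {}" using I(2) by blast
    have u': "u = store_upd ''phase'' 0 0 4 (run give_junk s1)" unfolding u using False by simp
    \<comment> \<open>The distribution of the junk that \<open>give_junk\<close> produces.\<close>
    define D where "D i = (if i = 1 then junk n M v else {})" for i :: nat
    have "disjoint_family_on D (agents n)" "(\<Union>i\<in>agents n. D i) = junk n M v"
      using n_pos by (auto simp: D_def disjoint_family_on_def split: if_splits)
    then have step: "ls_step n M v (Scattering S A R) (Done (\<lambda>i. A i \<union> D i))"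
      unfolding R by (rule ls_step.finish)
    have ou: "owner u k = (if owner s k = 0 then 1 else owner s k)" if "k < length xs" for k
      using give_junk[OF e1 that] unfolding u' by (simp add: owner_def fr1)
    have "encodes_bundles n xs (\<lambda>i. A i \<union> D i) u"
      unfolding encodes_bundles_def owner_def[symmetric]
    proof (intro allI impI conjI ballI)
      fix k assume k: "k < length xs"
      show "owner u k \<le> n" using encodes_bundlesD(1)[OF eb k] n_pos by (simp add: ou[OF k])
      fix j assume j: "j \<in> agents n"
      note E = encodes_bundlesD(2)[OF eb k]
      have M: "xs ! k \<in> M" using k set_xs nth_mem by blast
      show "owner u k = j \<longleftrightarrow> xs ! k \<in> A j \<union> D j"
      proof (cases "owner s k = 0")
        case True
        then have "xs ! k \<notin> A i" if "i \<in> agents n" for i using E[OF that] that by simp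
        then have "xs ! k \<notin> goods" using I(3) unfolding R by blast
        then have "xs ! k \<in> junk n M v" using M by blast
        then show ?thesis using True E[OF j] j by (auto simp: ou[OF k] D_def)
      next
        case False
        then have "owner s k \<in> agents n" using encodes_bundlesD(1)[OF eb k] by simp
        then have "xs ! k \<in> (\<Union>i\<in>agents n. A i)" using E by blast
        then have "xs ! k \<notin> junk n M v" using I(3) unfolding R by blast
        then show ?thesis using False E[OF j] by (auto simp: ou[OF k] D_def)
      qed
    qed
    moreover have "env u"
      unfolding u' by (rule env_cong[OF e1]) (simp_all add: run_frame)
    moreover have "u ''phase'' 0 0 = 4" unfolding u' by simp
    ultimately have "encodes_env (Done (\<lambda>i. A i \<union> D i)) u" unfolding encodes_env_def by simp
    then show ?thesis using step unfolding u_def by blast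
  qed
qed

text \<open>\<open>worth i (A j)\<close> as it is visible in the store;
  \<open>worth_pair_count\<close> makes the connection.\<close>

definition pair_count :: "store \<Rightarrow> nat \<Rightarrow> nat \<Rightarrow> nat" where
  "pair_count s i j = card {k. k < length xs \<and> owner s k = j \<and> likes i k}"

lemma count_worth:
  assumes e: "env s"
  shows "run count_worth s ''cnt'' 0 0 = pair_count s (s ''i'' 0 0) (s ''j'' 0 0)"
proof -
  let ?i = "s ''i'' 0 0" and ?j = "s ''j'' 0 0"
  let ?t = "Conj (Eq (Entry ''owner'' (Var ''k'')) (Var ''j'')) (Eq (Cell ''val'' (Var ''i'') (Var ''k'')) (Const 1))"
  let ?c = "CIf ?t
         (CSet ''cnt'' (Const 0) (Add (Var ''cnt'') (Const 1))) CSkip"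
  let ?s = "store_upd ''cnt'' 0 0 0 s"
  let ?X = "\<lambda>k. {l. l < k \<and> owner s l = ?j \<and> likes ?i l}"
  let ?I = "\<lambda>k w. w ''cnt'' 0 0 = card (?X k)"
  have "?I (length xs) (run (CFor ''k'' (Var ''m'') ?c) ?s)"
  proof (rule run_For[where I = ?I])
    fix k w assume I: "?I k w" and wk: "w ''k'' 0 0 = k"
      and fr: "\<And>y. y \<noteq> ''k'' \<Longrightarrow> y \<notin> writes ?c \<Longrightarrow> w y = ?s y"
    have w: "w ''owner'' k 0 = owner s k" "w ''val'' ?i k = of_bool (likes ?i k)"
      "w ''i'' = s ''i''" "w ''j'' = s ''j''"
      using envD(3)[OF e, of ?i k] by (simp_all add: fr owner_def)
    have "?X (Suc k) = (if owner s k = ?j \<and> likes ?i k then insert k (?X k) else ?X k)"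
      by (auto simp: less_Suc_eq)
    then have X: "card (?X (Suc k)) = (if owner s k = ?j \<and> likes ?i k then Suc (card (?X k)) else card (?X k))"
      by simp
    have "eval_test ?t w \<longleftrightarrow> owner s k = ?j \<and> likes ?i k"
      unfolding eval_test.simps eval_expr.simps wk w by (cases "likes ?i k") auto
    then have "run ?c w ''cnt'' 0 0 = (if owner s k = ?j \<and> likes ?i k then Suc (w ''cnt'' 0 0) else w ''cnt'' 0 0)"
      unfolding run.simps(4) by simp
    then show "?I (Suc k) (run ?c w)" unfolding X using I by simp
  next
    show "eval_expr (Var ''m'') ?s = length xs" by (simp add: envD[OF e])
  qed simp_all
  moreover have "run count_worth s = run (CFor ''k'' (Var ''m'') ?c) ?s"
    by (simp add: count_worth_def del: run.simps(5))
  ultimately show ?thesis unfolding pair_count_def by simp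
qed

lemma check_receiver:
  assumes e: "env s" and es: "encodes_sets n xs S R s" and S: "S \<subseteq> agents n"
    and it: "s ''item'' 0 0 < length xs" and j: "s ''j'' 0 0 = j" "j \<in> agents n"
  defines "g \<equiv> xs ! (s ''item'' 0 0)"
  shows "run check_receiver s ''bad'' 0 0 = 0 \<longleftrightarrow>
    j \<notin> tau v S g \<and> (\<forall>i\<in>tau v S g. pair_count s i j < s ''B'' 0 0)"
proof -
  let ?g = "s ''item'' 0 0"
  let ?N = "Add (Var ''n'') (Const 1)"
  \<comment> \<open>Index 0 is included because the loop starts there; its row of \<open>val\<close>
    is zero.\<close>
  have tau: "i \<in> tau v S g \<longleftrightarrow> s ''S'' i 0 = 1 \<and> s ''val'' i ?g = 1" if "i \<le> n" for i
  proof (cases "i = 0")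
    case True
    then show ?thesis using S envD(3)[OF e, of i ?g] unfolding tau_def by auto
  next
    case False
    then have "i \<in> agents n" using that by simp
    then show ?thesis using encodes_setsD(1)[OF es] envD(3)[OF e, of i ?g] it
      unfolding tau_def g_def by simp
  qed
  define s1 where "s1 = run (CSet ''bad'' (Const 0) (Const 0) ;;
     CIf (Conj (Eq (Entry ''S'' (Var ''j'')) (Const 1)) (Eq (Cell ''val'' (Var ''j'') (Var ''item'')) (Const 1)))
       (CSet ''bad'' (Const 0) (Const 1)) CSkip) s"
  have fr1: "s1 y = s y" if "y \<noteq> ''bad''" for y
    unfolding s1_def using that by (intro run_frame) simp
  have bad1: "s1 ''bad'' 0 0 = 0 \<longleftrightarrow> j \<notin> tau v S g"
    using j tau[of j] unfolding s1_def by auto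
  let ?Q = "\<lambda>i. i \<in> tau v S g \<and> \<not> pair_count s i j < s ''B'' 0 0"
  let ?I = "\<lambda>k w. w ''bad'' 0 0 = 0 \<longleftrightarrow> j \<notin> tau v S g \<and> (\<forall>i<k. \<not> ?Q i)"
  have "?I (n + 1) (run (CFor ''i'' ?N check_agent) s1)"
  proof (rule run_For[where I = ?I])
    show "eval_expr ?N s1 = n + 1" by (simp add: fr1 envD[OF e])
    show "?I 0 s1" using bad1 by simp
  next
    fix i w assume i: "i < n + 1" and I: "?I i w" and wi: "w ''i'' 0 0 = i"
      and fr: "\<And>y. y \<noteq> ''i'' \<Longrightarrow> y \<notin> writes check_agent \<Longrightarrow> w y = s1 y"
    have ew: "env w" by (rule env_cong[OF e]) (simp_all add: fr fr1)
    have ow: "owner w = owner s" by (simp add: owner_def[abs_def] fr fr1)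
    define w1 where "w1 = run count_worth w"
    have frw: "w1 y = w y" if "y \<notin> {''cnt'', ''k''}" for y
      unfolding w1_def using that by (intro run_frame) simp
    have cnt: "w1 ''cnt'' 0 0 = pair_count s i j"
      using count_worth[OF ew] j(1) unfolding w1_def by (simp add: wi fr fr1 pair_count_def ow)
    have t: "eval_test (Conj (Eq (Entry ''S'' (Var ''i'')) (Const 1)) (Conj (Eq (Cell ''val'' (Var ''i'') (Var ''item'')) (Const 1))
            (Neg (Lt (Var ''cnt'') (Var ''B''))))) w1 \<longleftrightarrow> ?Q i"
      using i tau[of i] by (auto simp: cnt frw wi fr fr1)
    have "run check_agent w = (if ?Q i then store_upd ''bad'' 0 0 1 w1 else w1)"
      unfolding check_agent_def run.simps(3,4) w1_def[symmetric] t by simp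
    then have "run check_agent w ''bad'' 0 0 = (if ?Q i then 1 else w ''bad'' 0 0)"
      by (simp add: frw)
    then show "?I (Suc i) (run check_agent w)" using I by (auto simp: less_Suc_eq)
  qed simp
  moreover have "run check_receiver s = run (CFor ''i'' ?N check_agent) s1"
    by (simp add: check_receiver_def s1_def del: run.simps(5))
  moreover have "(\<forall>i<n + 1. \<not> ?Q i) \<longleftrightarrow> (\<forall>i\<in>tau v S g. pair_count s i j < s ''B'' 0 0)"
    using S unfolding tau_def by (auto simp: less_Suc_eq_le)
  ultimately show ?thesis by simp
qed

text \<open>Later admissible agents overwrite earlier ones, so the loop invariant says only that
  \<open>dest\<close> is admissible or that no admissible agent has been met.\<close>

lemma find_receiver:
  assumes e: "env s" and es: "encodes_sets n xs S R s" and S: "S \<subseteq> agents n"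
    and it: "s ''item'' 0 0 < length xs"
  defines "g \<equiv> xs ! (s ''item'' 0 0)" and "d \<equiv> run find_receiver s ''dest'' 0 0"
  assumes ex: "\<exists>j\<in>agents n - tau v S g. \<forall>i\<in>tau v S g. pair_count s i j < s ''B'' 0 0"
  shows "d \<in> agents n - tau v S g \<and> (\<forall>i\<in>tau v S g. pair_count s i d < s ''B'' 0 0)"
proof -
  let ?s = "store_upd ''dest'' 0 0 0 s"
  let ?N = "Add (Var ''n'') (Const 1)"
  let ?c = "check_receiver ;;
        CIf (Conj (Pos (Var ''j'')) (Eq (Var ''bad'') (Const 0))) (CSet ''dest'' (Const 0) (Var ''j'')) CSkip"
  let ?ok = "\<lambda>j. j \<in> agents n - tau v S g \<and> (\<forall>i\<in>tau v S g. pair_count s i j < s ''B'' 0 0)"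
  let ?I = "\<lambda>k w. ?ok (w ''dest'' 0 0) \<or> (\<forall>j<k. \<not> ?ok j)"
  have "?I (n + 1) (run (CFor ''j'' ?N ?c) ?s)"
  proof (rule run_For[where I = ?I])
    show "eval_expr ?N ?s = n + 1" by (simp add: envD[OF e])
  next
    fix j w assume j: "j < n + 1" and I: "?I j w" and wj: "w ''j'' 0 0 = j"
      and fr: "\<And>y. y \<noteq> ''j'' \<Longrightarrow> y \<notin> writes ?c \<Longrightarrow> w y = ?s y"
    have fw: "w y = s y" if "y \<in> {''n'', ''m'', ''val'', ''owner'', ''S'', ''R'', ''B'', ''item''}" for y
      using that by (auto simp: fr)
    have ew: "env w" by (rule env_cong[OF e]) (simp_all add: fw)
    have sw: "encodes_sets n xs S R w" using es unfolding encodes_sets_def by (simp add: fw)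
    have pc: "pair_count w = pair_count s"
      by (simp add: pair_count_def[abs_def] owner_def fw)
    define w1 where "w1 = run check_receiver w"
    have frw: "w1 ''j'' = w ''j''" "w1 ''dest'' = w ''dest''"
      unfolding w1_def by (intro run_frame, simp)+
    have r: "run ?c w = (if 0 < j \<and> w1 ''bad'' 0 0 = 0 then store_upd ''dest'' 0 0 j w1 else w1)"
      by (simp add: w1_def[symmetric] frw wj)
    show "?I (Suc j) (run ?c w)"
    proof (cases "j = 0")
      case True
      then show ?thesis using I unfolding r by (auto simp: frw)
    next
      case False
      then have ja: "j \<in> agents n" using j by simp
      have "w1 ''bad'' 0 0 = 0 \<longleftrightarrow> ?ok j"
        using check_receiver[OF ew sw S _ wj ja] it ja unfolding w1_def[symmetric] pc g_def
        by (simp add: fw)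
      then show ?thesis using I False unfolding r by (auto simp: frw less_Suc_eq)
    qed
  next
    show "?I k (store_upd ''j'' 0 0 l w)" if "?I k w" for k l w using that by simp
  qed simp
  moreover have "run find_receiver s = run (CFor ''j'' ?N ?c) ?s"
    by (simp add: find_receiver_def del: run.simps(5))
  ultimately have "?ok d \<or> (\<forall>j<n + 1. \<not> ?ok j)" unfolding d_def by simp
  moreover have "\<exists>j<n + 1. ?ok j" using ex by (auto simp: less_Suc_eq_le)
  ultimately show ?thesis by blast
qed

lemma worth_pair_count:
  assumes eb: "encodes_bundles n xs A s" and i: "i \<in> agents n" "j \<in> agents n" and A: "A j \<subseteq> M"
  shows "worth i (A j) = pair_count s i j"
proof -
  have "{g \<in> A j. v i {g} = 1} = (!) xs ` {k. k < length xs \<and> owner s k = j \<and> likes i k}"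
  proof (intro equalityI subsetI)
    fix g assume g: "g \<in> {g \<in> A j. v i {g} = 1}"
    then obtain k where k: "k < length xs" "g = xs ! k" using A item_index[of g] by blast
    then show "g \<in> (!) xs ` {k. k < length xs \<and> owner s k = j \<and> likes i k}"
      using g encodes_bundlesD(2)[OF eb k(1) i(2)] i(1) by blast
  next
    fix g assume "g \<in> (!) xs ` {k. k < length xs \<and> owner s k = j \<and> likes i k}"
    then show "g \<in> {g \<in> A j. v i {g} = 1}"
      using encodes_bundlesD(2)[OF eb _ i(2)] by blast
  qed
  moreover have "inj_on ((!) xs) {k. k < length xs \<and> owner s k = j \<and> likes i k}"
    using distinct_xs by (auto simp: inj_on_def nth_eq_iff_index_eq)
  ultimately show ?thesis unfolding pair_count_def by (simp add: card_image)
qed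

text \<open>The search succeeds by \<open>receiver_ex\<close>; had it failed, \<open>dest\<close>
  would be 0 and the store would match no transition.\<close>

lemma place_phase:
  assumes norm: "normalized n M v" "n \<le> 7"
    and enc: "encodes_env (Placing S A R g) s" and inv: "config_inv (Placing S A R g)"
  shows "\<exists>c'. ls_step n M v (Placing S A R g) c' \<and> encodes_env c' (run place_phase s)"
proof -
  have e: "env s" and ph: "s ''phase'' 0 0 = 3" "s ''B'' 0 0 = capa"
    and eb: "encodes_bundles n xs A s" and es: "encodes_sets n xs S R s"
    and it: "s ''item'' 0 0 < length xs" "xs ! (s ''item'' 0 0) = g"
    using enc unfolding encodes_env_def by auto
  have gR: "g \<notin> R" and sc: "scatter_inv S A (insert g R)" using inv by auto
  note I = scatter_inv_facts[OF sc]
  have A: "A j \<subseteq> M" "g \<notin> A j" if "j \<in> agents n" for j using I(3) that by blast+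
  have gM: "g \<in> M" using I(2) by blast
  \<comment> \<open>Agents of \<open>tau v S g\<close> value \<open>g\<close>, which turns the bound
    after the insertion into a strict bound before it.\<close>
  have crit: "v i (A j \<union> {g}) \<le> real capa \<longleftrightarrow> pair_count s i j < s ''B'' 0 0"
    if i: "i \<in> tau v S g" and j: "j \<in> agents n" for i j
  proof -
    have ia: "i \<in> agents n" "v i {g} = 1" using i I(1) unfolding tau_def by blast+
    have "insert g (A j) \<subseteq> M" using A(1)[OF j] gM by blast
    from v_eq_worth[OF ia(1) this] have "v i (A j \<union> {g}) = real (worth i (A j) + 1)"
      using worth_insert[OF A[OF j], of i] ia(2) by simp
    then have "v i (A j \<union> {g}) = real (pair_count s i j + 1)"
      unfolding worth_pair_count[OF eb ia(1) j A(1)[OF j]] .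
    then show ?thesis unfolding ph(2) by (simp only: of_nat_le_iff) linarith
  qed
  define d where "d = run find_receiver s ''dest'' 0 0"
  obtain j where j: "j \<in> agents n - tau v S g" "\<forall>i\<in>tau v S g. v i (A j \<union> {g}) \<le> real capa"
    using receiver_ex[OF norm sc, of g] by blast
  then have "\<forall>i\<in>tau v S g. pair_count s i j < s ''B'' 0 0" using crit by blast
  then have "\<exists>j\<in>agents n - tau v S g. \<forall>i\<in>tau v S g. pair_count s i j < s ''B'' 0 0" using j(1) by blast
  then have d: "d \<in> agents n - tau v S g" "\<forall>i\<in>tau v S g. pair_count s i d < s ''B'' 0 0"
    using find_receiver[OF e es I(1) it(1)] unfolding d_def it(2) by blast+
  then have "\<forall>i\<in>tau v S g. v i (A d \<union> {g}) \<le> real capa" using crit by blast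
  with d(1) have step: "ls_step n M v (Placing S A R g) (Scattering S (A(d := A d \<union> {g})) R)"
    by (rule ls_step.place)
  define u where "u = run place_phase s"
  define s1 where "s1 = run find_receiver s"
  have fr1: "s1 y = s y" if "y \<notin> {''cnt'', ''k'', ''bad'', ''i'', ''j'', ''dest''}" for y
    unfolding s1_def using that by (intro run_frame) simp
  have u: "u = store_upd ''phase'' 0 0 2 (store_upd ''owner'' (s ''item'' 0 0) 0 d s1)"
    unfolding u_def place_phase_def by (simp add: s1_def[symmetric] d_def fr1)
  have ou: "owner u k = (if k = s ''item'' 0 0 then d else owner s k)" for k
    unfolding u by (simp add: owner_def fr1)
  have fu: "u y = s y" if "y \<in> {''n'', ''m'', ''val'', ''S'', ''R'', ''B''}" for y
    using that unfolding u by (auto simp: fr1)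
  let ?A = "A(d := A d \<union> {g})"
  have "encodes_bundles n xs ?A u"
    unfolding encodes_bundles_def owner_def[symmetric] ou
  proof (intro allI impI conjI ballI)
    fix k assume k: "k < length xs"
    show "(if k = s ''item'' 0 0 then d else owner s k) \<le> n"
      using encodes_bundlesD(1)[OF eb k] d(1) by simp
    fix j assume j: "j \<in> agents n"
    note E = encodes_bundlesD(2)[OF eb k j]
    show "((if k = s ''item'' 0 0 then d else owner s k) = j) = (xs ! k \<in> ?A j)"
    proof (cases "k = s ''item'' 0 0")
      case True
      then show ?thesis using it(2) A(2)[OF j] by auto
    next
      case False
      then have "xs ! k \<noteq> g" using it k distinct_xs by (metis nth_eq_iff_index_eq)
      then show ?thesis using False E by auto
    qed
  qed
  moreover have "encodes_sets n xs S R u" using es unfolding encodes_sets_def by (simp add: fu)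
  moreover have "env u" by (rule env_cong[OF e]) (simp_all add: fu)
  moreover have "u ''phase'' 0 0 = 2" by (simp add: u)
  moreover have "u ''B'' 0 0 = capa" using ph(2) by (simp add: fu)
  ultimately have "encodes_env (Scattering S ?A R) u" unfolding encodes_env_def by simp
  then show ?thesis using step unfolding u_def by blast
qed

section \<open>The complete program\<close>

lemma encodes_env_input: "encodes_env Start (input_store n v xs)"
  unfolding encodes_env_def env_def by (simp add: input_store_def)

text \<open>The bound on the phase makes the test of the main loop succeed, so that each round
  simulates exactly one transition.\<close>

lemma body_step:
  assumes norm: "normalized n M v" "n \<le> 7"
    and enc: "encodes_env c s" and inv: "config_inv c" and nd: "\<nexists>A. c = Done A"
  shows "s ''phase'' 0 0 < 4 \<and> (\<exists>c'. ls_step n M v c c' \<and> encodes_env c' (run body s))"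
proof (cases c)
  case Start
  have s: "s = input_store n v xs" using enc Start by (simp add: encodes_env_def)
  have ph: "s ''phase'' 0 0 = 0" and o0: "owner s k = 0" for k
    by (simp_all add: s input_store_def owner_def)
  have e: "env s" using enc by (simp add: encodes_env_def)
  note L = level_phase[OF e o0]
  have "run body s = run level_phase s" using ph by (simp add: body_def)
  then show ?thesis using ls_step.level[OF L(2)] L(1,3) ph unfolding Start encodes_env_def by auto
next
  case (Swapping S P R)
  then have ph: "s ''phase'' 0 0 = 1" using enc by (simp add: encodes_env_def)
  have "run body s = run swap_phase s" using ph by (simp add: body_def)
  then show ?thesis using swap_phase[of S P R s] enc inv ph unfolding Swapping by simp
next
  case (Scattering S A R)
  then have ph: "s ''phase'' 0 0 = 2" using enc by (simp add: encodes_env_def)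
  have "run body s = run pick_phase s" using ph by (simp add: body_def)
  then show ?thesis using pick_phase[of S A R s] enc inv ph unfolding Scattering by simp
next
  case (Placing S A R g)
  then have ph: "s ''phase'' 0 0 = 3" using enc by (simp add: encodes_env_def)
  have "run body s = run place_phase s" using ph by (simp add: body_def)
  then show ?thesis using place_phase[OF norm, of S A R g s] enc inv ph unfolding Placing by simp
next
  case (Done A)
  then show ?thesis using nd by blast
qed

end

context enumerated_instance
begin

text \<open>The rank bounds the number of rounds. A round pays for the body and one successful test;
  the final 1 is the failing test.\<close>

lemma main_loop_tracks:
  assumes norm: "normalized n M v" "n \<le> 7" and enc: "encodes_env c s" and inv: "config_inv c"
  shows "\<exists>T s' A. exec (main_loop (compile body)) s T s' \<and>
    T \<le> rank c * (poly (cost body) (n + length xs) + 1) + 1 \<and>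
    tracks n M v xs (compile body) c s (Done A) s'"
  using enc inv
proof (induction "rank c" arbitrary: c s rule: less_induct)
  case less
  let ?C = "poly (cost body) (n + length xs)"
  have es: "encodes n M v xs c s" "env s" using less.prems(1) by (simp_all add: encodes_env_def)
  show ?case
  proof (cases "\<exists>A. c = Done A")
    case True
    then obtain A where A: "c = Done A" by blast
    have "exec (main_loop (compile body)) s 1 s"
      unfolding main_loop_def using es A by (intro exec.Loop_False) simp
    moreover have "tracks n M v xs (compile body) c s (Done A) s"
      using es(1) unfolding A by (rule tracks.refl)
    ultimately show ?thesis by (intro exI[of _ 1] exI[of _ s] exI[of _ A]) simp
  next
    case False
    then have nd: "\<nexists>A. c = Done A" by simp
    obtain c' where c': "s ''phase'' 0 0 < 4" "ls_step n M v c c'" "encodes_env c' (run body s)"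
      using body_step[OF norm less.prems nd] by blast
    obtain T where T: "T \<le> ?C" "exec (compile body) s T (run body s)"
      using exec_compile[OF wf_body, of s] envD(1,2)[OF es(2)] by auto
    have r: "config_inv c'" "rank c' < rank c" using step_inv[OF c'(2) less.prems(2)] by blast+
    obtain U s' A where U: "exec (main_loop (compile body)) (run body s) U s'"
      "U \<le> rank c' * (?C + 1) + 1" "tracks n M v xs (compile body) c' (run body s) (Done A) s'"
      using less.hyps[OF r(2) c'(3) r(1)] by blast
    have "exec (main_loop (compile body)) s (T + U + 1) s'"
      using c'(1) T(2) U(1) unfolding main_loop_def by (intro exec.Loop_True) simp_all
    moreover have "Suc (rank c') * (?C + 1) \<le> rank c * (?C + 1)"
      using r(2) by (intro mult_right_mono) simp_all
    then have "T + U + 1 \<le> rank c * (?C + 1) + 1" using T(1) U(2) by simp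
    moreover have "tracks n M v xs (compile body) c s (Done A) s'"
      by (rule tracks.step[OF es(1) c'(2) T(2) U(3)])
    ultimately show ?thesis by blast
  qed
qed

text \<open>\<open>[:3, 3:]\<close> comes from the initial rank \<open>3 * card M + 3\<close>,
  bounded in terms of \<open>n + card M\<close>.\<close>

lemma program_correct:
  assumes "normalized n M v" "n \<le> 7"
  shows "\<exists>T s A. exec (main_loop (compile body)) (input_store n v xs) T s \<and>
    T \<le> poly ([:3, 3:] * (cost body + 1) + 1) (n + card M) \<and>
    tracks n M v xs (compile body) Start (input_store n v xs) (Done A) s"
proof -
  let ?C = "poly (cost body) (n + length xs)"
  have m: "card M = length xs" using distinct_card[OF distinct_xs] set_xs by simp
  obtain T s A where T: "exec (main_loop (compile body)) (input_store n v xs) T s"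
    "T \<le> rank (Start :: 'a config) * (?C + 1) + 1"
    "tracks n M v xs (compile body) Start (input_store n v xs) (Done A) s"
    using main_loop_tracks[OF assms encodes_env_input] by auto
  have "rank (Start :: 'a config) * (?C + 1) \<le> (3 * (n + length xs) + 3) * (?C + 1)"
    by (intro mult_right_mono) (simp_all add: m)
  then have "T \<le> poly ([:3, 3:] * (cost body + 1) + 1) (n + card M)"
    using T(2) by (simp add: m algebra_simps)
  then show ?thesis using T by blast
qed

end

theorem theorem3:
  shows "(\<forall>n (M :: 'a set) v.
            binary_goods_instance n M v \<and> normalized n M v \<and> n \<le> 7 \<longrightarrow>
            (\<forall>c. (ls_step n M v)\<^sup>*\<^sup>* Start c \<longrightarrow>
               (\<forall>A. c = Done A \<longrightarrow> allocation n M A \<and> EF1 n v A \<and> EQ1 n v A) \<and>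
               ((\<nexists>A. c = Done A) \<longrightarrow> (\<exists>c'. ls_step n M v c c'))))
       \<and> (\<exists>q :: nat poly. \<forall>n (M :: 'a set) v.
            binary_goods_instance n M v \<and> normalized n M v \<and> n \<le> 7 \<longrightarrow>
            (\<forall>l c. (ls_step n M v ^^ l) Start c \<longrightarrow> l \<le> poly q (n + card M)))
       \<and> (\<exists>body (q :: nat poly). \<forall>n (M :: 'a set) v xs.
            binary_goods_instance n M v \<and> normalized n M v \<and> n \<le> 7 \<and>
            distinct xs \<and> set xs = M \<longrightarrow>
            (\<exists>T s A. exec (main_loop body) (input_store n v xs) T s \<and>
                     T \<le> poly q (n + card M) \<and>
                     tracks n M v xs body Start (input_store n v xs) (Done A) s))"
proof (intro conjI)
  show "\<forall>n (M :: 'a set) v.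
            binary_goods_instance n M v \<and> normalized n M v \<and> n \<le> 7 \<longrightarrow>
            (\<forall>c. (ls_step n M v)\<^sup>*\<^sup>* Start c \<longrightarrow>
               (\<forall>A. c = Done A \<longrightarrow> allocation n M A \<and> EF1 n v A \<and> EQ1 n v A) \<and>
               ((\<nexists>A. c = Done A) \<longrightarrow> (\<exists>c'. ls_step n M v c c')))"
  proof (intro allI impI)
    fix n and M :: "'a set" and v c
    assume H: "binary_goods_instance n M v \<and> normalized n M v \<and> n \<le> 7"
      and c: "(ls_step n M v)\<^sup>*\<^sup>* Start c"
    interpret binary_instance n M v using H by unfold_locales blast
    obtain l where "(ls_step n M v ^^ l) Start c" using rtranclp_imp_relpowp[OF c] by blast
    then have inv: "config_inv c" using steps_inv by blast
    have "\<forall>A. c = Done A \<longrightarrow> allocation n M A \<and> EF1 n v A \<and> EQ1 n v A" using inv by auto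
    moreover have "\<exists>c'. ls_step n M v c c'" if "\<nexists>A. c = Done A"
      using progress[OF _ _ inv that] H by blast
    ultimately show "(\<forall>A. c = Done A \<longrightarrow> allocation n M A \<and> EF1 n v A \<and> EQ1 n v A) \<and>
      ((\<nexists>A. c = Done A) \<longrightarrow> (\<exists>c'. ls_step n M v c c'))" by blast
  qed
next
  show "\<exists>q :: nat poly. \<forall>n (M :: 'a set) v.
            binary_goods_instance n M v \<and> normalized n M v \<and> n \<le> 7 \<longrightarrow>
            (\<forall>l c. (ls_step n M v ^^ l) Start c \<longrightarrow> l \<le> poly q (n + card M))"
  proof (intro exI[of _ "[:3, 3:]"] allI impI)
    fix n and M :: "'a set" and v l c
    assume H: "binary_goods_instance n M v \<and> normalized n M v \<and> n \<le> 7"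
      and c: "(ls_step n M v ^^ l) Start c"
    interpret binary_instance n M v using H by unfold_locales blast
    have "l + rank c \<le> 3 * card M + 3" using steps_inv[OF c] by blast
    then show "l \<le> poly [:3, 3:] (n + card M)" by simp
  qed
next
  show "\<exists>body (q :: nat poly). \<forall>n (M :: 'a set) v xs.
            binary_goods_instance n M v \<and> normalized n M v \<and> n \<le> 7 \<and>
            distinct xs \<and> set xs = M \<longrightarrow>
            (\<exists>T s A. exec (main_loop body) (input_store n v xs) T s \<and>
                     T \<le> poly q (n + card M) \<and>
                     tracks n M v xs body Start (input_store n v xs) (Done A) s)"
  \<comment> \<open>Program and polynomial mention no instance, so a single program serves all of
    them.\<close>
  proof (intro exI[of _ "compile body"] exI[of _ "[:3, 3:] * (cost body + 1) + 1"] allI impI)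
    fix n and M :: "'a set" and v xs
    assume H: "binary_goods_instance n M v \<and> normalized n M v \<and> n \<le> 7 \<and> distinct xs \<and> set xs = M"
    interpret enumerated_instance n M v xs using H by unfold_locales blast+
    show "\<exists>T s A. exec (main_loop (compile body)) (input_store n v xs) T s \<and>
      T \<le> poly ([:3, 3:] * (cost body + 1) + 1) (n + card M) \<and>
      tracks n M v xs (compile body) Start (input_store n v xs) (Done A) s"
      using program_correct H by blast
  qed
qed

end
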